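(* Let $r\ge 2$ and $n\ge 1$. The Foulkes characters $\phi_0,\phi_1,\ldots,\phi_n$ of $G_n=G(r,1,n)$ form an orthonormal basis for the Hilbert space $\mathrm{CF}_\ell(G_n)$ with inner product $$[\vartheta,\psi]=\frac{1}{|G_n|}\sum_{i,j=0}^{n}\vartheta(C_i)\,\overline{\psi(C_j)}\,\mu(C_i,C_j),$$ where $\mu$ is the convex combination of expectations defined in the context.
   Context: Fix an integer $r>1$, a primitive $r$-th root of unity $\zeta$, and $Z=\langle\zeta\rangle$. $G_n=G(r,1,n)$ is the group of $n\times n$ complex matrices with exactly one nonzero entry in each row and column, all nonzero entries lying in $Z$. Each $x\in G_n$ is $x=D A_\pi$ with $D$ diagonal and $A_\pi=(\delta_{i\pi(j)})$, $\pi\in S_n$. The type of $x$ is the $r$-tuple of partitions $\lambda=(\lambda^0,\ldots,\lambda^{r-1})$, where the parts of $\lambda^j$ are the lengths of the cycles $(i_1\,i_2\,\ldots\,i_k)$ of $\pi$ with $x_{i_1i_2}x_{i_2i_3}\cdots x_{i_ki_1}=\zeta^j$; conjugacy classes correspond to types, and $K_\lambda$ is the class of elements of type $\lambda$. $\ell(x)$ is the number of parts of $\lambda^0$ (equivalently $\ell(x)=\dim\ker(x-1)$), and $C_i=\{x\in G_n\mid\ell(x)=i\}$, $0\le i\le n$. $\mathrm{CF}_\ell(G_n)$ is the complex vector space of functions $G_n\to\mathbb{C}$ depending only on $\ell$; $\vartheta(C_i)$ is the common value of such a $\vartheta$ on $C_i$. The Foulkes characters $\phi_0,\ldots,\phi_n$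 of $G_n$ are given by $\phi_i(x)=\sum_{j=0}^{n}(-1)^{i-j}\binom{n+1}{i-j}(rj+1)^{\ell(x)}$, with $\binom{a}{b}=0$ for $b<0$. For a sequence $\mathfrak a=(K_1,\ldots,K_m)$ of conjugacy classes of $G_n$, let $\mu_{\mathfrak a}(C_i,C_j)=\mathbf{E}\,|k_1k_2\cdots k_m C_i\cap C_j|$, where $k_1,\ldots,k_m$ are independent and $k_u$ is uniformly random in $K_u$. Let $\mathfrak a_1=(K_{((n),\emptyset,\ldots,\emptyset)},K_{((n),\emptyset,\ldots,\emptyset)})$, $\mathfrak a_2=(K_{((n),\emptyset,\ldots,\emptyset)},K_{(\emptyset,(n),\emptyset,\ldots,\emptyset)})$, $\mathfrak a_3=(K_{((n),\emptyset,\ldots,\emptyset)},K_{((n-1),(1),\emptyset,\ldots,\emptyset)})$, $\mathfrak a_4=(K_{((n),\emptyset,\ldots,\emptyset)},K_{((n),\emptyset,\ldots,\emptyset)},K_{((n-1,1),\emptyset,\ldots,\emptyset)},K_{((n-1,1),\emptyset,\ldots,\emptyset)})$, $\mathfrak a_5=(K_{((n),\emptyset,\ldots,\emptyset)},K_{((n),\emptyset,\ldots,\emptyset)},K_{((n-1),(1),\emptyset,\ldots,\emptyset)},K_{((n-1,1),\emptyset,\ldots,\emptyset)})$, and $\mu_i=\mu_{\mathfrak a_i}$. If $n=1$, $\mu=\frac{2}{r}\mu_1+\frac{r-2}{r}\mu_2$. If $n\ge 2$, $\mu=\frac1r\mu_1+\frac{r-2}{2r}\mu_2+\frac14\mu_3+\frac1{2r}\mu_4+\frac{r-2}{4r}\mu_5$.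 *)

theory Defs
  imports
    "HOL-Library.Function_Algebras"
    "HOL-Library.Multiset"
    "HOL-Combinatorics.Orbits"
    "HOL-Probability.Product_PMF"
    "Jordan_Normal_Form.Matrix"
begin

definition primitive_root_of_unity :: "nat \<Rightarrow> complex \<Rightarrow> bool" where
  "primitive_root_of_unity r \<zeta> \<longleftrightarrow> r > 0 \<and> \<zeta> ^ r = 1 \<and> (\<forall>k. 0 < k \<and> k < r \<longrightarrow> \<zeta> ^ k \<noteq> 1)"


section \<open>The groups $G(r,1,n)$\<close>

text \<open>Rows and columns are indexed by \<open>{0..<n}\<close>. The set \<open>{\<zeta> ^ k | k < r}\<close> is the cyclic group
  generated by the primitive \<open>r\<close>-th root of unity \<open>\<zeta>\<close>.\<close>

definition refl_group :: "nat \<Rightarrow> complex \<Rightarrow> nat \<Rightarrow> complex mat set" where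
  "refl_group r \<zeta> n = {x \<in> carrier_mat n n.
     (\<forall>i<n. \<exists>!j. j < n \<and> x $$ (i, j) \<noteq> 0) \<and>
     (\<forall>j<n. \<exists>!i. i < n \<and> x $$ (i, j) \<noteq> 0) \<and>
     (\<forall>i<n. \<forall>j<n. x $$ (i, j) \<noteq> 0 \<longrightarrow> x $$ (i, j) \<in> {\<zeta> ^ k | k. k < r})}"

definition perm_matrix :: "nat \<Rightarrow> (nat \<Rightarrow> nat) \<Rightarrow> complex mat" where
  "perm_matrix n p = mat n n (\<lambda>(i, j). if i = p j then 1 else 0)"

definition perm_part :: "nat \<Rightarrow> complex mat \<Rightarrow> nat \<Rightarrow> nat" where
  "perm_part n x = (THE p. p permutes {0..<n} \<and>
     (\<exists>D \<in> carrier_mat n n. diagonal_mat D \<and> x = D * perm_matrix n p))"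

definition cycle_sets :: "nat \<Rightarrow> (nat \<Rightarrow> nat) \<Rightarrow> nat set set" where
  "cycle_sets n p = orbit p ` {0..<n}"

text \<open>The nonzero entry of \<open>x\<close> in column \<open>j\<close> is \<open>x $$ (p j, j)\<close> for \<open>p\<close> the permutation part of
  \<open>x\<close>. The cyclic product $x_{i_1 i_2} x_{i_2 i_3} \cdots x_{i_k i_1}$ of the nonzero entries along
  a cycle, in which $i_u = p(i_{u+1})$, is therefore the following product over the support of the
  cycle.\<close>

definition cycle_product :: "nat \<Rightarrow> complex mat \<Rightarrow> nat set \<Rightarrow> complex" where
  "cycle_product n x C = (\<Prod>j\<in>C. x $$ (perm_part n x j, j))"

text \<open>Types are lists of \<open>r\<close> partitions, a partition being the multiset of its parts.\<close>

definition mat_type :: "nat \<Rightarrow> complex \<Rightarrow> nat \<Rightarrow> complex mat \<Rightarrow> nat multiset list" where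
  "mat_type r \<zeta> n x = map (\<lambda>j. image_mset card
     (mset_set {C \<in> cycle_sets n (perm_part n x). cycle_product n x C = \<zeta> ^ j})) [0..<r]"

definition conj_class :: "nat \<Rightarrow> complex \<Rightarrow> nat \<Rightarrow> nat multiset list \<Rightarrow> complex mat set" where
  "conj_class r \<zeta> n lam = {x \<in> refl_group r \<zeta> n. mat_type r \<zeta> n x = lam}"

definition ell :: "nat \<Rightarrow> complex \<Rightarrow> nat \<Rightarrow> complex mat \<Rightarrow> nat" where
  "ell r \<zeta> n x = size (mat_type r \<zeta> n x ! 0)"

definition ell_class :: "nat \<Rightarrow> complex \<Rightarrow> nat \<Rightarrow> nat \<Rightarrow> complex mat set" where
  "ell_class r \<zeta> n i = {x \<in> refl_group r \<zeta> n. ell r \<zeta> n x = i}"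


section \<open>Functions depending only on \<open>\<ell>\<close>\<close>

text \<open>A function on the group is represented by a function on all complex matrices that vanishes
  outside the group.\<close>

definition CF_ell :: "nat \<Rightarrow> complex \<Rightarrow> nat \<Rightarrow> (complex mat \<Rightarrow> complex) set" where
  "CF_ell r \<zeta> n = {f. (\<forall>x. x \<notin> refl_group r \<zeta> n \<longrightarrow> f x = 0) \<and>
     (\<forall>x\<in>refl_group r \<zeta> n. \<forall>y\<in>refl_group r \<zeta> n. ell r \<zeta> n x = ell r \<zeta> n y \<longrightarrow> f x = f y)}"

definition class_value :: "nat \<Rightarrow> complex \<Rightarrow> nat \<Rightarrow> (complex mat \<Rightarrow> complex) \<Rightarrow> nat \<Rightarrow> complex" where
  "class_value r \<zeta> n f i = (THE c. \<forall>x\<in>ell_class r \<zeta> n i. f x = c)"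

text \<open>The guard \<open>j \<le> i\<close> implements the convention that binomial coefficients with negative lower
  index vanish.\<close>

definition foulkes_char :: "nat \<Rightarrow> complex \<Rightarrow> nat \<Rightarrow> nat \<Rightarrow> complex mat \<Rightarrow> complex" where
  "foulkes_char r \<zeta> n i x = (if x \<in> refl_group r \<zeta> n then
     (\<Sum>j=0..n. if j \<le> i
        then (-1) ^ (i - j) * of_nat ((n + 1) choose (i - j)) * of_nat (r * j + 1) ^ ell r \<zeta> n x
        else 0) else 0)"


section \<open>The form\<close>

text \<open>\<open>Pi_pmf\<close> is the joint distribution of the independent variables \<open>k 0, \<dots>, k (m - 1)\<close>; its
  second argument is only the value of \<open>k\<close> outside the index set.\<close>

definition mu_seq :: "nat \<Rightarrow> complex \<Rightarrow> nat \<Rightarrow> complex mat set list \<Rightarrow> nat \<Rightarrow> nat \<Rightarrow> real" where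
  "mu_seq r \<zeta> n Ks i j = measure_pmf.expectation
     (Pi_pmf {0..<length Ks} (1\<^sub>m n) (\<lambda>u. pmf_of_set (Ks ! u)))
     (\<lambda>k. real (card (((\<lambda>x. foldr (*) (map k [0..<length Ks]) (1\<^sub>m n) * x) ` ell_class r \<zeta> n i)
                      \<inter> ell_class r \<zeta> n j)))"

definition mu :: "nat \<Rightarrow> complex \<Rightarrow> nat \<Rightarrow> nat \<Rightarrow> nat \<Rightarrow> real" where
  "mu r \<zeta> n i j =
    (let K = conj_class r \<zeta> n;
         A = K ({#n#} # replicate (r - 1) {#});
         B = K ({#} # {#n#} # replicate (r - 2) {#});
         C = K ({#n - 1#} # {#1#} # replicate (r - 2) {#});
         D = K ({#n - 1, 1#} # replicate (r - 1) {#});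
         \<mu>1 = mu_seq r \<zeta> n [A, A] i j;
         \<mu>2 = mu_seq r \<zeta> n [A, B] i j;
         \<mu>3 = mu_seq r \<zeta> n [A, C] i j;
         \<mu>4 = mu_seq r \<zeta> n [A, A, D, D] i j;
         \<mu>5 = mu_seq r \<zeta> n [A, A, C, D] i j
     in if n = 1 then 2 / real r * \<mu>1 + (real r - 2) / real r * \<mu>2
        else 1 / real r * \<mu>1 + (real r - 2) / (2 * real r) * \<mu>2 + 1 / 4 * \<mu>3
             + 1 / (2 * real r) * \<mu>4 + (real r - 2) / (4 * real r) * \<mu>5)"

definition foulkes_inner ::
    "nat \<Rightarrow> complex \<Rightarrow> nat \<Rightarrow> (complex mat \<Rightarrow> complex) \<Rightarrow> (complex mat \<Rightarrow> complex) \<Rightarrow> complex" where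
  "foulkes_inner r \<zeta> n \<theta> \<psi> = 1 / of_nat (card (refl_group r \<zeta> n)) *
     (\<Sum>i=0..n. \<Sum>j=0..n.
        class_value r \<zeta> n \<theta> i * cnj (class_value r \<zeta> n \<psi> j) * complex_of_real (mu r \<zeta> n i j))"


section \<open>Hilbert spaces of complex functions\<close>

definition fun_scale :: "complex \<Rightarrow> ('a \<Rightarrow> complex) \<Rightarrow> 'a \<Rightarrow> complex" where
  "fun_scale c f = (\<lambda>x. c * f x)"

global_interpretation cfun: vector_space "fun_scale :: complex \<Rightarrow> ('a \<Rightarrow> complex) \<Rightarrow> 'a \<Rightarrow> complex"
  by standard (auto simp: fun_scale_def fun_eq_iff algebra_simps)

definition inner_product_on ::
    "('a \<Rightarrow> complex) set \<Rightarrow> (('a \<Rightarrow> complex) \<Rightarrow> ('a \<Rightarrow> complex) \<Rightarrow> complex) \<Rightarrow> bool" where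
  "inner_product_on V ip \<longleftrightarrow>
     (\<forall>f\<in>V. \<forall>g\<in>V. \<forall>h\<in>V. ip (f + g) h = ip f h + ip g h) \<and>
     (\<forall>c. \<forall>f\<in>V. \<forall>g\<in>V. ip (fun_scale c f) g = c * ip f g) \<and>
     (\<forall>f\<in>V. \<forall>g\<in>V. ip g f = cnj (ip f g)) \<and>
     (\<forall>f\<in>V. f \<noteq> 0 \<longrightarrow> ip f f \<in> \<real> \<and> Re (ip f f) > 0)"

definition hilbert_space_on ::
    "('a \<Rightarrow> complex) set \<Rightarrow> (('a \<Rightarrow> complex) \<Rightarrow> ('a \<Rightarrow> complex) \<Rightarrow> complex) \<Rightarrow> bool" where
  "hilbert_space_on V ip \<longleftrightarrow> cfun.subspace V \<and> inner_product_on V ip \<and>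
     (let nrm = (\<lambda>f. sqrt (Re (ip f f))) in
      \<forall>s :: nat \<Rightarrow> 'a \<Rightarrow> complex. (\<forall>k. s k \<in> V) \<and>
          (\<forall>\<epsilon>>0. \<exists>N. \<forall>k\<ge>N. \<forall>l\<ge>N. nrm (s k - s l) < \<epsilon>)
        \<longrightarrow> (\<exists>f\<in>V. (\<lambda>k. nrm (s k - f)) \<longlonglongrightarrow> 0))"

text \<open>A basis in the algebraic sense; this is the Hilbert space notion for a finite index set.\<close>

definition orthonormal_basis_on ::
    "('a \<Rightarrow> complex) set \<Rightarrow> (('a \<Rightarrow> complex) \<Rightarrow> ('a \<Rightarrow> complex) \<Rightarrow> complex) \<Rightarrow>
     'i set \<Rightarrow> ('i \<Rightarrow> 'a \<Rightarrow> complex) \<Rightarrow> bool" where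
  "orthonormal_basis_on V ip I b \<longleftrightarrow>
     inj_on b I \<and> cfun.independent (b ` I) \<and> cfun.span (b ` I) = V \<and>
     (\<forall>i\<in>I. \<forall>j\<in>I. ip (b i) (b j) = (if i = j then 1 else 0))"

end

theory Submission
  imports Defs "HOL-Computational_Algebra.Computational_Algebra"
begin

text \<open>The functions $(ra+1)^{\ell}$, $0 \le a \le n$, are the permutation characters of $G_n$ on
  words, and $\phi_0,\dots,\phi_n$ arise from them by inverting $(1-x)^{-(n+1)}$. So it suffices to show
  \[ [(ra+1)^\ell, (rb+1)^\ell] = \sum_{i=0}^n {n+a-i \choose n}{n+b-i \choose n}. \]
  The first factor of every sequence $\mathfrak a_i$ is an $n$-cycle whose colours are uniform among
  those of product $1$. Averaging over these colours turns the form into sums over $S_n$ of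
  $a^{\mathrm{cyc}(\sigma)} b^{\mathrm{cyc}(\pi\sigma)}$, where $\pi$ is a product of random $n$-cycles and
  $(n-1)$-cycles. Three facts about $S_n$ evaluate them. First, the average of $y^{\mathrm{cyc}(cz)}$ over
  $n$-cycles $c$ has generating function proportional to
  $x (1-x)^{-n-2} \prod (1-x^{\lambda_i})$ for $z$ of cycle type $\lambda$ (Stanley), by induction on $n$,
  removing a point of $z$. Second, the coefficients of $\prod (1-x^{\lambda_i})/(1-x)$, which are the hook
  characters up to sign, are orthonormal, by a cycle index computation. Third, the product of a
  random $n$-cycle and a random $(n-1)$-cycle is uniform on the odd permutations.\<close>

section \<open>Cycles of permutations and transpositions\<close>

text \<open>The weights of the convex combination solve a counting problem. Let \<open>T_i\<close>
  be the i-th summand of the target. Averaging over colours splits each sequence into a pairing at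
  (a+1, b+1) with weight 1 and one at (a, b) with weight r - 1 or -1, according as the colours of
  its classes multiply to 1 or to \<zeta>; lowering a and b by one shifts i by one. Two n-cycles
  therefore produce the windows \<open>T_0, ..., T_(n-1)\<close> and \<open>T_1, ..., T_n\<close>,
  and the two sequences of this kind are mixed so that, for n \<ge> 2, each window gets weight 1/2.
  The inner terms are then complete, but \<open>T_0\<close> and \<open>T_n\<close> are counted only
  by halves. The other sequences repair these ends: a product that is uniform on the odd or on the
  even permutations sees only the trivial and the sign character, that is, the first and the last
  term of each window, with opposite signs for the odd and equal signs for the even ones. Together
  both parities supply the missing halves of \<open>T_0\<close> and \<open>T_n\<close>, while
  \<open>T_1\<close> and \<open>T_(n-1)\<close> cancel. For n = 1 there are no inner terms, and the
  two windows themselves are added with weight 1.\<close>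

definition cycle_weight :: "(nat \<Rightarrow> 'b::comm_ring_1) \<Rightarrow> 'a set \<Rightarrow> ('a \<Rightarrow> 'a) \<Rightarrow> 'b" where
  "cycle_weight f S p = (\<Prod>C\<in>orbit p ` S. f (card C))"

lemma orbit_eq_of_mem:
  assumes "finite S" "p permutes S" "y \<in> orbit p x"
  shows "orbit p y = orbit p x"
  using orbit_cyclic_eq3[OF cyclic_on_orbit[OF assms(2,1)] assms(3)] .

lemma mem_orbit_self:
  assumes "finite S" "p permutes S"
  shows "x \<in> orbit p x"
  using permutes_imp_permutation[OF assms] by (rule permutation_self_in_orbit)

lemma orbit_insert_fixed:
  assumes "finite S" "p permutes S" "x \<notin> S"
  shows "orbit p ` insert x S = insert {x} (orbit p ` S)" "{x} \<notin> orbit p ` S"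
proof -
  have "orbit p x = {x}" using assms by (simp add: orbit_eq_singleton_iff permutes_not_in)
  thus "orbit p ` insert x S = insert {x} (orbit p ` S)" by simp
  show "{x} \<notin> orbit p ` S" using permutes_orbit_subset[OF assms(2)] assms(3) by blast
qed

lemma cycle_weight_insert_fixed:
  assumes "finite S" "p permutes S" "x \<notin> S"
  shows "cycle_weight f (insert x S) p = f 1 * cycle_weight f S p"
  using orbit_insert_fixed[OF assms] assms(1) by (simp add: cycle_weight_def)

section \<open>Merging two cycles by a transposition\<close>

lemma orbit_transpose_other:
  assumes "finite S" "p permutes S" "a \<notin> orbit p x" "b \<notin> orbit p x"
  shows "orbit (Transposition.transpose a b \<circ> p) x = orbit p x"
proof (rule orbit_cong)
  show "x \<in> orbit p x" by (rule mem_orbit_self[OF assms(1,2)])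
  fix s assume "s \<in> orbit p x"
  hence "p s \<in> orbit p x" by (rule orbit.step)
  thus "(Transposition.transpose a b \<circ> p) s = p s" using assms(3,4) by (auto simp: Transposition.transpose_def)
qed

text \<open>Starting at \<open>a\<close>, the new permutation follows the old cycle up to the
  preimage of \<open>a\<close>, is diverted from there to \<open>b\<close>, runs through the cycle
  of \<open>b\<close> and is diverted at its end back to \<open>a\<close>.\<close>

lemma orbit_transpose_merge:
  assumes S: "finite S" "p permutes S" and ab: "b \<notin> orbit p a"
  shows "orbit (Transposition.transpose a b \<circ> p) a = orbit p a \<union> orbit p b"
proof
  let ?w = "Transposition.transpose a b \<circ> p"
  have ab': "a \<notin> orbit p b" using ab orbit_eq_of_mem[OF S] mem_orbit_self[OF S] by metis
  have aa: "a \<in> orbit p a" "b \<in> orbit p b" by (rule mem_orbit_self[OF S])+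
  have "y \<in> orbit p a \<union> orbit p b" if "y \<in> orbit ?w a" for y
    using that
  proof induction
    case base
    show ?case using aa orbit.base[of p a] by (auto simp: Transposition.transpose_def)
  next
    case (step y)
    thus ?case using aa orbit.step[of y p] by (auto simp: Transposition.transpose_def)
  qed
  thus "orbit ?w a \<subseteq> orbit p a \<union> orbit p b" by blast
  have per: "permutation p" by (rule permutes_imp_permutation[OF S])
  have "permutation ?w" using per by (simp add: permutation_compose permutation_swap_id)
  hence aw: "a \<in> orbit ?w a" by (rule permutation_self_in_orbit)
  have A: "y \<in> orbit ?w a" if "y \<in> orbit p a" for y
    using that
  proof induction
    case base
    have "p a \<noteq> b" using ab orbit.base by metis
    hence "p a = a \<or> p a = ?w a" by (auto simp: Transposition.transpose_def)
    thus ?case using aw orbit.base[of ?w a] by metis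
  next
    case (step y)
    have "p y \<noteq> b" using ab orbit.step[OF step(1)] by metis
    hence "p y = a \<or> p y = ?w y" by (auto simp: Transposition.transpose_def)
    thus ?case using aw orbit.step[OF step(2)] by metis
  qed
  obtain y where y: "y \<in> orbit p a" "p y = a" using aa(1) orbit.cases aa by metis
  hence bw: "b \<in> orbit ?w a" using orbit.step[OF A[OF y(1)]] by simp
  have B: "y \<in> orbit ?w a" if "y \<in> orbit p b" for y
    using that
  proof induction
    case base
    have "p b \<noteq> a" using ab' orbit.base by metis
    hence "p b = b \<or> p b = ?w b" by (auto simp: Transposition.transpose_def)
    thus ?case using bw orbit.step[OF bw] by metis
  next
    case (step y)
    have "p y \<noteq> a" using ab' orbit.step[OF step(1)] by metis
    hence "p y = b \<or> p y = ?w y" by (auto simp: Transposition.transpose_def)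
    thus ?case using bw orbit.step[OF step(2)] by metis
  qed
  show "orbit p a \<union> orbit p b \<subseteq> orbit ?w a" using A B by blast
qed

lemma orbit_image_merge:
  assumes S: "finite S" "p permutes S" and ab: "a \<in> S" "b \<in> S" "b \<notin> orbit p a"
  shows "orbit (Transposition.transpose a b \<circ> p) ` S =
    insert (orbit p a \<union> orbit p b) (orbit p ` S - {orbit p a, orbit p b})"
    (is "?L = ?R")
proof -
  let ?w = "Transposition.transpose a b \<circ> p"
  have w: "?w permutes S" using S ab by (intro permutes_compose permutes_swap_id)
  have m: "orbit ?w a = orbit p a \<union> orbit p b" by (rule orbit_transpose_merge[OF S ab(3)])
  have cases: "orbit ?w x = (if x \<in> orbit p a \<union> orbit p b then orbit p a \<union> orbit p b else orbit p x)" for x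
  proof (cases "x \<in> orbit p a \<union> orbit p b")
    case True
    thus ?thesis using orbit_eq_of_mem[OF S(1) w] m by metis
  next
    case False
    hence "a \<notin> orbit p x" "b \<notin> orbit p x"
      using orbit_eq_of_mem[OF S] mem_orbit_self[OF S] by blast+
    thus ?thesis using orbit_transpose_other[OF S] False by simp
  qed
  have e: "x \<in> orbit p a \<union> orbit p b \<longleftrightarrow> orbit p x \<in> {orbit p a, orbit p b}" for x
    using orbit_eq_of_mem[OF S] mem_orbit_self[OF S] by blast
  show ?thesis
  proof
    show "?L \<subseteq> ?R" using cases e by auto
    show "?R \<subseteq> ?L"
    proof
      fix C assume "C \<in> ?R"
      then consider "C = orbit p a \<union> orbit p b" | x where "x \<in> S" "C = orbit p x" "C \<notin> {orbit p a, orbit p b}"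
        by blast
      thus "C \<in> ?L"
      proof cases
        case 1 thus ?thesis using m ab(1) by blast
      next
        case 2 thus ?thesis using cases[of x] e[of x] by (metis imageI)
      qed
    qed
  qed
qed

text \<open>Replaces the quotient of \<open>cycle_weight\<close> by the factor of the cycle through
  \<open>a\<close>, since the weights lie in a ring without division.\<close>

definition cycle_coweight :: "(nat \<Rightarrow> 'b::comm_ring_1) \<Rightarrow> 'a set \<Rightarrow> ('a \<Rightarrow> 'a) \<Rightarrow> 'a \<Rightarrow> 'b" where
  "cycle_coweight f S p a = (\<Prod>C\<in>orbit p ` S - {orbit p a}. f (card C))"

lemma cycle_weight_eq_coweight:
  assumes "finite S" "a \<in> S"
  shows "cycle_weight f S p = f (card (orbit p a)) * cycle_coweight f S p a"
  unfolding cycle_weight_def cycle_coweight_def using assms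
  by (intro prod.remove) auto

lemma finite_orbit_permutes:
  assumes "finite S" "p permutes S"
  shows "finite (orbit p x)"
  using finite_orbit[OF mem_orbit_self[OF assms]] .

lemma orbit_disjoint:
  assumes "finite S" "p permutes S" "b \<notin> orbit p a"
  shows "orbit p a \<inter> orbit p b = {}"
  using orbit_eq_of_mem[OF assms(1,2)] mem_orbit_self[OF assms(1,2)] assms(3) by (metis disjoint_iff)

lemma cycle_weight_merge:
  assumes S: "finite S" "p permutes S" and ab: "a \<in> S" "b \<in> S" "b \<notin> orbit p a"
  shows "cycle_weight f S (Transposition.transpose a b \<circ> p) =
    f (card (orbit p a) + card (orbit p b)) *
    (\<Prod>C\<in>orbit p ` S - {orbit p a} - {orbit p b}. f (card C))"
proof -
  have d: "orbit p a \<inter> orbit p b = {}" by (rule orbit_disjoint[OF S ab(3)])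
  have "orbit p a \<union> orbit p b \<notin> orbit p ` S - {orbit p a, orbit p b}"
  proof
    assume "orbit p a \<union> orbit p b \<in> orbit p ` S - {orbit p a, orbit p b}"
    then obtain x where x: "orbit p x = orbit p a \<union> orbit p b" "orbit p x \<noteq> orbit p a" by auto
    hence "a \<in> orbit p x" using mem_orbit_self[OF S] by blast
    thus False using orbit_eq_of_mem[OF S] x by metis
  qed
  moreover have "card (orbit p a \<union> orbit p b) = card (orbit p a) + card (orbit p b)"
    using d finite_orbit_permutes[OF S] by (simp add: card_Un_disjoint)
  moreover have "orbit p ` S - {orbit p a, orbit p b} = orbit p ` S - {orbit p a} - {orbit p b}" by blast
  ultimately show ?thesis
    unfolding cycle_weight_def orbit_image_merge[OF S ab]
    using finite_imageI[OF S(1), of "orbit p"] by (simp only: prod.insert finite_Diff not_False_eq_True)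
qed

text \<open>The new point is a fixed point of \<open>p\<close>, so inserting it into a cycle is a
  merge with a cycle of length one.\<close>

lemma cycle_weight_insert_moved:
  assumes S: "finite S" "p permutes S" "x \<notin> S" "a \<in> S"
  shows "cycle_weight f (insert x S) (Transposition.transpose a x \<circ> p) =
    f (Suc (card (orbit p a))) * cycle_coweight f S p a"
proof -
  have p': "p permutes insert x S" using S(2) by (rule permutes_subset) auto
  have ox: "orbit p x = {x}" using S by (simp add: orbit_eq_singleton_iff permutes_not_in)
  have nx: "x \<notin> orbit p a" using permutes_orbit_subset[OF S(2,4)] S(3) by blast
  have "orbit p ` insert x S - {orbit p a} - {orbit p x} = orbit p ` S - {orbit p a}"
    using orbit_insert_fixed[OF S(1-3)] ox by auto
  moreover have "cycle_weight f (insert x S) (Transposition.transpose a x \<circ> p) =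
      f (card (orbit p a) + card (orbit p x)) *
      (\<Prod>C\<in>orbit p ` insert x S - {orbit p a} - {orbit p x}. f (card C))"
    by (rule cycle_weight_merge[OF _ p' _ _ nx]) (use S in auto)
  ultimately show ?thesis by (simp only: ox cycle_coweight_def) simp
qed

section \<open>Cutting a cycle by a transposition\<close>

lemma orbit_enum:
  fixes a
  assumes S: "finite S" "p permutes S"
  defines "l \<equiv> card (orbit p a)"
  shows "inj_on (\<lambda>i. (p ^^ i) a) {0..<l}" "orbit p a = (\<lambda>i. (p ^^ i) a) ` {0..<l}"
proof -
  have aa: "a \<in> orbit p a" by (rule mem_orbit_self[OF S])
  let ?m = "funpow_dist1 p a a"
  have i: "inj_on (\<lambda>i. (p ^^ i) a) {0..<?m}" by (rule inj_on_funpow_dist1[OF aa])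
  have e: "orbit p a = (\<lambda>i. (p ^^ i) a) ` {0..<?m}" by (rule orbit_conv_funpow_dist1[OF aa])
  have "l = ?m" unfolding l_def by (subst e) (simp add: card_image[OF i])
  thus "inj_on (\<lambda>i. (p ^^ i) a) {0..<l}" "orbit p a = (\<lambda>i. (p ^^ i) a) ` {0..<l}" using i e by simp_all
qed

text \<open>The point before \<open>(p ^^ i) a\<close> is sent by \<open>p\<close> to
  \<open>(p ^^ i) a\<close> and then by the transposition back to \<open>a\<close>, which closes the
  cycle after i steps.\<close>

lemma orbit_transpose_split:
  assumes S: "finite S" "p permutes S" and i: "0 < i" "i < card (orbit p a)"
  shows "orbit (Transposition.transpose a ((p ^^ i) a) \<circ> p) a = (\<lambda>j. (p ^^ j) a) ` {0..<i}"
proof -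
  let ?b = "(p ^^ i) a" and ?w = "Transposition.transpose a ((p ^^ i) a) \<circ> p"
  note en = orbit_enum[OF S, of a]
  have neq: "(p ^^ j) a \<noteq> (p ^^ k) a" if "j < k" "k \<le> i" for j k
    using inj_onD[OF en(1), of j k] that i by auto
  have pw: "(?w ^^ j) a = (p ^^ j) a" if "j < i" for j
    using that
  proof (induction j)
    case (Suc j)
    have "(p ^^ Suc j) a \<noteq> a" using neq[of 0 "Suc j"] Suc.prems by auto
    moreover have "(p ^^ Suc j) a \<noteq> ?b" using neq[of "Suc j" i] Suc.prems by auto
    ultimately show ?case using Suc by (simp add: Transposition.transpose_def)
  qed simp
  have "(?w ^^ i) a = a"
  proof -
    obtain k where k: "i = Suc k" using i by (cases i) auto
    thus ?thesis using pw[of k] by simp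
  qed
  hence "orbit ?w a = {(?w ^^ m) a | m. m < i}" by (rule orbit_altdef_bounded) (rule i)
  also have "\<dots> = (\<lambda>j. (p ^^ j) a) ` {0..<i}" using pw by force
  finally show ?thesis .
qed

lemma cycle_weight_split:
  assumes S: "finite S" "p permutes S" "a \<in> S" and i: "0 < i" "i < card (orbit p a)"
  shows "cycle_weight f S (Transposition.transpose a ((p ^^ i) a) \<circ> p) =
    f i * f (card (orbit p a) - i) * cycle_coweight f S p a"
proof -
  let ?b = "(p ^^ i) a" and ?w = "Transposition.transpose a ((p ^^ i) a) \<circ> p"
  note en = orbit_enum[OF S(1,2), of a]
  have bS: "?b \<in> S" using S(3) permutes_in_funpow_image[OF S(2)] by blast
  have w: "?w permutes S" using S bS by (intro permutes_compose permutes_swap_id)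
  have ow: "orbit ?w a = (\<lambda>j. (p ^^ j) a) ` {0..<i}" by (rule orbit_transpose_split[OF S(1,2) i])
  have bn: "?b \<notin> orbit ?w a"
  proof
    assume "?b \<in> orbit ?w a"
    then obtain j where "j < i" "(p ^^ i) a = (p ^^ j) a" unfolding ow by auto
    thus False using inj_onD[OF en(1), of i j] i by auto
  qed
  \<comment> \<open>Read backwards, \<open>p\<close> is obtained from \<open>?w\<close> by a merging
    transposition. So the cycles of \<open>?w\<close> can be recovered from the merging lemmas,
    applied to \<open>?w\<close>.\<close>
  have tw: "Transposition.transpose a ?b \<circ> ?w = p" by (simp add: comp_assoc[symmetric] fun_eq_iff)
  have inj: "inj_on (\<lambda>j. (p ^^ j) a) {0..<i}" by (rule inj_on_subset[OF en(1)]) (use i in auto)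
  have c1: "card (orbit ?w a) = i" unfolding ow card_image[OF inj] by simp
  have un: "orbit p a = orbit ?w a \<union> orbit ?w ?b"
    using orbit_transpose_merge[OF S(1) w bn] tw by simp
  have d: "orbit ?w a \<inter> orbit ?w ?b = {}" by (rule orbit_disjoint[OF S(1) w bn])
  have c2: "card (orbit ?w ?b) = card (orbit p a) - i"
    using un d c1 finite_orbit_permutes[OF S(1) w] by (simp add: card_Un_disjoint)
  have im: "orbit p ` S = insert (orbit p a) (orbit ?w ` S - {orbit ?w a, orbit ?w ?b})"
    using orbit_image_merge[OF S(1) w S(3) bS bn] tw un by simp
  have nin: "orbit p a \<notin> orbit ?w ` S"
  proof
    assume "orbit p a \<in> orbit ?w ` S"
    then obtain x where x: "orbit ?w x = orbit p a" by auto
    hence "a \<in> orbit ?w x" "?b \<in> orbit ?w x" using un mem_orbit_self[OF S(1) w] by blast+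
    thus False using orbit_eq_of_mem[OF S(1) w] bn by metis
  qed
  have ne: "orbit ?w ?b \<noteq> orbit ?w a" using bn mem_orbit_self[OF S(1) w] by blast
  have eq: "orbit p ` S - {orbit p a} = orbit ?w ` S - {orbit ?w a} - {orbit ?w ?b}"
    using im nin by blast
  have "cycle_weight f S ?w = f i * (f (card (orbit p a) - i) *
      (\<Prod>C\<in>orbit ?w ` S - {orbit ?w a} - {orbit ?w ?b}. f (card C)))"
    unfolding cycle_weight_def
    using S(1,3) bS ne c1 c2
    by (subst prod.remove[of _ "orbit ?w a"], simp, blast, subst prod.remove[of _ "orbit ?w ?b"]) auto
  thus ?thesis unfolding cycle_coweight_def eq by (simp add: mult.assoc)
qed

section \<open>The cycle polynomial and its sum over transpositions\<close>

lemma sum_over_orbits: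
  assumes S: "finite S" "p permutes S" and \<C>: "\<C> \<subseteq> orbit p ` S"
  shows "(\<Sum>x\<in>\<Union>\<C>. g (orbit p x)) = (\<Sum>C\<in>\<C>. of_nat (card C) * (g C :: 'b::comm_ring_1))"
proof -
  have "(\<Sum>x\<in>\<Union>\<C>. g (orbit p x)) = (\<Sum>C\<in>\<C>. \<Sum>x\<in>C. g (orbit p x))"
  proof (rule sum.Union_disjoint[unfolded comp_def])
    show "\<forall>A\<in>\<C>. finite A" using \<C> finite_orbit_permutes[OF S] by blast
    show "\<forall>A\<in>\<C>. \<forall>B\<in>\<C>. A \<noteq> B \<longrightarrow> A \<inter> B = {}"
    proof (intro ballI impI)
      fix A B assume "A \<in> \<C>" "B \<in> \<C>" and ne: "A \<noteq> B"
      then obtain a b where ab: "A = orbit p a" "B = orbit p b" using \<C> by blast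
      have "b \<notin> orbit p a" using ne ab orbit_eq_of_mem[OF S] by metis
      thus "A \<inter> B = {}" using orbit_disjoint[OF S] ab by simp
    qed
  qed
  also have "\<dots> = (\<Sum>C\<in>\<C>. of_nat (card C) * g C)"
  proof (rule sum.cong[OF refl])
    fix C assume "C \<in> \<C>"
    then obtain a where a: "C = orbit p a" using \<C> by blast
    have "(\<Sum>x\<in>C. g (orbit p x)) = (\<Sum>x\<in>C. g C)"
      by (rule sum.cong) (use orbit_eq_of_mem[OF S] a in auto)
    thus "(\<Sum>x\<in>C. g (orbit p x)) = of_nat (card C) * g C" by simp
  qed
  finally show ?thesis .
qed

lemma Union_orbits:
  assumes "finite S" "p permutes S"
  shows "\<Union>(orbit p ` S) = S"
  using permutes_orbit_subset[OF assms(2)] mem_orbit_self[OF assms] by blast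

text \<open>This is det(1 - xP) for the permutation matrix P of \<open>p\<close> on
  \<open>S\<close>: its coefficient at x^k is, up to the sign (-1)^k, the trace of \<open>p\<close>
  on the k-th exterior power of the permutation representation.\<close>

definition cycle_poly :: "'a set \<Rightarrow> ('a \<Rightarrow> 'a) \<Rightarrow> real poly" where
  "cycle_poly = cycle_weight (\<lambda>k. 1 - [:0, 1:] ^ k)"

lemma X_pderiv_power: "[:0, 1:] * pderiv ([:0, 1:] ^ k) = of_nat k * ([:0, 1:] ^ k :: real poly)"
proof (induction k)
  case (Suc k)
  have "pderiv [:0, 1 :: real:] = 1" by (simp add: pderiv_pCons)
  hence "pderiv ([:0, 1 :: real:] ^ Suc k) = [:0, 1:] * pderiv ([:0, 1:] ^ k) + [:0, 1:] ^ k"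
    unfolding power_Suc pderiv_mult by simp
  also have "\<dots> = of_nat (Suc k) * [:0, 1:] ^ k"
    unfolding Suc by (simp only: of_nat_Suc algebra_simps)
  finally show ?case by (simp only: power_Suc ac_simps)
qed simp

text \<open>The contribution of a single cycle of length \<open>l\<close> to
  \<open>sum_transpose_cycle_poly\<close>, where \<open>c\<close> is the number of points outside
  that cycle and \<open>d - 1\<close> the number of all points. Then c + l = d - 1, and the
  right-hand side collapses to (d - 1) (1 - x^(l+1)).\<close>

lemma split_sum:
  fixes x :: "'b::comm_ring_1"
  assumes "l > 0"
  shows "(1 - x) * ((\<Sum>i=1..<l. (1 - x^i) * (1 - x^(l-i))) - of_nat l * x^l + c) + (1 + d * x) * (1 - x^l)
    = (c + of_nat l) * (1 - x) + (d - 1) * x - (d - 1) * x * x ^ l"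
proof -
  have g: "(1 - x) * (\<Sum>i=1..<l. x^i) = x - x^l"
    using assms
  proof (induction l rule: nat_induct_non_zero)
    case (Suc n)
    have "(1 - x) * (\<Sum>i=1..<Suc n. x^i) = (1 - x) * (\<Sum>i=1..<n. x^i) + (1 - x) * x^n"
      using Suc.hyps by (simp add: distrib_left)
    thus ?case unfolding Suc.IH by (simp add: algebra_simps)
  qed simp
  have r: "(\<Sum>i=1..<l. x^(l-i)) = (\<Sum>i=1..<l. x^i)"
    by (rule sum.reindex_bij_witness[of _ "\<lambda>i. l - i" "\<lambda>i. l - i"]) auto
  have "(\<Sum>i=1..<l. (1 - x^i) * (1 - x^(l-i))) = (\<Sum>i=1..<l. (1 + x^l) - x^i - x^(l-i))"
    by (rule sum.cong[OF refl]) (auto simp: algebra_simps power_add[symmetric])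
  also have "\<dots> = of_nat (l - 1) * (1 + x^l) - 2 * (\<Sum>i=1..<l. x^i)"
    unfolding sum_subtractf r by simp
  finally have e: "(\<Sum>i=1..<l. (1 - x^i) * (1 - x^(l-i))) = of_nat (l - 1) * (1 + x^l) - 2 * (\<Sum>i=1..<l. x^i)" .
  have o: "of_nat (l - 1) = (of_nat l - 1 :: 'b)" using assms by (simp add: of_nat_diff)
  have "(1 - x) * ((\<Sum>i=1..<l. (1 - x^i) * (1 - x^(l-i))) - of_nat l * x^l + c)
     = (1 - x) * ((of_nat l - 1) * (1 + x^l) - of_nat l * x^l + c) - 2 * ((1 - x) * (\<Sum>i=1..<l. x^i))"
    unfolding e o by (simp add: algebra_simps)
  thus ?thesis unfolding g by (simp add: algebra_simps)
qed

text \<open>This is what remains of the recurrence \<open>cycle_gf_insert_moved\<close> once the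
  generating functions are written through cycle polynomials. A transposition of \<open>a\<close>
  with a point of its own cycle cuts that cycle, one with any other point merges two cycles. The
  merged terms combine with the derivative in such a way that the lengths of the other cycles enter
  only through their sum.\<close>

lemma sum_transpose_cycle_poly:
  assumes S: "finite S" "p permutes S" "a \<in> S"
  shows "(1 - [:0, 1:]) * ((\<Sum>b\<in>S - {a}. cycle_poly S (Transposition.transpose a b \<circ> p))
      + [:0, 1:] * pderiv (cycle_poly S p)) + (1 + of_nat (Suc (card S)) * [:0, 1:]) * cycle_poly S p =
    of_nat (card S) * ((1 - [:0, 1:] ^ Suc (card (orbit p a)))
      * cycle_coweight (\<lambda>k. 1 - [:0, 1:] ^ k) S p a)"
proof -
  define X where "X = ([:0, 1:] :: real poly)"
  define f where "f = (\<lambda>k. 1 - X ^ k)"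
  define l where "l = card (orbit p a)"
  define R where "R = cycle_coweight f S p a"
  define O' where "O' = orbit p ` S - {orbit p a}"
  define P where "P = (\<lambda>C. \<Prod>D\<in>O' - {C}. f (card D))"
  have Q: "cycle_poly = cycle_weight f" by (simp add: cycle_poly_def f_def X_def)
  have fin: "finite O'" using S(1) by (simp add: O'_def)
  have R: "R = (\<Prod>D\<in>O'. f (card D))" by (simp add: R_def cycle_coweight_def O'_def)
  have RP: "f (card C) * P C = R" if "C \<in> O'" for C
    unfolding R P_def using fin that by (simp add: prod.remove[of O' C])
  have aO: "a \<in> orbit p a" by (rule mem_orbit_self[OF S(1,2)])
  have l0: "l > 0" using aO finite_orbit_permutes[OF S(1,2)] by (auto simp: l_def card_gt_0_iff)
  have OS: "orbit p a \<subseteq> S" by (rule permutes_orbit_subset[OF S(2,3)])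
  note en = orbit_enum[OF S(1,2), of a, folded l_def]
  have Oa: "orbit p a - {a} = (\<lambda>i. (p ^^ i) a) ` {1..<l}"
  proof -
    have "{0..<l} = insert 0 {1..<l}" using l0 by auto
    hence "orbit p a = insert a ((\<lambda>i. (p ^^ i) a) ` {1..<l})" using en(2) by simp
    moreover have "a \<notin> (\<lambda>i. (p ^^ i) a) ` {1..<l}"
    proof
      assume "a \<in> (\<lambda>i. (p ^^ i) a) ` {1..<l}"
      then obtain i where "i \<in> {1..<l}" "(p ^^ 0) a = (p ^^ i) a" by auto
      thus False using inj_onD[OF en(1), of 0 i] by auto
    qed
    ultimately show ?thesis by blast
  qed
  have "(\<Sum>b\<in>orbit p a - {a}. cycle_weight f S (Transposition.transpose a b \<circ> p))
      = (\<Sum>i=1..<l. cycle_weight f S (Transposition.transpose a ((p ^^ i) a) \<circ> p))"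
    unfolding Oa by (rule sum.reindex_cong[OF _ refl refl]) (rule inj_on_subset[OF en(1)], auto)
  also have "\<dots> = (\<Sum>i=1..<l. f i * f (l - i)) * R"
    unfolding sum_distrib_right
    by (rule sum.cong[OF refl]) (use cycle_weight_split[OF S, where f = f] in \<open>auto simp: l_def R_def\<close>)
  finally have s1: "(\<Sum>b\<in>orbit p a - {a}. cycle_weight f S (Transposition.transpose a b \<circ> p))
      = (\<Sum>i=1..<l. f i * f (l - i)) * R" .
  have UO: "\<Union>O' = S - orbit p a"
  proof -
    have u1: "x \<notin> orbit p a" if "x \<in> C" "C \<in> O'" for x C
      using that orbit_eq_of_mem[OF S(1,2)] unfolding O'_def by (metis DiffE imageE insertI1)
    have u2: "x \<in> \<Union>O'" if "x \<in> S" "x \<notin> orbit p a" for x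
    proof
      show "x \<in> orbit p x" by (rule mem_orbit_self[OF S(1,2)])
      thus "orbit p x \<in> O'" using that unfolding O'_def by auto
    qed
    have u3: "C \<subseteq> S" if "C \<in> O'" for C
      using that permutes_orbit_subset[OF S(2)] unfolding O'_def by auto
    show ?thesis
    proof (intro subset_antisym subsetI)
      show "x \<in> S - orbit p a" if "x \<in> \<Union>O'" for x
        using that u1 u3 by (meson DiffI UnionE subsetD)
      show "x \<in> \<Union>O'" if "x \<in> S - orbit p a" for x
        using that u2 by (meson DiffD1 DiffD2)
    qed
  qed
  have "(\<Sum>b\<in>S - orbit p a. cycle_weight f S (Transposition.transpose a b \<circ> p))
    = (\<Sum>b\<in>S - orbit p a. f (l + card (orbit p b)) * P (orbit p b))"
    by (rule sum.cong[OF refl])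
       (use cycle_weight_merge[OF S, where f = f] in \<open>auto simp: l_def P_def O'_def\<close>)
  also have "\<dots> = (\<Sum>C\<in>O'. of_nat (card C) * (f (l + card C) * P C))"
    unfolding UO[symmetric] by (rule sum_over_orbits[OF S(1,2)]) (auto simp: O'_def)
  finally have s2: "(\<Sum>b\<in>S - orbit p a. cycle_weight f S (Transposition.transpose a b \<circ> p))
    = (\<Sum>C\<in>O'. of_nat (card C) * (f (l + card C) * P C))" .
  have "S - {a} = (orbit p a - {a}) \<union> (S - orbit p a)" using OS aO by blast
  hence s3: "(\<Sum>b\<in>S - {a}. cycle_weight f S (Transposition.transpose a b \<circ> p))
    = (\<Sum>i=1..<l. f i * f (l - i)) * R + (\<Sum>C\<in>O'. of_nat (card C) * (f (l + card C) * P C))"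
    unfolding s1[symmetric] s2[symmetric]
    using S(1) finite_orbit_permutes[OF S(1,2)] by (auto intro!: sum.union_disjoint)
  have Xd: "X * pderiv (f k) = - of_nat k * X ^ k" for k
    using X_pderiv_power[of k] by (simp add: f_def X_def pderiv_diff)
  have W: "cycle_weight f S p = f l * R" unfolding l_def R_def by (rule cycle_weight_eq_coweight[OF S(1,3)])
  have "X * pderiv R = (\<Sum>C\<in>O'. P C * (X * pderiv (f (card C))))"
    unfolding R pderiv_prod sum_distrib_left P_def by (simp add: ac_simps)
  hence "X * pderiv (cycle_weight f S p) = R * (X * pderiv (f l)) + f l * (\<Sum>C\<in>O'. P C * (X * pderiv (f (card C))))"
    unfolding W pderiv_mult by (simp add: algebra_simps)
  hence d: "X * pderiv (cycle_weight f S p) = - of_nat l * X ^ l * R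
      - (\<Sum>C\<in>O'. of_nat (card C) * (X ^ card C * f l * P C))"
    unfolding Xd by (simp add: sum_distrib_left sum_negf algebra_simps)
  \<comment> \<open>Here \<open>f (l + k) - X ^ k * f l = f k\<close>, so that the merged cycle
    becomes the original one again and the other cycles contribute only their number of
    points.\<close>
  have "(\<Sum>C\<in>O'. of_nat (card C) * (f (l + card C) * P C)) - (\<Sum>C\<in>O'. of_nat (card C) * (X ^ card C * f l * P C))
     = (\<Sum>C\<in>O'. of_nat (card C) * (f (card C) * P C))"
    unfolding sum_subtractf[symmetric] by (rule sum.cong[OF refl]) (simp add: f_def algebra_simps power_add)
  also have "\<dots> = (\<Sum>C\<in>O'. of_nat (card C) * 1) * R"
    using RP by (simp add: sum_distrib_right)
  also have "(\<Sum>C\<in>O'. of_nat (card C) * (1 :: real poly)) = (\<Sum>x\<in>\<Union>O'. 1)"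
    by (rule sum_over_orbits[OF S(1,2), symmetric]) (auto simp: O'_def)
  also have "\<dots> = of_nat (card S - l)"
    unfolding UO l_def using OS finite_orbit_permutes[OF S(1,2)] by (simp add: card_Diff_subset)
  finally have m: "(\<Sum>C\<in>O'. of_nat (card C) * (f (l + card C) * P C)) - (\<Sum>C\<in>O'. of_nat (card C) * (X ^ card C * f l * P C))
    = of_nat (card S - l) * R" .
  have lS: "l \<le> card S" unfolding l_def by (rule card_mono[OF S(1) OS])
  have tot: "(\<Sum>b\<in>S - {a}. cycle_weight f S (Transposition.transpose a b \<circ> p)) + X * pderiv (cycle_weight f S p)
    = ((\<Sum>i=1..<l. f i * f (l - i)) - of_nat l * X ^ l + of_nat (card S - l)) * R"
    unfolding s3 d using m by (simp add: algebra_simps)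
  have "(1 - X) * ((\<Sum>b\<in>S - {a}. cycle_weight f S (Transposition.transpose a b \<circ> p)) + X * pderiv (cycle_weight f S p))
      + (1 + of_nat (Suc (card S)) * X) * cycle_weight f S p
    = ((1 - X) * ((\<Sum>i=1..<l. f i * f (l - i)) - of_nat l * X ^ l + of_nat (card S - l))
      + (1 + of_nat (Suc (card S)) * X) * f l) * R"
    unfolding tot unfolding W by (simp add: algebra_simps)
  also have "\<dots> = of_nat (card S) * (f (Suc l) * R)"
    unfolding f_def split_sum[OF l0] using lS by (simp add: of_nat_diff algebra_simps)
  finally show ?thesis unfolding Q unfolding l_def f_def X_def R_def .
qed

section \<open>Products with a random full cycle\<close>

lemma comp_transpose:
  assumes "inj q"
  shows "q \<circ> Transposition.transpose a b = Transposition.transpose (q a) (q b) \<circ> q"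
  using assms by (auto simp: fun_eq_iff Transposition.transpose_def inj_eq)

lemma transpose_triangle:
  assumes "a \<noteq> b" "a \<noteq> x" "b \<noteq> x"
  shows "Transposition.transpose x b \<circ> Transposition.transpose a x =
    Transposition.transpose a b \<circ> Transposition.transpose x b"
  using assms by (auto simp: fun_eq_iff Transposition.transpose_def)

section \<open>Full cycles and how they grow by one point\<close>

definition num_cycles :: "'a set \<Rightarrow> ('a \<Rightarrow> 'a) \<Rightarrow> nat" where
  "num_cycles S p = card (orbit p ` S)"

lemma num_cycles_insert_fixed:
  assumes "finite S" "p permutes S" "x \<notin> S"
  shows "num_cycles (insert x S) p = Suc (num_cycles S p)"
  using orbit_insert_fixed[OF assms] assms(1) by (simp add: num_cycles_def)

lemma cycle_weight_const: "cycle_weight (\<lambda>_. c) S p = c ^ num_cycles S p"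
  by (simp add: cycle_weight_def num_cycles_def)

text \<open>Giving every cycle the weight 2 turns the statement on weights into one on numbers of
  cycles, since a power of 2 determines its exponent.\<close>

lemma num_cycles_insert_moved:
  assumes "finite S" "p permutes S" "x \<notin> S" "a \<in> S"
  shows "num_cycles (insert x S) (Transposition.transpose a x \<circ> p) = num_cycles S p"
proof -
  have "(2 :: int) ^ num_cycles (insert x S) (Transposition.transpose a x \<circ> p) = 2 ^ num_cycles S p"
    using cycle_weight_insert_moved[OF assms, of "\<lambda>_. 2 :: int"] cycle_weight_eq_coweight[OF assms(1,4), of "\<lambda>_. 2 :: int" p]
    by (simp add: cycle_weight_const)
  thus ?thesis by simp
qed

text \<open>On a one-point set this is the set of the identity alone. For n = 2 the cycles of length
  n - 1 are thus the identity, taken once for each of the two points that can be left out.\<close>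

definition full_cycles :: "'a set \<Rightarrow> ('a \<Rightarrow> 'a) set" where
  "full_cycles S = {c. c permutes S \<and> num_cycles S c = 1}"

lemma full_cycles_permutes: "c \<in> full_cycles S \<Longrightarrow> c permutes S"
  by (simp add: full_cycles_def)

lemma finite_full_cycles: "finite S \<Longrightarrow> finite (full_cycles S)"
  by (rule finite_subset[OF _ finite_permutations[of S]]) (auto simp: full_cycles_def)

text \<open>A full cycle on the larger set arises exactly once from a full cycle on \<open>S\<close>
  by inserting \<open>x\<close> behind some point \<open>b\<close>; leaving \<open>x\<close> fixed
  would give a second cycle. The transposition is moved to the right of \<open>q\<close>, by the
  substitution of \<open>q b\<close> for \<open>b\<close>, because there it meets the permutation
  with which the cycle is composed in \<open>cycle_gf\<close>.\<close>

lemma sum_full_cycles_insert: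
  fixes g :: "('a \<Rightarrow> 'a) \<Rightarrow> 'b::comm_monoid_add"
  assumes S: "finite S" "S \<noteq> {}" "x \<notin> S"
  shows "sum g (full_cycles (insert x S)) =
    (\<Sum>q\<in>full_cycles S. \<Sum>b\<in>S. g (q \<circ> Transposition.transpose x b))"
proof -
  let ?P = "{p. p permutes S}" and ?T = "\<lambda>b q. Transposition.transpose x b \<circ> q"
  have fP: "finite {p. p permutes insert x S}" "finite ?P" using S(1) by (auto intro: finite_permutations)
  have cond: "num_cycles (insert x S) (?T b q) = (if b = x then Suc (num_cycles S q) else num_cycles S q)"
    if "b \<in> insert x S" "q \<in> ?P" for b q
  proof (cases "b = x")
    case True thus ?thesis using num_cycles_insert_fixed[OF S(1) _ S(3)] that by simp
  next
    case False
    thus ?thesis using num_cycles_insert_moved[OF S(1) _ S(3), of q b] that by (simp add: transpose_commute)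
  qed
  have F: "(\<Sum>q\<in>?P. if num_cycles S q = 1 then h q else 0) = sum h (full_cycles S)"
    for h :: "('a \<Rightarrow> 'a) \<Rightarrow> 'b"
    using sum.inter_filter[OF fP(2), of h "\<lambda>q. num_cycles S q = 1"] by (simp add: full_cycles_def)
  have pos: "num_cycles S q > 0" for q using S by (simp add: num_cycles_def card_gt_0_iff)
  have "sum g (full_cycles (insert x S)) =
    (\<Sum>p | p permutes insert x S. if num_cycles (insert x S) p = 1 then g p else 0)"
    unfolding full_cycles_def using fP(1) by (subst sum.inter_filter[symmetric]) (auto intro!: sum.cong)
  also have "\<dots> = (\<Sum>b\<in>insert x S. \<Sum>q\<in>?P. if num_cycles (insert x S) (?T b q) = 1 then g (?T b q) else 0)"
    by (rule sum_over_permutations_insert[OF S(1,3)])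
  also have "\<dots> = (\<Sum>b\<in>insert x S. \<Sum>q\<in>?P. if b \<noteq> x \<and> num_cycles S q = 1 then g (?T b q) else 0)"
  proof (intro sum.cong refl)
    fix b q assume "b \<in> insert x S" "q \<in> ?P"
    thus "(if num_cycles (insert x S) (?T b q) = 1 then g (?T b q) else 0) =
      (if b \<noteq> x \<and> num_cycles S q = 1 then g (?T b q) else 0)"
      using pos[of q] by (simp only: cond) simp
  qed
  also have "\<dots> = (\<Sum>b\<in>S. \<Sum>q\<in>?P. if num_cycles S q = 1 then g (?T b q) else 0)"
    unfolding sum.insert[OF S(1,3)] using S(3)
    by (simp, intro sum.cong refl) (use S(3) in auto)
  also have "\<dots> = (\<Sum>b\<in>S. \<Sum>q\<in>full_cycles S. g (?T b q))"
    by (simp only: F)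
  also have "\<dots> = (\<Sum>q\<in>full_cycles S. \<Sum>b\<in>S. g (?T b q))" by (rule sum.swap)
  also have "\<dots> = (\<Sum>q\<in>full_cycles S. \<Sum>b\<in>S. g (q \<circ> Transposition.transpose x b))"
  proof (rule sum.cong[OF refl])
    fix q assume "q \<in> full_cycles S"
    hence q: "q permutes S" by (rule full_cycles_permutes)
    have "(\<Sum>b\<in>S. g (?T b q)) = (\<Sum>b\<in>S. g (?T (q b) q))"
      by (rule sum.permute[OF q, unfolded comp_def])
    also have "\<dots> = (\<Sum>b\<in>S. g (q \<circ> Transposition.transpose x b))"
      using comp_transpose[OF permutes_inj[OF q], of x] permutes_not_in[OF q S(3)] by simp
    finally show "(\<Sum>b\<in>S. g (?T b q)) = (\<Sum>b\<in>S. g (q \<circ> Transposition.transpose x b))" .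
  qed
  finally show ?thesis .
qed

lemma full_cycles_singleton: "full_cycles {x} = {id}"
  by (auto simp: full_cycles_def num_cycles_def)

lemma card_full_cycles:
  assumes "finite S" "S \<noteq> {}"
  shows "card (full_cycles S) = fact (card S - 1)"
  using assms
proof (induction S rule: finite_ne_induct)
  case (insert x S)
  have "card (full_cycles (insert x S)) = card S * card (full_cycles S)"
    using sum_full_cycles_insert[OF insert(1-3), of "\<lambda>_. 1 :: nat"] by (simp add: mult.commute)
  moreover have "card S > 0" using insert by (simp add: card_gt_0_iff)
  ultimately show ?case using insert by (cases "card S") auto
qed (simp add: full_cycles_singleton)

text \<open>Coefficients of the product of the class sum of full cycles with
  $\sum_w y^{\mathrm{cyc}(w)} w$ in the group algebra.\<close>

definition cycle_gf :: "'a set \<Rightarrow> ('a \<Rightarrow> 'a) \<Rightarrow> 'b::comm_ring_1 \<Rightarrow> 'b" where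
  "cycle_gf S p y = (\<Sum>c\<in>full_cycles S. y ^ num_cycles S (c \<circ> p))"

section \<open>The generating function of products with a full cycle\<close>

lemma cycle_gf_insert_fixed:
  assumes S: "finite S" "S \<noteq> {}" "x \<notin> S" and p: "p permutes S"
  shows "cycle_gf (insert x S) p y = of_nat (card S) * cycle_gf S p y"
proof -
  have "num_cycles (insert x S) ((q \<circ> Transposition.transpose x b) \<circ> p) = num_cycles S (q \<circ> p)"
    if "q \<in> full_cycles S" "b \<in> S" for q b
  proof -
    have q: "q permutes S" using that by (simp add: full_cycles_permutes)
    \<comment> \<open>Moved past \<open>q\<close>, the transposition inserts \<open>x\<close> into a
      cycle of \<open>q \<circ> p\<close>. This leaves the number of cycles alone for every choice
      of \<open>b\<close>, whence the factor \<open>card S\<close>.\<close>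
    have "(q \<circ> Transposition.transpose x b) \<circ> p = Transposition.transpose (q b) x \<circ> (q \<circ> p)"
      using comp_transpose[OF permutes_inj[OF q], of x b] permutes_not_in[OF q S(3)]
      by (simp add: comp_assoc transpose_commute)
    thus ?thesis
      using num_cycles_insert_moved[OF S(1) permutes_compose[OF p q] S(3), of "q b"]
        permutes_in_image[OF q] that by simp
  qed
  thus ?thesis unfolding cycle_gf_def
    by (simp add: sum_full_cycles_insert[OF S] sum_distrib_left)
qed

text \<open>Write the full cycle as a full cycle \<open>q\<close> on \<open>S\<close> with
  \<open>x\<close> inserted behind \<open>b\<close>. For b = a the two transpositions cancel and
  \<open>x\<close> becomes a fixed point, which accounts for the factor \<open>y\<close>. For b
  \<noteq> a, \<open>transpose_triangle\<close> rewrites their product so that \<open>x\<close> is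
  inserted into a cycle of \<open>q\<close> composed with the transposition of \<open>a\<close> and
  \<open>b\<close> and with \<open>p\<close>.\<close>

lemma cycle_gf_insert_moved:
  assumes S: "finite S" "x \<notin> S" and p: "p permutes S" and a: "a \<in> S"
  shows "cycle_gf (insert x S) (Transposition.transpose a x \<circ> p) y =
    y * cycle_gf S p y + (\<Sum>b\<in>S - {a}. cycle_gf S (Transposition.transpose a b \<circ> p) y)"
proof -
  let ?t = Transposition.transpose
  have A: "num_cycles (insert x S) ((q \<circ> ?t x a) \<circ> (?t a x \<circ> p)) = Suc (num_cycles S (q \<circ> p))"
    if q: "q \<in> full_cycles S" for q
  proof -
    have "(q \<circ> ?t x a) \<circ> (?t a x \<circ> p) = q \<circ> p" by (auto simp: fun_eq_iff transpose_commute)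
    thus ?thesis
      using num_cycles_insert_fixed[OF S(1) permutes_compose[OF p full_cycles_permutes[OF q]] S(2)] by simp
  qed
  have B: "num_cycles (insert x S) ((q \<circ> ?t x b) \<circ> (?t a x \<circ> p)) = num_cycles S (q \<circ> (?t a b \<circ> p))"
    if q: "q \<in> full_cycles S" and b: "b \<in> S - {a}" for q b
  proof -
    have qp: "q permutes S" by (rule full_cycles_permutes[OF q])
    have q': "(q \<circ> ?t a b) permutes S"
      by (rule permutes_compose[OF permutes_swap_id qp]) (use a b in auto)
    have "?t x b \<circ> ?t a x = ?t a b \<circ> ?t x b"
      by (rule transpose_triangle) (use a b S(2) in auto)
    hence "(q \<circ> ?t x b) \<circ> (?t a x \<circ> p) = ((q \<circ> ?t a b) \<circ> ?t x b) \<circ> p"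
      by (simp add: fun_eq_iff)
    also have "\<dots> = ?t ((q \<circ> ?t a b) b) x \<circ> ((q \<circ> ?t a b) \<circ> p)"
      using comp_transpose[OF permutes_inj[OF q'], of x b] permutes_not_in[OF q' S(2)]
      by (simp add: comp_assoc transpose_commute)
    finally have "(q \<circ> ?t x b) \<circ> (?t a x \<circ> p) = ?t ((q \<circ> ?t a b) b) x \<circ> ((q \<circ> ?t a b) \<circ> p)" .
    moreover have "(q \<circ> ?t a b) b \<in> S" using permutes_in_image[OF q', of b] b by blast
    ultimately show ?thesis
      using num_cycles_insert_moved[OF S(1) permutes_compose[OF p q'] S(2)] by (simp add: comp_assoc)
  qed
  have ne: "S \<noteq> {}" using a by blast
  have "cycle_gf (insert x S) (?t a x \<circ> p) y =
    (\<Sum>q\<in>full_cycles S. \<Sum>b\<in>S. y ^ num_cycles (insert x S) ((q \<circ> ?t x b) \<circ> (?t a x \<circ> p)))"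
    unfolding cycle_gf_def by (rule sum_full_cycles_insert[OF S(1) ne S(2)])
  also have "\<dots> = (\<Sum>q\<in>full_cycles S. y * y ^ num_cycles S (q \<circ> p) +
      (\<Sum>b\<in>S - {a}. y ^ num_cycles S (q \<circ> (?t a b \<circ> p))))"
  proof (rule sum.cong[OF refl])
    fix q assume q: "q \<in> full_cycles S"
    show "(\<Sum>b\<in>S. y ^ num_cycles (insert x S) ((q \<circ> ?t x b) \<circ> (?t a x \<circ> p))) =
      y * y ^ num_cycles S (q \<circ> p) + (\<Sum>b\<in>S - {a}. y ^ num_cycles S (q \<circ> (?t a b \<circ> p)))"
      unfolding sum.remove[OF S(1) a] A[OF q] by (simp add: B[OF q])
  qed
  also have "\<dots> = y * cycle_gf S p y + (\<Sum>b\<in>S - {a}. cycle_gf S (?t a b \<circ> p) y)"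
    unfolding cycle_gf_def sum.distrib sum_distrib_left by (subst sum.swap) (rule refl)
  finally show ?thesis .
qed

lemma permutes_insert_cases:
  assumes "z permutes insert x S" "x \<notin> S"
  obtains "z permutes S" | a p where "a \<in> S" "p permutes S" "z = Transposition.transpose a x \<circ> p"
proof (cases "z x = x")
  case True
  thus ?thesis using permutes_insert_lemma[OF assms(1)] that(1) by simp
next
  case False
  hence "z x \<in> S" using permutes_in_image[OF assms(1), of x] by simp
  moreover have "z = Transposition.transpose (z x) x \<circ> (Transposition.transpose x (z x) \<circ> z)"
    by (auto simp: fun_eq_iff transpose_commute)
  ultimately show ?thesis using permutes_insert_lemma[OF assms(1)] that(2) by blast
qed

text \<open>The generating variable records \<open>y\<close>, so the factor \<open>y\<close> in
  \<open>cycle_gf_insert_moved\<close> becomes the operator X d/dX. After multiplication by (1 -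
  X)^(m+3), with m = \<open>card S\<close>, the recurrence is the polynomial identity
  \<open>sum_transpose_cycle_poly\<close>. A fixed point multiplies the cycle polynomial by 1 - X,
  in agreement with the additional power of 1 - X on the left.\<close>

lemma cycle_gf_fps:
  fixes S :: "'a set"
  assumes "finite S" "S \<noteq> {}" "p permutes S"
  shows "Abs_fps (\<lambda>y. cycle_gf S p (of_nat y)) * (1 - fps_X) ^ (card S + 2) =
    of_nat (fact (card S - 1)) * fps_X * fps_of_poly (cycle_poly S p)"
  using assms
proof (induction S arbitrary: p rule: finite_ne_induct)
  case (singleton x)
  have X: "fps_of_poly [:0, 1:] = (fps_X :: real fps)" by (simp add: fps_of_poly_pCons)
  have p: "p = id" using singleton by simp
  have o: "orbit (\<lambda>a. a) x = {x}" by (simp add: orbit_eq_singleton_iff)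
  have "Abs_fps of_nat * (1 - fps_X :: real fps) ^ 2 = fps_X"
  proof -
    have "Abs_fps of_nat = (fps_X * Abs_fps (\<lambda>n. of_nat (Suc n)) :: real fps)"
      by (auto simp: fps_eq_iff of_nat_diff simp del: of_nat_Suc)
    moreover have "Abs_fps (\<lambda>n. of_nat (Suc n)) * (1 - fps_X :: real fps) ^ 2 = 1"
    proof -
      have "((1 - fps_X :: real fps) ^ 2) $ 0 \<noteq> 0" by (simp add: fps_nth_power_0)
      hence "inverse ((1 - fps_X :: real fps) ^ 2) * (1 - fps_X) ^ 2 = 1" by (rule inverse_mult_eq_1)
      thus ?thesis unfolding fps_one_over_one_minus_fps_X_squared by (simp add: add.commute)
    qed
    ultimately show ?thesis by (simp add: mult.assoc)
  qed
  hence "Abs_fps of_nat * (1 - fps_X :: real fps) ^ Suc (Suc (Suc 0)) = fps_X * (1 - fps_X)"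
    by (simp add: power2_eq_square mult.assoc[symmetric])
  thus ?case
    by (simp add: p cycle_gf_def full_cycles_singleton num_cycles_def cycle_poly_def cycle_weight_def
        fps_of_poly_diff X numeral_3_eq_3 o)
next
  case (insert x S)
  let ?t = Transposition.transpose
  define m where "m = card S"
  have m: "m > 0" "card (insert x S) = Suc m" using insert by (auto simp: m_def card_gt_0_iff)
  define \<Gamma> where "\<Gamma> = (\<lambda>S (p :: 'a \<Rightarrow> 'a). Abs_fps (\<lambda>y. cycle_gf S p (of_nat y)) :: real fps)"
  define X where "X = (fps_X :: real fps)"
  define c where "c = (of_nat (fact (m - 1)) :: real fps)"
  define Q where "Q = (\<lambda>S p. fps_of_poly (cycle_poly S (p :: 'a \<Rightarrow> 'a)))"
  have X: "fps_of_poly [:0, 1:] = X" by (simp add: X_def fps_of_poly_pCons)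
  have IH: "\<Gamma> S p * (1 - X) ^ (m + 2) = c * X * Q S p" if "p permutes S" for p
    using insert.IH[OF that] by (simp add: \<Gamma>_def X_def c_def Q_def m_def)
  have fm: "of_nat m * c = of_nat (fact m)"
    unfolding c_def using m(1) by (metis fact_reduce of_nat_id of_nat_mult)
  have "\<Gamma> (insert x S) p * (1 - X) ^ Suc (m + 2) = of_nat (fact m) * X * Q (insert x S) p"
    using insert.prems insert.hyps(3)
  proof (cases rule: permutes_insert_cases)
    case 1
    have "\<Gamma> (insert x S) p = of_nat m * \<Gamma> S p"
      unfolding \<Gamma>_def by (simp add: fps_eq_iff cycle_gf_insert_fixed[OF insert.hyps(1-3) 1] m_def fps_of_nat[symmetric])
    moreover have "Q (insert x S) p = (1 - X) * Q S p"
      unfolding Q_def cycle_poly_def cycle_weight_insert_fixed[OF insert.hyps(1) 1 insert.hyps(3)]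
      by (simp add: fps_of_poly_mult fps_of_poly_diff X_def)
    moreover have "of_nat m * \<Gamma> S p * (1 - X) ^ Suc (m + 2) = of_nat m * (1 - X) * (\<Gamma> S p * (1 - X) ^ (m + 2))"
      by (simp add: ac_simps)
    ultimately show ?thesis unfolding IH[OF 1] fm[symmetric] by (simp add: ac_simps)
  next
    case (2 a q)
    have tq: "(?t a b \<circ> q) permutes S" if "b \<in> S - {a}" for b
      by (rule permutes_compose[OF 2(2) permutes_swap_id]) (use 2 that in auto)
    define \<Sigma> where "\<Sigma> = (\<Sum>b\<in>S - {a}. Q S (?t a b \<circ> q))"
    have G: "\<Gamma> (insert x S) p = fps_XD (\<Gamma> S q) + (\<Sum>b\<in>S - {a}. \<Gamma> S (?t a b \<circ> q))"
      unfolding \<Gamma>_def 2(3)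
      by (simp add: fps_eq_iff cycle_gf_insert_moved[OF insert.hyps(1,3) 2(2,1)] fps_sum_nth)
    have s: "(\<Sum>b\<in>S - {a}. \<Gamma> S (?t a b \<circ> q)) * (1 - X) ^ (m + 2) = c * X * \<Sigma>"
      unfolding sum_distrib_right \<Sigma>_def sum_distrib_left
      by (rule sum.cong[OF refl]) (use IH[OF tq] in simp)
    have dX: "fps_deriv X = 1" by (simp add: X_def)
    have dc: "fps_deriv c = 0" unfolding c_def fps_of_nat[symmetric] by (rule fps_deriv_const)
    have dP: "fps_deriv ((1 - X) ^ (m + 2)) = - (of_nat (m + 2) * (1 - X) ^ (m + 1))"
    proof -
      have d1: "fps_deriv (1 - X) = - 1" by (simp add: dX)
      have "m + 2 - 1 = m + 1" by simp
      thus ?thesis unfolding fps_deriv_power' d1 by (simp only: mult_minus_left mult_minus_right mult_1_right)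
    qed
    define N where "N = (of_nat (m + 2) :: real fps)"
    define P where "P = (1 - X) ^ (m + 1)"
    define P' where "P' = (1 - X) ^ (m + 2)"
    define Q' where "Q' = fps_deriv (Q S q)"
    have PP: "P' = (1 - X) * P" "(1 - X) ^ Suc (m + 2) = (1 - X) * P'"
      by (simp_all add: P_def P'_def)
    have IHq: "\<Gamma> S q * P' = c * X * Q S q" unfolding P'_def by (rule IH[OF 2(2)])
    have "fps_deriv (\<Gamma> S q * P') = fps_deriv (c * X * Q S q)" by (simp only: IHq)
    hence "fps_deriv (\<Gamma> S q) * P' = N * (\<Gamma> S q * P) + c * (Q S q + X * Q')"
      using dP unfolding N_def[symmetric] P_def[symmetric] P'_def[symmetric] Q'_def
      by (simp add: dX dc algebra_simps)
    hence "X * (1 - X) * (fps_deriv (\<Gamma> S q) * P')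
        = X * (1 - X) * (N * (\<Gamma> S q * P) + c * (Q S q + X * Q'))" by simp
    also have "\<dots> = X * N * (\<Gamma> S q * P') + X * (1 - X) * (c * (Q S q + X * Q'))"
      unfolding PP by (simp add: algebra_simps)
    finally have d: "fps_XD (\<Gamma> S q) * (1 - X) ^ Suc (m + 2)
        = c * X * ((1 - X) * (Q S q + X * fps_deriv (Q S q)) + of_nat (m + 2) * X * Q S q)"
      unfolding IHq PP(2) N_def[symmetric] Q'_def[symmetric]
      by (simp add: fps_XD_def X_def[symmetric] algebra_simps)
    have "\<Gamma> (insert x S) p * (1 - X) ^ Suc (m + 2)
        = fps_XD (\<Gamma> S q) * (1 - X) ^ Suc (m + 2) + (1 - X) * ((\<Sum>b\<in>S - {a}. \<Gamma> S (?t a b \<circ> q)) * (1 - X) ^ (m + 2))"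
      unfolding G by (simp add: algebra_simps)
    also have "\<dots> = c * X * ((1 - X) * (\<Sigma> + X * fps_deriv (Q S q)) + (1 + of_nat (Suc m) * X) * Q S q)"
      unfolding d s by (simp add: algebra_simps)
    also have "(1 - X) * (\<Sigma> + X * fps_deriv (Q S q)) + (1 + of_nat (Suc m) * X) * Q S q
        = of_nat m * Q (insert x S) p"
    proof -
      have "fps_of_poly ((1 - [:0, 1:]) * ((\<Sum>b\<in>S - {a}. cycle_poly S (?t a b \<circ> q))
          + [:0, 1:] * pderiv (cycle_poly S q)) + (1 + of_nat (Suc m) * [:0, 1:]) * cycle_poly S q) =
        fps_of_poly (of_nat m * cycle_poly (insert x S) p)"
        unfolding m_def sum_transpose_cycle_poly[OF insert.hyps(1) 2(2,1)]
        unfolding 2(3) cycle_poly_def cycle_weight_insert_moved[OF insert.hyps(1) 2(2) insert.hyps(3) 2(1)] ..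
      note e = this
      have on: "fps_of_poly (of_nat k) = (of_nat k :: real fps)" for k
        by (simp add: of_nat_poly fps_of_poly_const fps_of_nat)
      show ?thesis
        using e unfolding fps_of_poly_add fps_of_poly_mult fps_of_poly_diff fps_of_poly_sum fps_of_poly_pderiv
          X fps_of_poly_1 on Q_def \<Sigma>_def .
    qed
    finally show ?thesis unfolding fm[symmetric] by (simp add: ac_simps)
  qed
  thus ?case by (simp add: \<Gamma>_def X_def Q_def m(2))
qed

section \<open>Hook polynomials and the expansion of products with a full cycle\<close>

lemma card_orbit_pos:
  assumes "finite S" "p permutes S"
  shows "card (orbit p a) > 0"
  using mem_orbit_self[OF assms] finite_orbit_permutes[OF assms] by (metis card_gt_0_iff empty_iff)

text \<open>The coefficient of \<open>x ^ k\<close> is $(-1)^k$ times the value at \<open>p\<close> of the irreducible character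
  of the hook shape $(n - k, 1^k)$.\<close>

definition hook_poly :: "'a set \<Rightarrow> ('a \<Rightarrow> 'a) \<Rightarrow> real poly" where
  "hook_poly S p = cycle_poly S p div (1 - [:0, 1:])"

lemma cycle_poly_eq_hook_poly:
  assumes "finite S" "S \<noteq> {}" "p permutes S"
  shows "cycle_poly S p = (1 - [:0, 1:]) * hook_poly S p"
proof -
  obtain a where a: "a \<in> S" using assms(2) by blast
  have "(1 - [:0, 1:] :: real poly) dvd 1 - [:0, 1:] ^ k" for k
    using one_diff_power_eq by (metis dvd_triv_left)
  hence "(1 - [:0, 1:]) dvd cycle_poly S p"
    unfolding cycle_poly_def cycle_weight_eq_coweight[OF assms(1) a] by (rule dvd_mult2)
  thus ?thesis unfolding hook_poly_def by simp
qed

lemma degree_one_minus_X_power: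
  assumes "k > 0"
  shows "degree (1 - [:0, 1:] ^ k :: real poly) = k" "lead_coeff (1 - [:0, 1:] ^ k :: real poly) = -1"
proof -
  have d: "degree ([:0, 1:] ^ k :: real poly) = k" by (simp add: degree_power_eq)
  have e: "(1 - [:0, 1:] ^ k :: real poly) = - ([:0, 1:] ^ k) + 1" by simp
  show "degree (1 - [:0, 1:] ^ k :: real poly) = k"
    unfolding e using assms d by (subst degree_add_eq_left) auto
  moreover have "[:0, 1:] ^ k = (monom 1 k :: real poly)" by (simp add: monom_altdef)
  ultimately show "lead_coeff (1 - [:0, 1:] ^ k :: real poly) = -1" using assms by simp
qed

lemma sum_card_orbits:
  assumes "finite S" "p permutes S"
  shows "(\<Sum>C\<in>orbit p ` S. card C) = card S"
proof -
  have "(\<Sum>x\<in>\<Union>(orbit p ` S). 1 :: int) = (\<Sum>C\<in>orbit p ` S. of_nat (card C) * 1)"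
    by (rule sum_over_orbits[OF assms subset_refl])
  thus ?thesis unfolding Union_orbits[OF assms] by (simp flip: of_nat_sum)
qed

lemma degree_cycle_poly:
  assumes "finite S" "p permutes S"
  shows "degree (cycle_poly S p) = card S" "lead_coeff (cycle_poly S p) = (-1) ^ num_cycles S p"
proof -
  have pos: "card C > 0" if "C \<in> orbit p ` S" for C
    using that card_orbit_pos[OF assms] by blast
  have "degree (cycle_poly S p) = (\<Sum>C\<in>orbit p ` S. degree (1 - [:0, 1:] ^ card C :: real poly))"
    unfolding cycle_poly_def cycle_weight_def
    by (rule degree_prod_eq_sum_degree) (metis degree_one_minus_X_power(1) degree_0 pos less_irrefl)
  thus "degree (cycle_poly S p) = card S"
    using degree_one_minus_X_power(1) pos sum_card_orbits[OF assms] by simp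
  show "lead_coeff (cycle_poly S p) = (-1) ^ num_cycles S p"
    unfolding cycle_poly_def cycle_weight_def lead_coeff_prod num_cycles_def
    using degree_one_minus_X_power(2) pos by simp
qed

text \<open>The lowest and the highest coefficient belong to the trivial and to the sign character;
  only these two survive in products of a full cycle with a cycle of length one less.\<close>

lemma coeff_hook_poly:
  assumes "finite S" "S \<noteq> {}" "p permutes S"
  shows "coeff (hook_poly S p) 0 = 1" "card S \<le> k \<Longrightarrow> coeff (hook_poly S p) k = 0"
    "coeff (hook_poly S p) (card S - 1) = - ((-1) ^ num_cycles S p)"
proof -
  note eq = cycle_poly_eq_hook_poly[OF assms]
  have n: "card S > 0" using assms by (simp add: card_gt_0_iff)
  have ne: "cycle_poly S p \<noteq> 0" using degree_cycle_poly[OF assms(1,3)] n by auto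
  hence h: "hook_poly S p \<noteq> 0" using eq by auto
  have X: "(1 - [:0, 1:] :: real poly) = [:1, -1:]" by (simp add: one_pCons)
  have dh: "Suc (degree (hook_poly S p)) = card S"
    using degree_cycle_poly(1)[OF assms(1,3)] degree_mult_eq[of "[:1, -1 :: real:]" "hook_poly S p"] h
    unfolding eq X by simp
  thus "card S \<le> k \<Longrightarrow> coeff (hook_poly S p) k = 0" by (simp add: coeff_eq_0)
  have "lead_coeff (cycle_poly S p) = - lead_coeff (hook_poly S p)"
    unfolding eq X lead_coeff_mult by simp
  thus "coeff (hook_poly S p) (card S - 1) = - ((-1) ^ num_cycles S p)"
    unfolding degree_cycle_poly(2)[OF assms(1,3)] using dh by (metis diff_Suc_1 minus_equation_iff)
  have "poly (cycle_poly S p) 0 = 1"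
    unfolding cycle_poly_def cycle_weight_def poly_prod
    by (rule prod.neutral) (use card_orbit_pos[OF assms(1,3)] in auto)
  thus "coeff (hook_poly S p) 0 = 1" unfolding eq poly_mult by (simp add: poly_0_coeff_0)
qed

text \<open>The expansion of x^k / (1 - x)^(n+1). It serves twice: to read off the numbers
  \<open>cycle_gf\<close> from their generating function, and to invert the binomial coefficients in
  the definition of the Foulkes characters.\<close>

lemma fps_binomial_shift:
  assumes "k \<le> n"
  shows "Abs_fps (\<lambda>y. of_nat ((y + n - k) choose n)) * (1 - fps_X) ^ Suc n = (fps_X ^ k :: real fps)"
proof -
  define B where "B = (\<lambda>n. Abs_fps (\<lambda>y. of_nat ((y + n) choose n)) :: real fps)"
  have B: "B n * (1 - fps_X) ^ Suc n = 1" for n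
  proof (induction n)
    case 0
    have "B 0 = inverse (1 - fps_X)" by (simp add: B_def fps_inverse_one_minus_fps_X)
    moreover have "(1 - fps_X :: real fps) $ 0 \<noteq> 0" by simp
    ultimately show ?case by (simp add: inverse_mult_eq_1)
  next
    case (Suc n)
    have "B (Suc n) * (1 - fps_X) = B n"
    proof (rule fps_ext)
      fix y
      show "(B (Suc n) * (1 - fps_X)) $ y = B n $ y"
        by (cases y) (simp_all add: B_def algebra_simps)
    qed
    thus ?case using Suc by (simp add: mult.assoc[symmetric])
  qed
  have "Abs_fps (\<lambda>y. of_nat ((y + n - k) choose n)) = fps_X ^ k * B n"
  proof (rule fps_ext)
    fix y
    show "Abs_fps (\<lambda>y. of_nat ((y + n - k) choose n)) $ y = (fps_X ^ k * B n) $ y"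
    proof (cases "y < k")
      case True
      hence "y + n - k < n" using assms by linarith
      thus ?thesis using True by (simp add: fps_X_power_mult_nth binomial_eq_0 del: power_Suc)
    next
      case False
      hence "y + n - k = y - k + n" by simp
      thus ?thesis using False by (simp add: fps_X_power_mult_nth B_def del: power_Suc)
    qed
  qed
  thus ?thesis using B[of n] by (simp add: mult.assoc)
qed

text \<open>One factor 1 - X of the cycle polynomial cancels against the denominator of
  \<open>cycle_gf_fps\<close>. What is left is x \<open>hook_poly\<close> / (1 - x)^(n+1), a
  combination of the series of \<open>fps_binomial_shift\<close>.\<close>

theorem cycle_gf_eq:
  assumes "finite S" "S \<noteq> {}" "p permutes S"
  shows "cycle_gf S p (of_nat y :: real) = fact (card S - 1) *
    (\<Sum>k<card S. coeff (hook_poly S p) k * of_nat ((y + card S - 1 - k) choose card S))"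
proof -
  define n where "n = card S"
  define T where "T = (\<lambda>k. Abs_fps (\<lambda>y. of_nat ((y + n - 1 - k) choose n)) :: real fps)"
  define c where "c = (fact (n - 1) :: real)"
  define R where "R = fps_const c * (\<Sum>k<n. fps_const (coeff (hook_poly S p) k) * T k)"
  define G where "G = Abs_fps (\<lambda>y. cycle_gf S p (of_nat y :: real))"
  have X1: "fps_of_poly (1 - [:0, 1:]) = (1 - fps_X :: real fps)"
    by (simp add: fps_of_poly_diff fps_of_poly_pCons)
  have h: "fps_of_poly (hook_poly S p) = (\<Sum>k<n. fps_const (coeff (hook_poly S p) k) * fps_X ^ k)"
  proof (rule fps_ext)
    fix i
    show "fps_of_poly (hook_poly S p) $ i = (\<Sum>k<n. fps_const (coeff (hook_poly S p) k) * fps_X ^ k) $ i"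
      using coeff_hook_poly(2)[OF assms, of i]
      by (simp add: fps_sum_nth fps_X_power_nth n_def if_distrib cong: if_cong)
  qed
  have c: "of_nat (fact (n - 1)) = fps_const c" unfolding c_def fps_of_nat[symmetric] by simp
  have "(1 - fps_X) * (G * (1 - fps_X) ^ Suc n) = G * (1 - fps_X) ^ (n + 2)" by (simp add: ac_simps)
  also have "\<dots> = of_nat (fact (n - 1)) * fps_X * fps_of_poly (cycle_poly S p)"
    unfolding G_def n_def by (rule cycle_gf_fps[OF assms])
  also have "\<dots> = (1 - fps_X) * (fps_const c * fps_X * fps_of_poly (hook_poly S p))"
    unfolding cycle_poly_eq_hook_poly[OF assms] fps_of_poly_mult X1 c by (simp add: ac_simps)
  finally have "G * (1 - fps_X) ^ Suc n = fps_const c * fps_X * fps_of_poly (hook_poly S p)"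
  proof -
    have ne: "(1 - fps_X :: real fps) \<noteq> 0" by (metis fps_X_neq_one eq_iff_diff_eq_0)
    show "(1 - fps_X) * (G * (1 - fps_X) ^ Suc n) =
        (1 - fps_X) * (fps_const c * fps_X * fps_of_poly (hook_poly S p)) \<Longrightarrow>
      G * (1 - fps_X) ^ Suc n = fps_const c * fps_X * fps_of_poly (hook_poly S p)"
      by (simp only: mult_left_cancel[OF ne])
  qed
  also have "\<dots> = fps_const c * (\<Sum>k<n. fps_const (coeff (hook_poly S p) k) * fps_X ^ Suc k)"
    unfolding h sum_distrib_left by (intro sum.cong refl) (simp only: power_Suc ac_simps)
  also have "\<dots> = fps_const c * (\<Sum>k<n. fps_const (coeff (hook_poly S p) k) * (T k * (1 - fps_X) ^ Suc n))"
  proof -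
    \<comment> \<open>The remaining factor X moves the coefficient of index k to the series of index
      k + 1, which is admissible since k < n.\<close>
    have "T k * (1 - fps_X) ^ Suc n = fps_X ^ Suc k" if "k < n" for k
    proof -
      have "T k = Abs_fps (\<lambda>y. of_nat ((y + n - Suc k) choose n))" by (simp add: T_def)
      thus ?thesis using fps_binomial_shift[of "Suc k" n] that by (simp only: Suc_le_eq)
    qed
    thus ?thesis by (intro arg_cong[where f = "(*) _"] sum.cong refl) (simp only: lessThan_iff)
  qed
  also have "\<dots> = R * (1 - fps_X) ^ Suc n"
    unfolding R_def by (simp only: sum_distrib_right mult.assoc)
  finally have "G = R" by (simp del: power_Suc)
  hence "G $ y = R $ y" by simp
  thus ?thesis by (simp add: G_def R_def T_def c_def n_def fps_sum_nth)
qed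

section \<open>Orthogonality of hook characters\<close>

lemma orbit_image_insert_moved:
  assumes S: "finite S" "p permutes S" "x \<notin> S" "a \<in> S"
  defines "w \<equiv> Transposition.transpose a x \<circ> p"
  shows "card (orbit w x) = Suc (card (orbit p a))"
    "orbit w ` insert x S - {orbit w x} = orbit p ` S - {orbit p a}"
proof -
  have S': "finite (insert x S)" using S(1) by simp
  have p': "p permutes insert x S" using S(2) by (rule permutes_subset) auto
  have ox: "orbit p x = {x}" using S by (simp add: orbit_eq_singleton_iff permutes_not_in)
  have nx: "x \<notin> orbit p a" using permutes_orbit_subset[OF S(2,4)] S(3) by blast
  have wp: "w permutes insert x S"
    unfolding w_def using S by (intro permutes_compose[OF p'] permutes_swap_id) auto
  have wa: "orbit w a = insert x (orbit p a)"
    unfolding w_def using orbit_transpose_merge[OF S' p' nx] ox by simp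
  hence wx: "orbit w x = insert x (orbit p a)" using orbit_eq_of_mem[OF S' wp, of x a] by simp
  thus "card (orbit w x) = Suc (card (orbit p a))"
    using nx finite_orbit_permutes[OF S(1,2)] by simp
  have "orbit w ` insert x S = insert (insert x (orbit p a)) (orbit p ` insert x S - {orbit p a, {x}})"
    unfolding w_def using orbit_image_merge[OF S' p' _ _ nx] S(4) ox by simp
  also have "orbit p ` insert x S - {orbit p a, {x}} = orbit p ` S - {orbit p a}"
    using orbit_insert_fixed[OF S(1-3)] by auto
  finally have "orbit w ` insert x S = insert (insert x (orbit p a)) (orbit p ` S - {orbit p a})" .
  moreover have "insert x (orbit p a) \<notin> orbit p ` S"
    using permutes_orbit_subset[OF S(2)] S(3) by blast
  ultimately show "orbit w ` insert x S - {orbit w x} = orbit p ` S - {orbit p a}"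
    unfolding wx by blast
qed

lemma cycle_coweight_insert_moved:
  assumes "finite S" "p permutes S" "x \<notin> S" "a \<in> S"
  shows "cycle_coweight f (insert x S) (Transposition.transpose a x \<circ> p) x = cycle_coweight f S p a"
  unfolding cycle_coweight_def orbit_image_insert_moved[OF assms] ..

lemma cycle_coweight_insert_fixed:
  assumes "finite S" "p permutes S" "x \<notin> S"
  shows "cycle_coweight f (insert x S) p x = cycle_weight f S p"
proof -
  have "orbit p x = {x}" using assms by (simp add: orbit_eq_singleton_iff permutes_not_in)
  hence "orbit p ` insert x S - {orbit p x} = orbit p ` S" using orbit_insert_fixed[OF assms] by simp
  thus ?thesis by (simp add: cycle_coweight_def cycle_weight_def)
qed

text \<open>The cycle index recurrence, obtained by recording the length of the cycle through a marked
  point and removing the points of that cycle one at a time.\<close>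

lemma sum_cycle_weight:
  fixes f :: "nat \<Rightarrow> real" and z :: "nat \<Rightarrow> real" and S :: "'a set"
  assumes z0: "z 0 = 1"
    and rec: "\<And>n. of_nat (Suc n) * z (Suc n) = (\<Sum>l=1..Suc n. f l * z (Suc n - l))"
  shows "finite S \<Longrightarrow> (\<Sum>p | p permutes S. cycle_weight f S p) = fact (card S) * z (card S)"
    and "finite S \<Longrightarrow> a \<in> S \<Longrightarrow> (\<Sum>p | p permutes S. g (card (orbit p a)) * cycle_coweight f S p a) =
      fact (card S - 1) * (\<Sum>l=1..card S. g l * z (card S - l))"
proof -
  \<comment> \<open>Both statements go through one induction: the marked sum on \<open>Suc n\<close>
    points uses both sums on n points, and the unmarked sum is the marked one with
    \<open>g = f\<close>.\<close>
  have "\<forall>S :: 'a set. finite S \<and> card S = n \<longrightarrow>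
      (\<Sum>p | p permutes S. cycle_weight f S p) = fact n * z n \<and>
      (\<forall>a\<in>S. \<forall>g. (\<Sum>p | p permutes S. g (card (orbit p a)) * cycle_coweight f S p a) =
        fact (n - 1) * (\<Sum>l=1..n. g l * z (n - l)))" for n
  proof (induction n)
    case 0
    have "(\<Sum>p | p permutes ({} :: 'a set). cycle_weight f {} p) = 1" by (simp add: cycle_weight_def)
    thus ?case using z0 by (auto simp del: permutes_empty)
  next
    case (Suc n)
    have A: "(\<Sum>p | p permutes S. g (card (orbit p a)) * cycle_coweight f S p a) =
        fact n * (\<Sum>l=1..Suc n. g l * z (Suc n - l))"
      if S: "finite S" "card S = Suc n" "a \<in> S" for S :: "'a set" and a g
    proof -
      define T where "T = S - {a}"
      have T: "finite T" "a \<notin> T" "S = insert a T" "card T = n" using S by (auto simp: T_def)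
      have o: "orbit q a = {a}" if "q permutes T" for q
        using that T by (simp add: orbit_eq_singleton_iff permutes_not_in)
      \<comment> \<open>Sort by the image \<open>b\<close> of \<open>a\<close>. If b = a, the marked
        cycle has length one; otherwise deleting \<open>a\<close> leaves a permutation of
        \<open>T\<close> whose cycle through \<open>b\<close> is shorter by one and takes over the
        mark.\<close>
      have "(\<Sum>p | p permutes S. g (card (orbit p a)) * cycle_coweight f S p a)
        = (\<Sum>q | q permutes T. g 1 * cycle_weight f T q) +
          (\<Sum>b\<in>T. \<Sum>q | q permutes T. g (Suc (card (orbit q b))) * cycle_coweight f T q b)"
        unfolding T(3) sum_over_permutations_insert[OF T(1,2)] sum.insert[OF T(1,2)]
        using cycle_coweight_insert_fixed[OF T(1) _ T(2), of _ f] o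
          cycle_coweight_insert_moved[OF T(1) _ T(2), of _ _ f]
          orbit_image_insert_moved(1)[OF T(1) _ T(2)]
        by (intro arg_cong2[of _ _ _ _ "(+)"] sum.cong refl)
           (simp_all add: transpose_commute[of a])
      also have "\<dots> = g 1 * (fact n * z n) + (\<Sum>b\<in>T. fact (n - 1) * (\<Sum>l=1..n. g (Suc l) * z (n - l)))"
      proof -
        have "(\<Sum>q | q permutes T. cycle_weight f T q) = fact n * z n"
          using Suc.IH T(1,4) by blast
        moreover have "(\<Sum>q | q permutes T. g (Suc (card (orbit q b))) * cycle_coweight f T q b) =
            fact (n - 1) * (\<Sum>l=1..n. g (Suc l) * z (n - l))" if "b \<in> T" for b
          using Suc.IH[rule_format, THEN conjunct2, rule_format, of T b "\<lambda>l. g (Suc l)"] T(1,4) that by blast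
        ultimately show ?thesis by (simp add: sum_distrib_left[symmetric])
      qed
      also have "(\<Sum>b\<in>T. fact (n - 1) * (\<Sum>l=1..n. g (Suc l) * z (n - l)))
          = fact n * (\<Sum>l=1..n. g (Suc l) * z (n - l))"
        using T(4) by (cases n) (simp_all add: algebra_simps)
      also have "(\<Sum>l=1..n. g (Suc l) * z (n - l)) = (\<Sum>l=Suc 1..Suc n. g l * z (Suc n - l))"
        unfolding sum.shift_bounds_cl_Suc_ivl by simp
      also have "g 1 * (fact n * z n) + fact n * \<dots> = fact n * (\<Sum>l=1..Suc n. g l * z (Suc n - l))"
        by (subst sum.atLeast_Suc_atMost[of 1 "Suc n"]) (simp_all add: algebra_simps)
      finally show ?thesis .
    qed
    have "(\<Sum>p | p permutes S. cycle_weight f S p) = fact (Suc n) * z (Suc n)"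
      if S: "finite S" "card S = Suc n" for S :: "'a set"
    proof -
      obtain a where a: "a \<in> S" using S by fastforce
      have "(\<Sum>p | p permutes S. cycle_weight f S p) =
          (\<Sum>p | p permutes S. f (card (orbit p a)) * cycle_coweight f S p a)"
        by (intro sum.cong refl cycle_weight_eq_coweight S a)
      also have "\<dots> = fact n * (of_nat (Suc n) * z (Suc n))" unfolding A[OF S a] rec ..
      finally show ?thesis by (simp add: algebra_simps)
    qed
    thus ?case using A by simp
  qed
  thus "finite S \<Longrightarrow> (\<Sum>p | p permutes S. cycle_weight f S p) = fact (card S) * z (card S)"
    and "finite S \<Longrightarrow> a \<in> S \<Longrightarrow> (\<Sum>p | p permutes S. g (card (orbit p a)) * cycle_coweight f S p a) =
      fact (card S - 1) * (\<Sum>l=1..card S. g l * z (card S - l))"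
    by blast+
qed

text \<open>The cycle index series is the exponential of the sum of f(l) x^l / l. For f(l) = (1 -
  s^l) (1 - t^l) this is the rational function (1 - sx) (1 - tx) / ((1 - x) (1 - stx)), named
  \<open>Z\<close>, and \<open>F\<close> is X times its logarithmic derivative. So
  \<open>X * fps_deriv Z = Z * F\<close> is the recurrence that \<open>sum_cycle_weight\<close>
  requires.\<close>

lemma sum_cycle_poly_product:
  fixes S :: "'a set" and s t :: real
  assumes S: "finite S" "S \<noteq> {}"
  shows "(\<Sum>p | p permutes S. poly (cycle_poly S p) s * poly (cycle_poly S p) t) =
    fact (card S) * ((1 - s) * (1 - t) * (\<Sum>k<card S. (s * t) ^ k))"
proof -
  define f where "f = (\<lambda>l. (1 - s ^ l) * (1 - t ^ l))"
  define X where "X = (fps_X :: real fps)"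
  define I where "I = (\<lambda>c::real. Abs_fps (\<lambda>n. c ^ n))"
  define D where "D = (\<lambda>c::real. 1 - fps_const c * X)"
  have DI: "D c * I c = 1" for c
  proof (rule fps_ext)
    fix n show "(D c * I c) $ n = (1 :: real fps) $ n"
      by (cases n) (simp_all add: D_def I_def X_def algebra_simps)
  qed
  have D': "fps_deriv (D c) = - fps_const c" for c by (simp add: D_def X_def)
  have I': "fps_deriv (I c) = fps_const c * I c * I c" for c
  proof -
    have "fps_deriv (D c * I c) = 0" unfolding DI by simp
    hence "D c * fps_deriv (I c) = fps_const c * I c" by (simp add: D' algebra_simps del: fps_const_neg)
    hence d: "I c * (D c * fps_deriv (I c)) = fps_const c * I c * I c" by (simp only: ac_simps)
    have "fps_deriv (I c) = (D c * I c) * fps_deriv (I c)" unfolding DI by simp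
    also have "\<dots> = I c * (D c * fps_deriv (I c))" by (simp only: ac_simps)
    finally show ?thesis unfolding d .
  qed
  define u where "u = s * t"
  define Z where "Z = D s * D t * I 1 * I u"
  define F where "F = X * (I 1 - fps_const s * I s - fps_const t * I t + fps_const u * I u)"
  have ZF: "X * fps_deriv Z = Z * F"
  proof -
    have a: "D s * I s = 1" "D t * I t = 1" by (rule DI)+
    have "Z * F = X * (D s * D t * I 1 * I u * (I 1 + fps_const u * I u)
        - fps_const s * (D s * I s) * D t * I 1 * I u - fps_const t * (D t * I t) * D s * I 1 * I u)"
      unfolding Z_def F_def by (simp add: algebra_simps)
    also have "\<dots> = X * fps_deriv Z"
      unfolding a Z_def by (simp add: D' I' algebra_simps del: fps_const_neg)
    finally show ?thesis ..
  qed
  have Ff: "F $ l = (if l = 0 then 0 else f l)" for l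
    by (cases l) (simp_all add: F_def f_def X_def I_def u_def power_mult_distrib algebra_simps)
  have rec: "of_nat (Suc n) * Z $ Suc n = (\<Sum>l=1..Suc n. f l * Z $ (Suc n - l))" for n
  proof -
    have "of_nat (Suc n) * Z $ Suc n = (X * fps_deriv Z) $ Suc n" by (simp add: X_def)
    also have "\<dots> = (F * Z) $ Suc n" unfolding ZF by (simp add: mult.commute)
    also have "\<dots> = (\<Sum>l=0..Suc n. F $ l * Z $ (Suc n - l))" by (rule fps_mult_nth)
    also have "\<dots> = (\<Sum>l=1..Suc n. f l * Z $ (Suc n - l))"
      by (subst sum.atLeast_Suc_atMost) (auto simp: Ff)
    finally show ?thesis .
  qed
  have z0: "Z $ 0 = 1" by (simp add: Z_def D_def I_def X_def)
  define \<sigma> where "\<sigma> = Abs_fps (\<lambda>n. \<Sum>k<n. u ^ k)"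
  have "D u * \<sigma> = X * I 1"
  proof (rule fps_ext)
    fix n show "(D u * \<sigma>) $ n = (X * I 1) $ n"
    proof (cases n)
      case (Suc m)
      have "(\<Sum>k<Suc m. u ^ k) = 1 + u * (\<Sum>k<m. u ^ k)"
        by (subst sum.lessThan_Suc_shift) (simp add: sum_distrib_left)
      thus ?thesis by (simp add: Suc D_def \<sigma>_def I_def X_def algebra_simps del: sum.lessThan_Suc)
    qed (simp add: D_def \<sigma>_def X_def)
  qed
  hence "(D u * I u) * \<sigma> = X * I 1 * I u" by (simp add: ac_simps)
  hence \<sigma>: "\<sigma> = X * I 1 * I u" unfolding DI by simp
  have XI: "X * I 1 = I 1 - 1" "fps_const u * X * I u = I u - 1"
    using DI[of 1] DI[of u] by (simp_all add: D_def algebra_simps)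
  have st: "fps_const s * fps_const t = fps_const u" by (simp add: u_def)
  \<comment> \<open>Partial fractions: (1 - sx) (1 - tx) = (1 - x) (1 - stx) + (1 - s) (1 - t) x,
    while \<open>\<sigma>\<close> is x / ((1 - x) (1 - stx)).\<close>
  have "1 + fps_const ((1 - s) * (1 - t)) * \<sigma> =
      D 1 * D u * (I 1 * I u) + (1 - fps_const s) * (1 - fps_const t) * X * (I 1 * I u)"
  proof -
    have "D 1 * D u * (I 1 * I u) = (D 1 * I 1) * (D u * I u)" by (simp add: ac_simps)
    moreover have "fps_const ((1 - s) * (1 - t)) = (1 - fps_const s) * (1 - fps_const t)"
      by (simp add: fps_const_mult[symmetric] fps_const_sub[symmetric] del: fps_const_mult fps_const_sub)
    ultimately show ?thesis unfolding \<sigma> DI by (simp add: ac_simps)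
  qed
  also have "\<dots> = (D 1 * D u + (1 - fps_const s) * (1 - fps_const t) * X) * (I 1 * I u)"
    by (simp add: algebra_simps)
  also have "D 1 * D u + (1 - fps_const s) * (1 - fps_const t) * X = D s * D t"
    unfolding D_def st[symmetric] fps_const_1_eq_1 by (simp add: algebra_simps del: fps_const_mult fps_const_add fps_const_sub)
  finally have "Z = 1 + fps_const ((1 - s) * (1 - t)) * \<sigma>" unfolding Z_def by (simp add: ac_simps)
  moreover have n: "card S > 0" using S by (simp add: card_gt_0_iff)
  ultimately have Zn: "Z $ card S = (1 - s) * (1 - t) * (\<Sum>k<card S. u ^ k)" by (simp add: \<sigma>_def)
  have "poly (cycle_poly S p) s * poly (cycle_poly S p) t = cycle_weight f S p" for p
    unfolding cycle_poly_def cycle_weight_def poly_prod prod.distrib[symmetric]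
    by (rule prod.cong) (simp_all add: f_def)
  thus ?thesis
    using sum_cycle_weight(1)[OF z0 rec S(1)] unfolding Zn u_def by simp
qed

text \<open>Dividing \<open>sum_cycle_poly_product\<close> by (1 - s) (1 - t) gives n! times the sum
  of the (st)^k, whose coefficient matrix in s and t is diagonal. The division excludes the value 1,
  but a polynomial is determined by its values elsewhere. Coefficients are compared in one variable
  at a time, with \<open>t\<close> fixed during the comparison in \<open>s\<close>.\<close>

theorem hook_orthogonality:
  fixes S :: "'a set"
  assumes S: "finite S" "S \<noteq> {}" and kl: "k < card S" "l < card S"
  shows "(\<Sum>p | p permutes S. coeff (hook_poly S p) k * coeff (hook_poly S p) l) =
    (if k = l then fact (card S) else 0)"
proof -
  define P where "P = {p. p permutes S}"
  define n where "n = card S"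
  have ev: "poly (cycle_poly S p) x = (1 - x) * poly (hook_poly S p) x" if "p \<in> P" for p x
    using cycle_poly_eq_hook_poly[OF S] that by (simp add: P_def)
  have st: "(\<Sum>p\<in>P. poly (hook_poly S p) s * poly (hook_poly S p) t) = fact n * (\<Sum>k<n. (s * t) ^ k)"
    if "s \<noteq> 1" "t \<noteq> 1" for s t
  proof -
    have "((1 - s) * (1 - t)) * (\<Sum>p\<in>P. poly (hook_poly S p) s * poly (hook_poly S p) t)
        = (\<Sum>p\<in>P. poly (cycle_poly S p) s * poly (cycle_poly S p) t)"
      unfolding sum_distrib_left by (rule sum.cong) (simp_all add: ev)
    also have "\<dots> = fact n * ((1 - s) * (1 - t) * (\<Sum>k<n. (s * t) ^ k))"
      unfolding P_def n_def by (rule sum_cycle_poly_product[OF S])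
    also have "\<dots> = ((1 - s) * (1 - t)) * (fact n * (\<Sum>k<n. (s * t) ^ k))"
      by (simp only: ac_simps)
    finally have "((1 - s) * (1 - t)) * (\<Sum>p\<in>P. poly (hook_poly S p) s * poly (hook_poly S p) t) = \<dots>" .
    moreover have "(1 - s) * (1 - t) \<noteq> 0" using that by simp
    ultimately show ?thesis using mult_left_cancel by blast
  qed
  have ext: "A = B" if "\<And>x. x \<noteq> 1 \<Longrightarrow> poly A x = poly B x" for A B :: "real poly"
  proof (rule ccontr)
    assume "A \<noteq> B"
    hence "finite {x. poly (A - B) x = 0}" by (intro poly_roots_finite) simp
    moreover have "- {1} \<subseteq> {x. poly (A - B) x = 0}" using that by auto
    ultimately have "finite (- {1 :: real})" by (rule rev_finite_subset)
    thus False using infinite_UNIV_char_0[where ?'a = real] by (simp add: finite_compl)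
  qed
  have A: "(\<Sum>p\<in>P. coeff (hook_poly S p) k * poly (hook_poly S p) t) = fact n * t ^ k" if "t \<noteq> 1" for t
  proof -
    have "(\<Sum>p\<in>P. Polynomial.smult (poly (hook_poly S p) t) (hook_poly S p)) = Polynomial.smult (fact n) (\<Sum>k<n. monom (t ^ k) k)"
      by (rule ext) (use st that in \<open>simp add: poly_sum poly_monom power_mult_distrib mult.commute\<close>)
    hence "coeff (\<Sum>p\<in>P. Polynomial.smult (poly (hook_poly S p) t) (hook_poly S p)) k =
      coeff (Polynomial.smult (fact n) (\<Sum>k<n. monom (t ^ k) k)) k" by simp
    thus ?thesis using kl(1) by (simp add: coeff_sum n_def mult.commute if_distrib cong: if_cong)
  qed
  have "(\<Sum>p\<in>P. Polynomial.smult (coeff (hook_poly S p) k) (hook_poly S p)) = monom (fact n) k"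
    by (rule ext) (use A in \<open>simp add: poly_sum poly_monom\<close>)
  hence "coeff (\<Sum>p\<in>P. Polynomial.smult (coeff (hook_poly S p) k) (hook_poly S p)) l = coeff (monom (fact n) k) l" by simp
  thus ?thesis by (simp add: coeff_sum P_def n_def)
qed

section \<open>Products of a full cycle and a cycle of length one less\<close>

lemma sign_eq_num_cycles:
  assumes "finite S" "p permutes S"
  shows "sign p = (-1) ^ (card S + num_cycles S p)"
  using assms
proof (induction S arbitrary: p rule: finite_induct)
  case empty
  thus ?case by (simp add: num_cycles_def)
next
  case (insert x S)
  from insert.prems insert.hyps(2) show ?case
  proof (cases rule: permutes_insert_cases)
    case 1
    thus ?thesis using insert.IH[OF 1] num_cycles_insert_fixed[OF insert.hyps(1) 1 insert.hyps(2)] insert.hyps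
      by simp
  next
    case (2 a q)
    have "sign p = - sign q"
    proof -
      have "a \<noteq> x" using 2 insert.hyps by blast
      moreover have "permutation q" by (rule permutes_imp_permutation[OF insert.hyps(1) 2(2)])
      ultimately show ?thesis unfolding 2(3) by (simp add: sign_compose permutation_swap_id sign_swap_id)
    qed
    moreover have "num_cycles (insert x S) p = num_cycles S q"
      unfolding 2(3) by (rule num_cycles_insert_moved[OF insert.hyps(1) 2(2) insert.hyps(2) 2(1)])
    ultimately show ?thesis using insert.IH[OF 2(2)] insert.hyps by simp
  qed
qed

text \<open>The number of ways to write the inverse of \<open>w\<close> as a product of two full cycles is the
  linear coefficient of $\sum_c y^{\mathrm{cyc}(c w)}$.\<close>

lemma card_full_cycle_factorizations:
  assumes S: "finite S" "S \<noteq> {}" "w permutes S"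
  defines "m \<equiv> card S"
  shows "real (card {c \<in> full_cycles S. c \<circ> w \<in> full_cycles S}) =
    fact (m - 1) / fact m * (\<Sum>k<m. (-1) ^ k * fact k * fact (m - 1 - k) * coeff (hook_poly S w) k)"
proof -
  \<comment> \<open>The expansion \<open>cycle_gf_eq\<close> holds at natural numbers only. Both
    sides are made into polynomials in \<open>y\<close>, so that their linear coefficients can be
    compared.\<close>
  define L :: "real poly" where "L = (\<Sum>c\<in>full_cycles S. monom 1 (num_cycles S (c \<circ> w)))"
  define B :: "nat \<Rightarrow> real poly" where
    "B = (\<lambda>k. Polynomial.smult (1 / fact m) (\<Prod>i<m. [:real (m - 1) - real k - real i, 1:]))"
  define R :: "real poly" where
    "R = Polynomial.smult (fact (m - 1)) (\<Sum>k<m. Polynomial.smult (coeff (hook_poly S w) k) (B k))"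
  have Bk: "poly (B k) (real y) = real ((y + m - 1 - k) choose m)" if "k < m" for k y
  proof -
    have "real (y + m - 1 - k) = real y + (real (m - 1) - real k)" using that by (simp add: of_nat_diff)
    hence "real ((y + m - 1 - k) choose m) = (\<Prod>i=0..<m. real y + (real (m - 1) - real k) - real i) / fact m"
      unfolding binomial_gbinomial gbinomial_prod_rev by simp
    thus ?thesis unfolding B_def by (simp add: poly_prod algebra_simps atLeast0LessThan)
  qed
  have "poly L (real y) = poly R (real y)" for y
  proof -
    have "poly L (real y) = cycle_gf S w (of_nat y)"
      unfolding L_def cycle_gf_def by (simp add: poly_sum poly_monom)
    also have "\<dots> = poly R (real y)"
      unfolding cycle_gf_eq[OF S] R_def using Bk by (simp add: poly_sum m_def[symmetric])
    finally show ?thesis .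
  qed
  hence LR: "L = R"
  proof (rule_tac ccontr)
    assume "L \<noteq> R" and e: "\<And>y. poly L (real y) = poly R (real y)"
    hence "finite {x. poly (L - R) x = 0}" by (intro poly_roots_finite) simp
    moreover have "range real \<subseteq> {x. poly (L - R) x = 0}" using e by auto
    ultimately have "finite (range real)" by (rule rev_finite_subset)
    thus False using range_inj_infinite[of real] by (simp add: inj_on_def)
  qed
  have fin: "finite (full_cycles S)" by (rule finite_full_cycles[OF S(1)])
  have "coeff L 1 = (\<Sum>c\<in>full_cycles S. if num_cycles S (c \<circ> w) = 1 then 1 else 0)"
    unfolding L_def coeff_sum by (rule sum.cong) auto
  also have "\<dots> = real (card {c \<in> full_cycles S. num_cycles S (c \<circ> w) = 1})"
    using sum.inter_filter[OF fin, of "\<lambda>_. 1 :: real" "\<lambda>c. num_cycles S (c \<circ> w) = 1"] by simp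
  also have "{c \<in> full_cycles S. num_cycles S (c \<circ> w) = 1} = {c \<in> full_cycles S. c \<circ> w \<in> full_cycles S}"
    using permutes_compose[OF S(3)] by (auto simp: full_cycles_def)
  finally have L1: "coeff L 1 = real (card {c \<in> full_cycles S. c \<circ> w \<in> full_cycles S})" .
  have B1: "coeff (B k) 1 = (-1) ^ k * fact k * fact (m - 1 - k) / fact m" if k: "k < m" for k
  proof -
    \<comment> \<open>The factor with i = j has constant term 0. The linear coefficient is therefore
      the product of the other constant terms, which is j! over i < j and (-1)^k k! over i >
      j.\<close>
    define j where "j = m - 1 - k"
    have j: "j < m" "real (m - 1) - real k = real j" "m = Suc (j + k)" using k by (auto simp: j_def of_nat_diff)
    have "(\<Prod>i<m. [:real (m - 1) - real k - real i, 1:]) =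
      [:0, 1:] * (\<Prod>i\<in>{..<m} - {j}. [:real j - real i, 1:])"
      using j by (subst prod.remove[of _ j]) auto
    hence "coeff (\<Prod>i<m. [:real (m - 1) - real k - real i, 1:]) 1 =
      coeff (\<Prod>i\<in>{..<m} - {j}. [:real j - real i, 1:]) 0" by simp
    also have "\<dots> = (\<Prod>i\<in>{..<m} - {j}. real j - real i)"
      unfolding poly_0_coeff_0[symmetric] poly_prod by simp
    also have "{..<m} - {j} = {..<j} \<union> {Suc j..<m}" using j by auto
    also have "(\<Prod>i\<in>{..<j} \<union> {Suc j..<m}. real j - real i) =
        (\<Prod>i<j. real j - real i) * (\<Prod>i=Suc j..<m. real j - real i)"
      by (rule prod.union_disjoint) auto
    also have "(\<Prod>i<j. real j - real i) = (\<Prod>i<j. real (Suc i))"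
      by (rule prod.reindex_bij_witness[of _ "\<lambda>i. j - Suc i" "\<lambda>i. j - Suc i"]) (auto simp: of_nat_diff)
    also have "\<dots> = fact j" by (simp add: fact_prod_Suc atLeast0LessThan)
    also have "(\<Prod>i=Suc j..<m. real j - real i) = (\<Prod>i<k. - real (Suc i))"
      by (rule prod.reindex_bij_witness[of _ "\<lambda>i. Suc j + i" "\<lambda>i. i - Suc j"]) (auto simp: of_nat_diff j(3))
    also have "\<dots> = (-1) ^ k * fact k"
      unfolding prod_uminus by (simp add: fact_prod_Suc atLeast0LessThan)
    finally show ?thesis unfolding B_def j_def by simp
  qed
  have "coeff R 1 = fact (m - 1) * (\<Sum>k<m. coeff (hook_poly S w) k * coeff (B k) 1)"
    unfolding R_def by (simp add: coeff_sum)
  also have "\<dots> = fact (m - 1) * (\<Sum>k<m. (1 / fact m) * ((-1) ^ k * fact k * fact (m - 1 - k) * coeff (hook_poly S w) k))"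
    by (rule arg_cong[where f = "(*) (fact (m - 1))"], rule sum.cong[OF refl])
       (simp only: B1 lessThan_iff, simp)
  finally show ?thesis unfolding L1[symmetric] LR sum_distrib_left[symmetric] by simp
qed

section \<open>Deleting a moved point from a permutation\<close>

definition remove_point :: "'a \<Rightarrow> ('a \<Rightarrow> 'a) \<Rightarrow> 'a \<Rightarrow> 'a" where
  "remove_point i z = Transposition.transpose i (z i) \<circ> z"

text \<open>Deletion sends the predecessor of \<open>i\<close> directly to \<open>z i\<close>, so
  the cycle of a moved point \<open>i\<close> loses \<open>i\<close> and nothing else changes.
  Inserting \<open>i\<close> before \<open>z i\<close> undoes this.\<close>

lemma remove_point:
  assumes "z permutes S" "i \<in> S"
  shows "remove_point i z permutes S - {i}" "z = Transposition.transpose (z i) i \<circ> remove_point i z"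
proof -
  have "z permutes insert i (S - {i})" using assms by (simp add: insert_absorb)
  thus "remove_point i z permutes S - {i}" unfolding remove_point_def by (rule permutes_insert_lemma)
  show "z = Transposition.transpose (z i) i \<circ> remove_point i z"
    by (auto simp: fun_eq_iff remove_point_def transpose_commute)
qed

text \<open>Deleting a point shortens its cycle, of length k, by one, and this happens for k points.
  The new factor then is k (1 - X^(k-1)), a combination of 1 - X^k and its derivative. A fixed point
  would leave the factor 1 - X^0 = 0, so restricting the sum to moved points changes
  nothing.\<close>

lemma sum_cycle_poly_remove_point:
  assumes S: "finite S" "z permutes S"
  shows "(\<Sum>i | i \<in> S \<and> z i \<noteq> i. cycle_poly (S - {i}) (remove_point i z)) =
    of_nat (card S) * cycle_poly S z + (1 - [:0, 1:]) * pderiv (cycle_poly S z)"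
proof -
  define f where "f = (\<lambda>k. 1 - [:0, 1 :: real:] ^ k)"
  define P where "P = (\<lambda>C. \<Prod>D\<in>orbit z ` S - {C}. f (card D))"
  have c: "(if z i \<noteq> i then cycle_weight f (S - {i}) (remove_point i z) else 0)
      = f (card (orbit z i) - 1) * P (orbit z i)" if i: "i \<in> S" for i
  proof (cases "z i = i")
    case True
    hence "orbit z i = {i}" by (simp add: orbit_eq_singleton_iff)
    thus ?thesis using True by (simp add: f_def)
  next
    case False
    define q where "q = remove_point i z"
    have T: "finite (S - {i})" "q permutes S - {i}" "i \<notin> S - {i}" "z i \<in> S - {i}" "insert i (S - {i}) = S"
      using S i False remove_point(1)[OF S(2) i] permutes_in_image[OF S(2), of i] by (auto simp: q_def)
    have z: "z = Transposition.transpose (z i) i \<circ> q" unfolding q_def by (rule remove_point(2)[OF S(2) i])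
    have "cycle_weight f (S - {i}) q = f (card (orbit q (z i))) * cycle_coweight f (S - {i}) q (z i)"
      by (rule cycle_weight_eq_coweight[OF T(1,4)])
    also have "cycle_coweight f (S - {i}) q (z i) = cycle_coweight f S z i"
      using cycle_coweight_insert_moved[OF T(1-4), of f] unfolding T(5) z[symmetric] ..
    also have "cycle_coweight f S z i = P (orbit z i)" by (simp add: P_def cycle_coweight_def)
    also have "card (orbit q (z i)) = card (orbit z i) - 1"
      using orbit_image_insert_moved(1)[OF T(1-4)] unfolding z[symmetric] by simp
    finally show ?thesis using False by (simp add: q_def)
  qed
  have PQ: "f (card C) * P C = cycle_weight f S z" if "C \<in> orbit z ` S" for C
    unfolding cycle_weight_def P_def using S(1) that by (simp add: prod.remove[of "orbit z ` S" C])
  \<comment> \<open>That is, k (1 - X^(k-1)) = k (1 - X^k) - (1 - X) k X^(k-1). The derivative is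
    obtained from \<open>X_pderiv_power\<close> by cancelling X.\<close>
  have fd: "of_nat k * f (k - 1) = of_nat k * f k + (1 - [:0, 1:]) * pderiv (f k)" if k0: "k > 0" for k
  proof -
    obtain j where k: "k = Suc j" using k0 by (cases k) auto
    have "[:0, 1:] * pderiv (f k) = - (of_nat k * [:0, 1:] ^ k)"
      using X_pderiv_power[of k] by (simp add: f_def pderiv_diff)
    hence "[:0, 1:] * pderiv (f k) = [:0, 1:] * (- (of_nat k * [:0, 1:] ^ j))" by (simp only: k power_Suc ac_simps mult_minus_right)
    moreover have "[:0, 1 :: real:] \<noteq> 0" by simp
    ultimately have pd: "pderiv (f k) = - (of_nat k * [:0, 1:] ^ j)" using mult_left_cancel by blast
    have "a * (1 - y) = a * (1 - x * y) + (1 - x) * - (a * y)" for a x y :: "real poly"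
      by (simp add: algebra_simps)
    thus ?thesis unfolding pd unfolding k f_def diff_Suc_1 power_Suc .
  qed
  have "(\<Sum>i | i \<in> S \<and> z i \<noteq> i. cycle_weight f (S - {i}) (remove_point i z))
    = (\<Sum>i\<in>S. f (card (orbit z i) - 1) * P (orbit z i))"
    using sum.inter_filter[OF S(1), of "\<lambda>i. cycle_weight f (S - {i}) (remove_point i z)" "\<lambda>i. z i \<noteq> i"] c
    by simp
  also have "\<dots> = (\<Sum>i\<in>\<Union>(orbit z ` S). f (card (orbit z i) - 1) * P (orbit z i))"
    unfolding Union_orbits[OF S] ..
  also have "\<dots> = (\<Sum>C\<in>orbit z ` S. of_nat (card C) * (f (card C - 1) * P C))"
    by (rule sum_over_orbits[OF S subset_refl])
  also have "\<dots> = (\<Sum>C\<in>orbit z ` S. of_nat (card C) * cycle_weight f S z + (1 - [:0, 1:]) * (P C * pderiv (f (card C))))"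
  proof (rule sum.cong[OF refl])
    fix C assume C: "C \<in> orbit z ` S"
    hence "card C > 0" using card_orbit_pos[OF S] by blast
    hence "of_nat (card C) * (f (card C - 1) * P C) =
        (of_nat (card C) * f (card C) + (1 - [:0, 1:]) * pderiv (f (card C))) * P C"
      using fd by (simp only: mult.assoc[symmetric])
    also have "\<dots> = of_nat (card C) * (f (card C) * P C) + (1 - [:0, 1:]) * (P C * pderiv (f (card C)))"
      by (simp only: algebra_simps)
    finally show "of_nat (card C) * (f (card C - 1) * P C) =
      of_nat (card C) * cycle_weight f S z + (1 - [:0, 1:]) * (P C * pderiv (f (card C)))"
      unfolding PQ[OF C] .
  qed
  also have "\<dots> = of_nat (card S) * cycle_weight f S z + (1 - [:0, 1:]) * pderiv (cycle_weight f S z)"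
  proof -
    have "pderiv (cycle_weight f S z) = (\<Sum>C\<in>orbit z ` S. P C * pderiv (f (card C)))"
      unfolding cycle_weight_def pderiv_prod P_def ..
    moreover have "(of_nat (card S) :: real poly) = (\<Sum>C\<in>orbit z ` S. of_nat (card C))"
      by (simp flip: of_nat_sum add: sum_card_orbits[OF S])
    ultimately show ?thesis by (simp only: sum.distrib sum_distrib_left sum_distrib_right)
  qed
  finally show ?thesis by (simp add: cycle_poly_def f_def)
qed

text \<open>Since \<open>Y = 1 - X\<close> has derivative -1, differentiating the product of
  \<open>Y\<close> and the hook polynomial lowers the factor \<open>card S\<close> by one when
  \<open>Y\<close> is cancelled.\<close>

lemma sum_hook_poly_remove_point:
  assumes S: "finite S" "card S \<ge> 2" "z permutes S"
  shows "(\<Sum>i | i \<in> S \<and> z i \<noteq> i. hook_poly (S - {i}) (remove_point i z)) =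
    of_nat (card S - 1) * hook_poly S z + (1 - [:0, 1:]) * pderiv (hook_poly S z)"
proof -
  define Y :: "real poly" where "Y = 1 - [:0, 1:]"
  have Y': "pderiv Y = -1" by (simp add: Y_def pderiv_diff pderiv_pCons one_pCons)
  have ne: "S \<noteq> {}" using S(2) by auto
  have "S - {i} \<noteq> {}" if "i \<in> S" for i using S(1,2) that by (metis card_le_Suc0_iff_eq Diff_eq_empty_iff singletonD subsetD not_less_eq_eq numeral_2_eq_2)
  hence "Y * (\<Sum>i | i \<in> S \<and> z i \<noteq> i. hook_poly (S - {i}) (remove_point i z)) =
      (\<Sum>i | i \<in> S \<and> z i \<noteq> i. cycle_poly (S - {i}) (remove_point i z))"
    unfolding sum_distrib_left Y_def using S(1) remove_point(1)[OF S(3)]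
    by (intro sum.cong refl cycle_poly_eq_hook_poly[symmetric]) auto
  also have "\<dots> = of_nat (card S) * (Y * hook_poly S z) + Y * pderiv (Y * hook_poly S z)"
    unfolding sum_cycle_poly_remove_point[OF S(1,3)] cycle_poly_eq_hook_poly[OF S(1) ne S(3)] Y_def ..
  also have "\<dots> = Y * (of_nat (card S - 1) * hook_poly S z + Y * pderiv (hook_poly S z))"
  proof -
    have "(of_nat (card S) :: real poly) = of_nat (card S - 1) + 1" using S(2) by (simp add: of_nat_diff)
    thus ?thesis unfolding pderiv_mult Y' by (simp only: algebra_simps)
  qed
  finally have "Y * (\<Sum>i | i \<in> S \<and> z i \<noteq> i. hook_poly (S - {i}) (remove_point i z)) = \<dots>" .
  moreover have "Y \<noteq> 0" unfolding Y_def by (simp add: one_pCons)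
  ultimately show ?thesis unfolding Y_def using mult_left_cancel by blast
qed

text \<open>Here lies the reason for the uniform distribution on odd permutations. By
  \<open>sum_hook_poly_remove_point\<close>, the coefficients of index k become (m - k) q_k + (k +
  1) q_(k+1); multiplied by (-1)^k k! (m - 1 - k)! these are the differences
  \<open>A k - A (Suc k)\<close>. The sum telescopes, and only the trivial character in
  \<open>A 0\<close> and the sign character in \<open>A m\<close> remain.\<close>

lemma sum_full_cycle_factorizations_remove_point:
  assumes S: "finite S" "card S \<ge> 2" "z permutes S"
  shows "(\<Sum>i | i \<in> S \<and> z i \<noteq> i. real (card {c \<in> full_cycles (S - {i}). c \<circ> remove_point i z \<in> full_cycles (S - {i})}))
    = fact (card S - 2) * (1 - of_int (sign z))"
proof -
  obtain m where m: "card S = Suc m" "m > 0" using S(2) by (cases "card S") auto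
  have ne: "S \<noteq> {}" using S(2) by auto
  define q where "q = coeff (hook_poly S z)"
  define A where "A = (\<lambda>k. (-1) ^ k * fact k * fact (m - k) * q k :: real)"
  have N: "real (card {c \<in> full_cycles (S - {i}). c \<circ> remove_point i z \<in> full_cycles (S - {i})}) =
    fact (m - 1) / fact m * (\<Sum>k<m. (-1) ^ k * fact k * fact (m - 1 - k) * coeff (hook_poly (S - {i}) (remove_point i z)) k)"
    if "i \<in> S" for i
  proof -
    have "card (S - {i}) = m" using that S(1) m by simp
    thus ?thesis
      using card_full_cycle_factorizations[of "S - {i}" "remove_point i z"] S(1) m(2) remove_point(1)[OF S(3) that]
      by (metis card.empty finite_Diff less_irrefl)
  qed
  have D: "(\<Sum>i | i \<in> S \<and> z i \<noteq> i. coeff (hook_poly (S - {i}) (remove_point i z)) k) =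
    real (m - k) * q k + real (Suc k) * q (Suc k)" if "k < m" for k
  proof -
    have X: "(1 - [:0, 1:] :: real poly) = [:1, -1:]" by (simp add: one_pCons)
    have "(\<Sum>i | i \<in> S \<and> z i \<noteq> i. coeff (hook_poly (S - {i}) (remove_point i z)) k) =
      coeff (of_nat m * hook_poly S z + [:1, -1:] * pderiv (hook_poly S z)) k"
      unfolding coeff_sum[symmetric] sum_hook_poly_remove_point[OF S] X m(1) by simp
    also have "\<dots> = real m * q k + real (Suc k) * q (Suc k) - real k * q k"
      by (cases k) (simp_all add: of_nat_poly coeff_pderiv q_def algebra_simps)
    finally show ?thesis using that by (simp add: of_nat_diff algebra_simps)
  qed
  have "(\<Sum>i | i \<in> S \<and> z i \<noteq> i. real (card {c \<in> full_cycles (S - {i}). c \<circ> remove_point i z \<in> full_cycles (S - {i})}))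
    = (\<Sum>i | i \<in> S \<and> z i \<noteq> i. fact (m - 1) / fact m * (\<Sum>k<m. (-1) ^ k * fact k * fact (m - 1 - k) * coeff (hook_poly (S - {i}) (remove_point i z)) k))"
    by (rule sum.cong) (use N in auto)
  also have "\<dots> = fact (m - 1) / fact m * (\<Sum>k<m. (-1) ^ k * fact k * fact (m - 1 - k) *
      (\<Sum>i | i \<in> S \<and> z i \<noteq> i. coeff (hook_poly (S - {i}) (remove_point i z)) k))"
    unfolding sum_distrib_left by (subst sum.swap) (rule refl)
  also have "(\<Sum>k<m. (-1) ^ k * fact k * fact (m - 1 - k) *
      (\<Sum>i | i \<in> S \<and> z i \<noteq> i. coeff (hook_poly (S - {i}) (remove_point i z)) k)) = (\<Sum>k<m. A k - A (Suc k))"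
  proof (rule sum.cong[OF refl])
    fix k assume "k \<in> {..<m}"
    hence k: "k < m" by simp
    then obtain j where j: "m - k = Suc j" by (metis Suc_diff_Suc)
    hence e: "m - 1 - k = j" "m - Suc k = j" by auto
    show "(-1) ^ k * fact k * fact (m - 1 - k) *
      (\<Sum>i | i \<in> S \<and> z i \<noteq> i. coeff (hook_poly (S - {i}) (remove_point i z)) k) = A k - A (Suc k)"
      unfolding D[OF k] A_def e j by (simp add: algebra_simps)
  qed
  also have "\<dots> = A 0 - A m" by (rule sum_lessThan_telescope')
  also have "\<dots> = fact m * (1 - of_int (sign z))"
  proof -
    have "q 0 = 1" unfolding q_def by (rule coeff_hook_poly(1)[OF S(1) ne S(3)])
    moreover have "q m = - ((-1) ^ num_cycles S z)"
      using coeff_hook_poly(3)[OF S(1) ne S(3)] m(1) by (simp add: q_def)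
    moreover have "sign z = - ((-1) ^ m * (-1) ^ num_cycles S z)"
      using sign_eq_num_cycles[OF S(1,3)] m(1) by (simp add: power_add)
    ultimately show ?thesis by (simp add: A_def algebra_simps)
  qed
  also have "fact (m - 1) / fact m * (fact m * (1 - of_int (sign z))) =
      fact (card S - 2) * (1 - real_of_int (sign z))"
    using m by (simp add: numeral_2_eq_2)
  finally show ?thesis .
qed

lemma inv_mem_full_cycles:
  assumes "finite T" "c \<in> full_cycles T"
  shows "inv_into UNIV c \<in> full_cycles T" "inv_into UNIV (inv_into UNIV c) = c"
proof -
  have c: "c permutes T" by (rule full_cycles_permutes[OF assms(2)])
  have "orbit (inv_into UNIV c) x = orbit c x" for x
    by (rule orbit_inv_eq[OF permutes_imp_permutation[OF assms(1) c]])
  thus "inv_into UNIV c \<in> full_cycles T"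
    using assms(2) permutes_inv[OF c] by (simp add: full_cycles_def num_cycles_def)
  show "inv_into UNIV (inv_into UNIV c) = c" by (rule permutes_inv_inv[OF c])
qed

text \<open>The product of a random full cycle and a random cycle of length one less is uniformly
  distributed on the odd permutations.\<close>

theorem sum_full_cycle_mult_subfull_cycle:
  fixes h :: "('a \<Rightarrow> 'a) \<Rightarrow> real"
  assumes S: "finite S" "card S \<ge> 2"
  shows "(\<Sum>i\<in>S. \<Sum>d\<in>full_cycles (S - {i}). \<Sum>c\<in>full_cycles S. h (c \<circ> d)) =
    fact (card S - 2) * (\<Sum>z | z permutes S. (1 - of_int (sign z)) * h z)"
proof -
  let ?t = Transposition.transpose
  define N where "N = (\<lambda>T (w :: 'a \<Rightarrow> 'a). real (card {c \<in> full_cycles T. c \<circ> w \<in> full_cycles T}))"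
  \<comment> \<open>As \<open>d\<close> fixes \<open>i\<close> and \<open>c\<close> does not,
    \<open>c \<circ> d\<close> moves \<open>i\<close>. Deleting \<open>i\<close> from it leaves
    \<open>q \<circ> d\<close>, where \<open>q\<close> is \<open>c\<close> without \<open>i\<close>.
    Hence \<open>z\<close> is attained as often as \<open>remove_point i z\<close> is a product of
    two full cycles on \<open>S - {i}\<close>.\<close>
  have inner: "(\<Sum>d\<in>full_cycles (S - {i}). \<Sum>c\<in>full_cycles S. h (c \<circ> d)) =
      (\<Sum>z | z permutes S. if z i \<noteq> i then N (S - {i}) (remove_point i z) * h z else 0)"
    if i: "i \<in> S" for i
  proof -
    define T where "T = S - {i}"
    have "card T = card S - 1" using i S(1) by (simp add: T_def)
    hence "T \<noteq> {}" using S(2) by force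
    hence T: "finite T" "T \<noteq> {}" "i \<notin> T" "insert i T = S" using S i by (auto simp: T_def)
    have fT: "finite (full_cycles T)" "finite {p. p permutes T}"
      using finite_full_cycles finite_permutations T(1) by blast+
    \<comment> \<open>\<open>N T p\<close> counts the full cycles \<open>c\<close> for which
      \<open>c \<circ> p\<close> is a full cycle. Inverting \<open>c\<close> turns these into the
      factorizations of \<open>p\<close>.\<close>
    have cnt: "(\<Sum>d\<in>full_cycles T. \<Sum>q\<in>full_cycles T. H (q \<circ> d)) = (\<Sum>p | p permutes T. N T p * H p)"
      for H :: "('a \<Rightarrow> 'a) \<Rightarrow> real"
    proof -
      note inv = inv_mem_full_cycles[OF T(1)]
      have "(\<Sum>p | p permutes T. N T p * H p) =
          (\<Sum>p | p permutes T. \<Sum>c\<in>full_cycles T. if c \<circ> p \<in> full_cycles T then H p else 0)"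
        unfolding N_def using sum.inter_filter[OF fT(1)]
        by (intro sum.cong refl) (simp add: sum.inter_filter[OF fT(1), symmetric])
      also have "\<dots> = (\<Sum>c\<in>full_cycles T. \<Sum>p | p permutes T. if c \<circ> p \<in> full_cycles T then H p else 0)"
        by (rule sum.swap)
      also have "\<dots> = (\<Sum>c\<in>full_cycles T. \<Sum>d\<in>full_cycles T. H (inv_into UNIV c \<circ> d))"
      proof (rule sum.cong[OF refl])
        fix c assume c: "c \<in> full_cycles T"
        hence cT: "c permutes T" by (rule full_cycles_permutes)
        have "(\<Sum>p | p permutes T. if c \<circ> p \<in> full_cycles T then H p else 0) =
            (\<Sum>p | p permutes T \<and> c \<circ> p \<in> full_cycles T. H p)"
          using sum.inter_filter[OF fT(2), of H "\<lambda>p. c \<circ> p \<in> full_cycles T"] by simp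
        also have "\<dots> = (\<Sum>d\<in>full_cycles T. H (inv_into UNIV c \<circ> d))"
          by (rule sum.reindex_bij_witness[of _ "\<lambda>d. inv_into UNIV c \<circ> d" "\<lambda>p. c \<circ> p"])
             (use permutes_inv_o[OF cT] permutes_compose[OF full_cycles_permutes permutes_inv[OF cT]]
              in \<open>auto simp: comp_assoc[symmetric]\<close>)
        finally show "(\<Sum>p | p permutes T. if c \<circ> p \<in> full_cycles T then H p else 0) =
          (\<Sum>d\<in>full_cycles T. H (inv_into UNIV c \<circ> d))" .
      qed
      also have "\<dots> = (\<Sum>q\<in>full_cycles T. \<Sum>d\<in>full_cycles T. H (q \<circ> d))"
        by (rule sum.reindex_bij_witness[of _ "inv_into UNIV" "inv_into UNIV"])
           (use inv in auto)
      also have "\<dots> = (\<Sum>d\<in>full_cycles T. \<Sum>q\<in>full_cycles T. H (q \<circ> d))" by (rule sum.swap)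
      finally show ?thesis ..
    qed
    have "(\<Sum>d\<in>full_cycles T. \<Sum>c\<in>full_cycles S. h (c \<circ> d)) =
        (\<Sum>d\<in>full_cycles T. \<Sum>q\<in>full_cycles T. \<Sum>b\<in>T. h ((q \<circ> ?t i b) \<circ> d))"
      by (rule sum.cong[OF refl]) (rule sum_full_cycles_insert[OF T(1-3), unfolded T(4)])
    also have "\<dots> = (\<Sum>d\<in>full_cycles T. \<Sum>q\<in>full_cycles T. \<Sum>b\<in>T. h (?t i b \<circ> (q \<circ> d)))"
    proof (rule sum.cong[OF refl], rule sum.cong[OF refl])
      fix q d assume "q \<in> full_cycles T"
      hence q: "q permutes T" by (rule full_cycles_permutes)
      have "(\<Sum>b\<in>T. h ((q \<circ> ?t i b) \<circ> d)) = (\<Sum>b\<in>T. h (?t i (q b) \<circ> (q \<circ> d)))"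
        using comp_transpose[OF permutes_inj[OF q], of i] permutes_not_in[OF q T(3)]
        by (simp add: comp_assoc)
      also have "\<dots> = (\<Sum>b\<in>T. h (?t i b \<circ> (q \<circ> d)))"
        by (rule sum.permute[OF q, unfolded comp_def, symmetric])
      finally show "(\<Sum>b\<in>T. h ((q \<circ> ?t i b) \<circ> d)) = (\<Sum>b\<in>T. h (?t i b \<circ> (q \<circ> d)))" .
    qed
    also have "\<dots> = (\<Sum>p | p permutes T. N T p * (\<Sum>b\<in>T. h (?t i b \<circ> p)))" by (rule cnt)
    also have "\<dots> = (\<Sum>b\<in>T. \<Sum>p | p permutes T. N T p * h (?t i b \<circ> p))"
      unfolding sum_distrib_left by (rule sum.swap)
    also have "\<dots> = (\<Sum>z | z permutes S. if z i \<noteq> i then N T (remove_point i z) * h z else 0)"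
    proof -
      have ti: "(?t i b \<circ> p) i = b" "remove_point i (?t i b \<circ> p) = p" if "p permutes T" for b p
        using permutes_not_in[OF that T(3)] by (auto simp: fun_eq_iff remove_point_def)
      have "(\<Sum>z | z permutes S. if z i \<noteq> i then N T (remove_point i z) * h z else 0) =
        (\<Sum>b\<in>insert i T. \<Sum>p | p permutes T. if b \<noteq> i then N T p * h (?t i b \<circ> p) else 0)"
        unfolding T(4)[symmetric] sum_over_permutations_insert[OF T(1,3)]
        by (intro sum.cong refl) (simp only: mem_Collect_eq ti)
      also have "\<dots> = (\<Sum>b\<in>T. \<Sum>p | p permutes T. if b \<noteq> i then N T p * h (?t i b \<circ> p) else 0)"
        unfolding sum.insert[OF T(1,3)] by simp
      also have "\<dots> = (\<Sum>b\<in>T. \<Sum>p | p permutes T. N T p * h (?t i b \<circ> p))"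
        using T(3) by (intro sum.cong refl) auto
      finally show ?thesis ..
    qed
    finally show ?thesis unfolding T_def .
  qed
  have "(\<Sum>i\<in>S. \<Sum>d\<in>full_cycles (S - {i}). \<Sum>c\<in>full_cycles S. h (c \<circ> d)) =
    (\<Sum>i\<in>S. \<Sum>z | z permutes S. if z i \<noteq> i then N (S - {i}) (remove_point i z) * h z else 0)"
    by (rule sum.cong[OF refl inner])
  also have "\<dots> = (\<Sum>z | z permutes S. \<Sum>i\<in>S. if z i \<noteq> i then N (S - {i}) (remove_point i z) * h z else 0)"
    by (rule sum.swap)
  also have "\<dots> = (\<Sum>z | z permutes S. fact (card S - 2) * ((1 - of_int (sign z)) * h z))"
  proof (rule sum.cong[OF refl])
    fix z assume "z \<in> {z. z permutes S}"
    hence z: "z permutes S" by simp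
    have "(\<Sum>i\<in>S. if z i \<noteq> i then N (S - {i}) (remove_point i z) * h z else 0) =
        (\<Sum>i | i \<in> S \<and> z i \<noteq> i. N (S - {i}) (remove_point i z)) * h z"
      using sum.inter_filter[OF S(1), of "\<lambda>i. N (S - {i}) (remove_point i z) * h z" "\<lambda>i. z i \<noteq> i"]
      by (simp add: sum_distrib_right)
    also have "\<dots> = fact (card S - 2) * ((1 - of_int (sign z)) * h z)"
      unfolding N_def sum_full_cycle_factorizations_remove_point[OF S z] by (rule mult.assoc)
    finally show "(\<Sum>i\<in>S. if z i \<noteq> i then N (S - {i}) (remove_point i z) * h z else 0) =
      fact (card S - 2) * ((1 - of_int (sign z)) * h z)" .
  qed
  finally show ?thesis by (simp add: sum_distrib_left)
qed

section \<open>The pairing of cycle counts\<close>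

text \<open>A new point either is fixed, which contributes the factor \<open>y\<close>, or is
  inserted into a cycle in one of \<open>card S\<close> ways, which keeps the number of cycles and
  changes the sign.\<close>

lemma sum_pow_num_cycles:
  fixes y :: real
  assumes "finite S"
  shows "(\<Sum>p | p permutes S. y ^ num_cycles S p) = (\<Prod>i<card S. y + real i)"
    and "(\<Sum>p | p permutes S. of_int (sign p) * y ^ num_cycles S p) = (\<Prod>i<card S. y - real i)"
proof -
  let ?t = Transposition.transpose
  have "(\<Sum>p | p permutes S. y ^ num_cycles S p) = (\<Prod>i<card S. y + real i) \<and>
    (\<Sum>p | p permutes S. of_int (sign p) * y ^ num_cycles S p) = (\<Prod>i<card S. y - real i)"
    using assms
  proof (induction S rule: finite_induct)
    case empty
    thus ?case by (simp add: num_cycles_def)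
  next
    case (insert x S)
    have f: "num_cycles (insert x S) q = Suc (num_cycles S q)" if "q permutes S" for q
      by (rule num_cycles_insert_fixed[OF insert.hyps(1) that insert.hyps(2)])
    have g: "num_cycles (insert x S) (?t x b \<circ> q) = num_cycles S q" if "q permutes S" "b \<in> S" for b q
      using num_cycles_insert_moved[OF insert.hyps(1) that(1) insert.hyps(2) that(2)]
      unfolding transpose_commute[of b x] .
    have sg: "sign (?t x b \<circ> q) = - sign q" if "q permutes S" "b \<in> S" for b q
    proof -
      have "b \<noteq> x" using that insert.hyps by blast
      moreover have "permutation q" by (rule permutes_imp_permutation[OF insert.hyps(1) that(1)])
      ultimately show ?thesis by (simp add: sign_compose permutation_swap_id sign_swap_id)
    qed
    have "(\<Sum>p | p permutes insert x S. y ^ num_cycles (insert x S) p) =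
        y * (\<Sum>q | q permutes S. y ^ num_cycles S q) + (\<Sum>b\<in>S. \<Sum>q | q permutes S. y ^ num_cycles S q)"
      unfolding sum_over_permutations_insert[OF insert.hyps] sum.insert[OF insert.hyps] sum_distrib_left
      by (intro arg_cong2[of _ _ _ _ "(+)"] sum.cong refl) (simp_all add: f g)
    moreover have "(\<Sum>p | p permutes insert x S. of_int (sign p) * y ^ num_cycles (insert x S) p) =
        y * (\<Sum>q | q permutes S. of_int (sign q) * y ^ num_cycles S q)
        + (\<Sum>b\<in>S. - (\<Sum>q | q permutes S. of_int (sign q) * y ^ num_cycles S q))"
      unfolding sum_over_permutations_insert[OF insert.hyps] sum.insert[OF insert.hyps]
        sum_distrib_left sum_negf[symmetric]
      by (intro arg_cong2[of _ _ _ _ "(+)"] sum.cong refl) (simp_all add: f g sg)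
    ultimately show ?case using insert by (simp add: algebra_simps)
  qed
  thus "(\<Sum>p | p permutes S. y ^ num_cycles S p) = (\<Prod>i<card S. y + real i)"
    and "(\<Sum>p | p permutes S. of_int (sign p) * y ^ num_cycles S p) = (\<Prod>i<card S. y - real i)"
    by blast+
qed

text \<open>The multiplicity of the hook character $(n - k, 1^k)$ in the permutation character
  $y^{\mathrm{cyc}}$, divided by the degree of that character.\<close>

definition hook_mult :: "nat \<Rightarrow> nat \<Rightarrow> nat \<Rightarrow> real" where
  "hook_mult n k y = real ((y + n - 1 - k) choose n)"

lemma hook_mult_extreme:
  assumes "n > 0"
  shows "fact n * hook_mult n 0 y = (\<Prod>i<n. real y + real i)"
    "fact n * hook_mult n (n - 1) y = (\<Prod>i<n. real y - real i)"
proof -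
  have "(\<Prod>i<n. real (y + n - 1) - real i) = (\<Prod>i<n. real y + real i)"
    by (rule prod.reindex_bij_witness[of _ "\<lambda>i. n - Suc i" "\<lambda>i. n - Suc i"]) (auto simp: of_nat_diff)
  thus "fact n * hook_mult n 0 y = (\<Prod>i<n. real y + real i)"
    unfolding hook_mult_def binomial_gbinomial gbinomial_prod_rev by (simp add: atLeast0LessThan)
  have "y + n - 1 - (n - 1) = y" using assms by simp
  thus "fact n * hook_mult n (n - 1) y = (\<Prod>i<n. real y - real i)"
    unfolding hook_mult_def binomial_gbinomial gbinomial_prod_rev by (simp add: atLeast0LessThan)
qed

lemma sum_pow_num_cycles_hook_mult:
  assumes "finite S" "S \<noteq> {}"
  shows "(\<Sum>p | p permutes S. real y ^ num_cycles S p) = fact (card S) * hook_mult (card S) 0 y"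
    "(\<Sum>p | p permutes S. of_int (sign p) * real y ^ num_cycles S p) = fact (card S) * hook_mult (card S) (card S - 1) y"
proof -
  have "card S > 0" using assms by (simp add: card_gt_0_iff)
  thus "(\<Sum>p | p permutes S. real y ^ num_cycles S p) = fact (card S) * hook_mult (card S) 0 y"
    "(\<Sum>p | p permutes S. of_int (sign p) * real y ^ num_cycles S p) = fact (card S) * hook_mult (card S) (card S - 1) y"
    using sum_pow_num_cycles[OF assms(1)] hook_mult_extreme by simp_all
qed

text \<open>The falling factorial at y = 1 contains the factor with i = 1.\<close>

lemma sum_sign_permutes:
  assumes "finite S" "card S \<ge> 2"
  shows "(\<Sum>p | p permutes S. of_int (sign p) :: real) = 0"
proof -
  have "(\<Prod>i<card S. 1 - real i) = 0"
    using assms by (subst prod_zero_iff) (auto intro!: bexI[of _ 1])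
  thus ?thesis using sum_pow_num_cycles(2)[OF assms(1), of 1] by simp
qed

section \<open>Correlations of cycle counts under random translations\<close>

lemma sum_permutes_compose_left:
  assumes "q permutes S"
  shows "(\<Sum>p | p permutes S. h (q \<circ> p)) = (\<Sum>p | p permutes S. h p)"
  using permutes_compose[OF _ assms] permutes_compose[OF _ permutes_inv[OF assms]]
    permutes_inv_o[OF assms]
  by (intro sum.reindex_bij_witness[of _ "\<lambda>p. inv_into UNIV q \<circ> p" "\<lambda>p. q \<circ> p"])
     (auto simp: comp_assoc[symmetric])

text \<open>The counterpart on the symmetric group of the correlation \<open>corr\<close> on the
  reflection group; averaging \<open>corr\<close> over colours leaves two of these pairings.\<close>

definition cycle_pairing :: "'a set \<Rightarrow> nat \<Rightarrow> nat \<Rightarrow> ('a \<Rightarrow> 'a) \<Rightarrow> real" where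
  "cycle_pairing S a b p =
    (\<Sum>q | q permutes S. real a ^ num_cycles S q * real b ^ num_cycles S (p \<circ> q))"

text \<open>The substitution w = d \<circ> q separates the two cycles: the first exponent then
  involves only the inverse of \<open>d\<close>, the second only \<open>c\<close>. Inverses of full
  cycles are full cycles, so the sum is that of the products
  \<open>cycle_gf S w a * cycle_gf S w b\<close> over all \<open>w\<close>, and
  \<open>hook_orthogonality\<close> makes the double sum over hooks diagonal.\<close>

theorem sum_cycle_pairing_full_full:
  assumes S: "finite S" "S \<noteq> {}"
  defines "n \<equiv> card S"
  shows "(\<Sum>c\<in>full_cycles S. \<Sum>d\<in>full_cycles S. cycle_pairing S a b (c \<circ> d)) =
    fact (n - 1) * fact (n - 1) * fact n * (\<Sum>k<n. hook_mult n k a * hook_mult n k b)"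
proof -
  let ?P = "{p. p permutes S}"
  have "(\<Sum>c\<in>full_cycles S. \<Sum>d\<in>full_cycles S. cycle_pairing S a b (c \<circ> d))
    = (\<Sum>c\<in>full_cycles S. \<Sum>d\<in>full_cycles S. \<Sum>w\<in>?P.
        real a ^ num_cycles S (inv_into UNIV d \<circ> w) * real b ^ num_cycles S (c \<circ> w))"
  proof (intro sum.cong refl)
    fix c d assume "d \<in> full_cycles S"
    hence d: "d permutes S" by (rule full_cycles_permutes)
    have "cycle_pairing S a b (c \<circ> d) = (\<Sum>q\<in>?P. real a ^ num_cycles S (inv_into UNIV d \<circ> (d \<circ> q)) * real b ^ num_cycles S (c \<circ> (d \<circ> q)))"
      unfolding cycle_pairing_def by (simp only: comp_assoc[symmetric] permutes_inv_o[OF d] id_comp)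
    also have "\<dots> = (\<Sum>w\<in>?P. real a ^ num_cycles S (inv_into UNIV d \<circ> w) * real b ^ num_cycles S (c \<circ> w))"
      by (rule sum_permutes_compose_left[OF d])
    finally show "cycle_pairing S a b (c \<circ> d) = \<dots>" .
  qed
  also have "\<dots> = (\<Sum>c\<in>full_cycles S. \<Sum>d\<in>full_cycles S. \<Sum>w\<in>?P.
        real a ^ num_cycles S (d \<circ> w) * real b ^ num_cycles S (c \<circ> w))"
    by (intro sum.cong refl sum.reindex_bij_witness[of _ "inv_into UNIV" "inv_into UNIV"])
       (simp_all add: inv_mem_full_cycles[OF S(1)])
  also have "\<dots> = (\<Sum>w\<in>?P. cycle_gf S w (real a) * cycle_gf S w (real b))"
    unfolding cycle_gf_def sum_product
    by (subst (2) sum.swap, subst (2) sum.swap, subst sum.swap) (intro sum.cong refl)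
  also have "\<dots> = (\<Sum>w\<in>?P. (fact (n - 1) * (\<Sum>k<n. coeff (hook_poly S w) k * hook_mult n k a)) *
      (fact (n - 1) * (\<Sum>l<n. coeff (hook_poly S w) l * hook_mult n l b)))"
    unfolding n_def hook_mult_def by (intro sum.cong refl) (simp only: mem_Collect_eq cycle_gf_eq[OF S])
  also have "\<dots> = fact (n - 1) * fact (n - 1) * (\<Sum>k<n. \<Sum>l<n. hook_mult n k a * hook_mult n l b *
      (\<Sum>w\<in>?P. coeff (hook_poly S w) k * coeff (hook_poly S w) l))"
  proof -
    have "(\<Sum>w\<in>?P. (fact (n - 1) * (\<Sum>k<n. coeff (hook_poly S w) k * hook_mult n k a)) *
      (fact (n - 1) * (\<Sum>l<n. coeff (hook_poly S w) l * hook_mult n l b))) =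
      (\<Sum>w\<in>?P. \<Sum>k<n. \<Sum>l<n. fact (n - 1) * fact (n - 1) * (hook_mult n k a * hook_mult n l b *
        (coeff (hook_poly S w) k * coeff (hook_poly S w) l)))"
    proof (rule sum.cong[OF refl])
      fix w
      have "(fact (n - 1) * (\<Sum>k<n. coeff (hook_poly S w) k * hook_mult n k a)) *
          (fact (n - 1) * (\<Sum>l<n. coeff (hook_poly S w) l * hook_mult n l b)) =
        fact (n - 1) * fact (n - 1) * ((\<Sum>k<n. coeff (hook_poly S w) k * hook_mult n k a) *
          (\<Sum>l<n. coeff (hook_poly S w) l * hook_mult n l b))" by (simp only: ac_simps)
      also have "\<dots> = (\<Sum>k<n. \<Sum>l<n. fact (n - 1) * fact (n - 1) *
          ((coeff (hook_poly S w) k * hook_mult n k a) * (coeff (hook_poly S w) l * hook_mult n l b)))"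
        unfolding sum_product unfolding sum_distrib_left ..
      also have "\<dots> = (\<Sum>k<n. \<Sum>l<n. fact (n - 1) * fact (n - 1) * (hook_mult n k a * hook_mult n l b *
        (coeff (hook_poly S w) k * coeff (hook_poly S w) l)))"
        by (simp only: ac_simps)
      finally show "(fact (n - 1) * (\<Sum>k<n. coeff (hook_poly S w) k * hook_mult n k a)) *
          (fact (n - 1) * (\<Sum>l<n. coeff (hook_poly S w) l * hook_mult n l b)) = \<dots>" .
    qed
    also have "\<dots> = (\<Sum>k<n. \<Sum>l<n. \<Sum>w\<in>?P. fact (n - 1) * fact (n - 1) * (hook_mult n k a * hook_mult n l b *
        (coeff (hook_poly S w) k * coeff (hook_poly S w) l)))"
      by (subst sum.swap, rule sum.cong[OF refl], rule sum.swap)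
    finally show ?thesis unfolding sum_distrib_left .
  qed
  also have "\<dots> = fact (n - 1) * fact (n - 1) * (\<Sum>k<n. \<Sum>l<n. if k = l then hook_mult n k a * hook_mult n k b * fact n else 0)"
    using hook_orthogonality[OF S] unfolding n_def
    by (intro arg_cong[where f = "(*) _"] sum.cong refl) auto
  also have "\<dots> = fact (n - 1) * fact (n - 1) * fact n * (\<Sum>k<n. hook_mult n k a * hook_mult n k b)"
    by (simp add: sum_distrib_left ac_simps)
  finally show ?thesis .
qed

text \<open>When \<open>z\<close> runs through the whole group, so does \<open>z \<circ> q\<close>.
  The sum thus factors into one sum for \<open>a\<close> and one for \<open>b\<close>; in the signed
  case the sign of \<open>z\<close> is first split into those of \<open>q\<close> and
  \<open>z \<circ> q\<close>.\<close>

lemma sum_cycle_pairing: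
  assumes S: "finite S" "S \<noteq> {}"
  defines "n \<equiv> card S"
  shows "(\<Sum>z | z permutes S. cycle_pairing S a b z) =
      fact n * fact n * (hook_mult n 0 a * hook_mult n 0 b)"
    "(\<Sum>z | z permutes S. of_int (sign z) * cycle_pairing S a b z) =
      fact n * fact n * (hook_mult n (n - 1) a * hook_mult n (n - 1) b)"
proof -
  let ?P = "{p. p permutes S}"
  have right: "(\<Sum>z\<in>?P. H (z \<circ> q)) = (\<Sum>z\<in>?P. H z)" if q: "q permutes S" for q and H :: "('a \<Rightarrow> 'a) \<Rightarrow> real"
    using permutes_compose[OF q] permutes_compose[OF permutes_inv[OF q]] permutes_inv_o[OF q]
    by (intro sum.reindex_bij_witness[of _ "\<lambda>p. p \<circ> inv_into UNIV q" "\<lambda>p. p \<circ> q"])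
       (auto simp: comp_assoc)
  have "(\<Sum>z\<in>?P. cycle_pairing S a b z) =
      (\<Sum>q\<in>?P. real a ^ num_cycles S q * (\<Sum>z\<in>?P. real b ^ num_cycles S (z \<circ> q)))"
    unfolding cycle_pairing_def sum_distrib_left by (rule sum.swap)
  also have "\<dots> = (\<Sum>q\<in>?P. real a ^ num_cycles S q * (\<Sum>z\<in>?P. real b ^ num_cycles S z))"
    by (rule sum.cong[OF refl], rule arg_cong[where f = "(*) _"])
       (use right[of _ "\<lambda>z. real b ^ num_cycles S z"] in blast)
  finally show "(\<Sum>z\<in>?P. cycle_pairing S a b z) = fact n * fact n * (hook_mult n 0 a * hook_mult n 0 b)"
    unfolding sum_distrib_right[symmetric] sum_pow_num_cycles_hook_mult[OF S] n_def[symmetric]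
    by (simp only: ac_simps)
  have sg: "of_int (sign z) = of_int (sign q) * (of_int (sign (z \<circ> q)) :: real)" if "z \<in> ?P" "q \<in> ?P" for z q
  proof -
    have "permutation z" "permutation q" using that permutes_imp_permutation[OF S(1)] by auto
    hence "sign q * sign (z \<circ> q) = sign z" by (simp add: sign_compose mult.commute[of "sign z"])
    thus ?thesis unfolding of_int_mult[symmetric] by (simp only:)
  qed
  have "(\<Sum>z\<in>?P. of_int (sign z) * cycle_pairing S a b z) =
      (\<Sum>q\<in>?P. \<Sum>z\<in>?P. of_int (sign z) * (real a ^ num_cycles S q * real b ^ num_cycles S (z \<circ> q)))"
    unfolding cycle_pairing_def sum_distrib_left by (rule sum.swap)
  also have "\<dots> = (\<Sum>q\<in>?P. (of_int (sign q) * real a ^ num_cycles S q) *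
      (\<Sum>z\<in>?P. of_int (sign (z \<circ> q)) * real b ^ num_cycles S (z \<circ> q)))"
    unfolding sum_distrib_left
  proof (rule sum.cong[OF refl], rule sum.cong[OF refl])
    fix q z assume "q \<in> ?P" "z \<in> ?P"
    thus "of_int (sign z) * (real a ^ num_cycles S q * real b ^ num_cycles S (z \<circ> q)) =
      of_int (sign q) * real a ^ num_cycles S q * (of_int (sign (z \<circ> q)) * real b ^ num_cycles S (z \<circ> q))"
      by (subst sg[of z q]) simp_all
  qed
  also have "\<dots> = (\<Sum>q\<in>?P. (of_int (sign q) * real a ^ num_cycles S q) *
      (\<Sum>z\<in>?P. of_int (sign z) * real b ^ num_cycles S z))"
  proof (rule sum.cong[OF refl], rule arg_cong[where f = "(*) _"])
    fix q assume "q \<in> ?P"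
    thus "(\<Sum>z\<in>?P. of_int (sign (z \<circ> q)) * real b ^ num_cycles S (z \<circ> q)) =
      (\<Sum>z\<in>?P. of_int (sign z) * real b ^ num_cycles S z)"
      using right[of q "\<lambda>z. of_int (sign z) * real b ^ num_cycles S z"] by simp
  qed
  finally show "(\<Sum>z\<in>?P. of_int (sign z) * cycle_pairing S a b z) =
      fact n * fact n * (hook_mult n (n - 1) a * hook_mult n (n - 1) b)"
    unfolding sum_distrib_right[symmetric] sum_pow_num_cycles_hook_mult[OF S] n_def[symmetric]
    by (simp only: ac_simps)
qed

text \<open>The weight 1 - sign of the odd permutations projects onto the trivial and the sign
  character, with a minus sign at the latter.\<close>

theorem sum_cycle_pairing_full_subfull:
  assumes S: "finite S" "card S \<ge> 2"
  defines "n \<equiv> card S"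
  shows "(\<Sum>c\<in>full_cycles S. \<Sum>i\<in>S. \<Sum>d\<in>full_cycles (S - {i}). cycle_pairing S a b (c \<circ> d)) =
    fact (n - 2) * fact n * fact n *
      (hook_mult n 0 a * hook_mult n 0 b - hook_mult n (n - 1) a * hook_mult n (n - 1) b)"
proof -
  have ne: "S \<noteq> {}" using S by auto
  have "(\<Sum>c\<in>full_cycles S. \<Sum>i\<in>S. \<Sum>d\<in>full_cycles (S - {i}). cycle_pairing S a b (c \<circ> d)) =
      (\<Sum>i\<in>S. \<Sum>d\<in>full_cycles (S - {i}). \<Sum>c\<in>full_cycles S. cycle_pairing S a b (c \<circ> d))"
    by (subst sum.swap, rule sum.cong[OF refl], rule sum.swap)
  also have "\<dots> = fact (n - 2) * ((\<Sum>z | z permutes S. cycle_pairing S a b z) -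
      (\<Sum>z | z permutes S. of_int (sign z) * cycle_pairing S a b z))"
    unfolding sum_full_cycle_mult_subfull_cycle[OF S] n_def sum_subtractf[symmetric]
    by (simp add: algebra_simps)
  finally show ?thesis unfolding sum_cycle_pairing[OF S(1) ne] n_def by (simp add: algebra_simps)
qed

section \<open>Regrouping products of four cycles\<close>

lemma full_cycles_conjugate:
  assumes c: "c permutes S" and d: "d \<in> full_cycles T" and T: "T \<subseteq> S" "finite S"
  shows "c \<circ> d \<circ> inv_into UNIV c \<in> full_cycles (c ` T)"
proof -
  have bij: "bij c" by (rule permutes_bij[OF c])
  have dT: "d permutes T" by (rule full_cycles_permutes[OF d])
  have fT: "finite T" using T finite_subset by blast
  have inv: "inv_into UNIV c (c x) = x" for x using permutes_inverses(2)[OF c] by simp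
  have p: "c \<circ> d \<circ> inv_into UNIV c permutes c ` T"
  proof (rule bij_imp_permutes)
    have "bij_betw (inv_into UNIV c) (c ` T) T"
      by (rule bij_betw_byWitness[where f' = c]) (auto simp: inv)
    moreover have "bij_betw c T (c ` T)" using bij by (simp add: bij_betw_def inj_on_def bij_def inj_def)
    ultimately show "bij_betw (c \<circ> d \<circ> inv_into UNIV c) (c ` T) (c ` T)"
      using permutes_imp_bij[OF dT] by (auto intro: bij_betw_trans)
    fix x assume x: "x \<notin> c ` T"
    have cx: "c (inv_into UNIV c x) = x" using permutes_inverses(1)[OF c] by simp
    hence "inv_into UNIV c x \<notin> T" using x by (metis imageI)
    thus "(c \<circ> d \<circ> inv_into UNIV c) x = x" using permutes_not_in[OF dT] cx by simp
  qed
  have o: "orbit (c \<circ> d \<circ> inv_into UNIV c) (c x) = c ` orbit d x" for x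
    by (rule orbit_inverse[symmetric, OF mem_orbit_self[OF fT dT]]) (simp add: inv)
  have "orbit (c \<circ> d \<circ> inv_into UNIV c) ` (c ` T) = (`) c ` orbit d ` T"
    unfolding image_image o ..
  moreover have "inj_on ((`) c) (orbit d ` T)"
    using bij by (intro inj_on_subset[OF inj_image_eq_iff[THEN iffD1, THEN inj_onI]]) (auto simp: bij_def)
  ultimately have "num_cycles (c ` T) (c \<circ> d \<circ> inv_into UNIV c) = num_cycles T d"
    unfolding num_cycles_def by (simp add: card_image)
  thus ?thesis using p d by (simp add: full_cycles_def)
qed

text \<open>The cycles that miss one point are closed under conjugation, so their sum is central in
  the group algebra. The missed point is conjugated together with the cycle, so the two index sets
  also match for n = 2, where the cycle does not determine it.\<close>

lemma sum_subfull_cycles_commute: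
  assumes S: "finite S" and c: "c permutes S"
  shows "(\<Sum>i\<in>S. \<Sum>d\<in>full_cycles (S - {i}). h (c \<circ> d)) = (\<Sum>i\<in>S. \<Sum>d\<in>full_cycles (S - {i}). h (d \<circ> c))"
proof -
  let ?c' = "inv_into UNIV c"
  have c': "?c' permutes S" by (rule permutes_inv[OF c])
  have ii: "inv_into UNIV ?c' = c" by (rule permutes_inv_inv[OF c])
  have f: "finite (full_cycles (S - {i}))" for i by (rule finite_full_cycles) (use S in simp)
  have im: "q ` (S - {i}) = S - {q i}" if "q permutes S" for q i
    using permutes_image[OF that] permutes_inj[OF that] by (simp add: image_set_diff)
  have A: "q \<circ> d \<circ> inv_into UNIV q \<in> full_cycles (S - {q i})" if "q permutes S" "d \<in> full_cycles (S - {i})" for q d i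
    using full_cycles_conjugate[OF that _ S] im[OF that(1)] by simp
  have o: "?c' \<circ> c = id" "c \<circ> ?c' = id" using permutes_inv_o[OF c] by auto
  have "(\<Sum>(i, d)\<in>Sigma S (\<lambda>i. full_cycles (S - {i})). h (c \<circ> d)) =
      (\<Sum>(i, d)\<in>Sigma S (\<lambda>i. full_cycles (S - {i})). h (d \<circ> c))"
  proof (rule sum.reindex_bij_witness[of _ "\<lambda>(i, d). (?c' i, ?c' \<circ> d \<circ> c)" "\<lambda>(i, d). (c i, c \<circ> d \<circ> ?c')"])
    fix x assume x: "x \<in> Sigma S (\<lambda>i. full_cycles (S - {i}))"
    obtain i d where id: "x = (i, d)" "i \<in> S" "d \<in> full_cycles (S - {i})" using x by auto
    have e: "?c' \<circ> (c \<circ> d \<circ> ?c') \<circ> c = (?c' \<circ> c) \<circ> d \<circ> (?c' \<circ> c)"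
      "c \<circ> (?c' \<circ> d \<circ> c) \<circ> ?c' = (c \<circ> ?c') \<circ> d \<circ> (c \<circ> ?c')"
      "c \<circ> d \<circ> ?c' \<circ> c = c \<circ> d \<circ> (?c' \<circ> c)"
      by (simp_all only: comp_assoc)
    show "(case case x of (i, d) \<Rightarrow> (c i, c \<circ> d \<circ> ?c') of (i, d) \<Rightarrow> (?c' i, ?c' \<circ> d \<circ> c)) = x"
      unfolding id(1) prod.case e o using permutes_inverses(2)[OF c] by simp
    show "(case case x of (i, d) \<Rightarrow> (?c' i, ?c' \<circ> d \<circ> c) of (i, d) \<Rightarrow> (c i, c \<circ> d \<circ> ?c')) = x"
      unfolding id(1) prod.case e o using permutes_inverses(1)[OF c] by simp
    show "(case x of (i, d) \<Rightarrow> (c i, c \<circ> d \<circ> ?c')) \<in> Sigma S (\<lambda>i. full_cycles (S - {i}))"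
      unfolding id(1) prod.case using A[OF c id(3)] permutes_in_image[OF c] id(2) by blast
    show "(case x of (i, d) \<Rightarrow> (?c' i, ?c' \<circ> d \<circ> c)) \<in> Sigma S (\<lambda>i. full_cycles (S - {i}))"
      unfolding id(1) prod.case using A[OF c' id(3)] permutes_in_image[OF c'] id(2) unfolding ii by blast
    show "(case case x of (i, d) \<Rightarrow> (c i, c \<circ> d \<circ> ?c') of (i, d) \<Rightarrow> h (d \<circ> c)) = (case x of (i, d) \<Rightarrow> h (c \<circ> d))"
      unfolding id(1) prod.case e o by simp
  qed
  thus ?thesis using S f by (simp add: sum.Sigma)
qed

text \<open>Centrality permits regrouping c c' d d' as (c d) (c' d'). Each bracket has weight
  proportional to 1 - sign, and the convolution of this function with itself is n! (1 + sign), the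
  weight of the even permutations.\<close>

theorem sum_cycle_pairing_full_full_subfull_subfull:
  assumes S: "finite S" "card S \<ge> 2"
  defines "n \<equiv> card S"
  shows "(\<Sum>c\<in>full_cycles S. \<Sum>c'\<in>full_cycles S. \<Sum>i\<in>S. \<Sum>d\<in>full_cycles (S - {i}).
      \<Sum>i'\<in>S. \<Sum>d'\<in>full_cycles (S - {i'}). cycle_pairing S a b (c \<circ> (c' \<circ> (d \<circ> d')))) =
    fact (n - 2) * fact (n - 2) * fact n * fact n * fact n *
      (hook_mult n 0 a * hook_mult n 0 b + hook_mult n (n - 1) a * hook_mult n (n - 1) b)"
proof -
  let ?P = "{p. p permutes S}"
  define g where "g = cycle_pairing S a b"
  define e where "e = (\<lambda>z :: 'a \<Rightarrow> 'a. 1 - real_of_int (sign z))"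
  have ne: "S \<noteq> {}" using S by auto
  have F: "(\<Sum>c\<in>full_cycles S. \<Sum>i\<in>S. \<Sum>d\<in>full_cycles (S - {i}). H (c \<circ> d)) = fact (n - 2) * (\<Sum>z\<in>?P. e z * H z)"
    for H :: "('a \<Rightarrow> 'a) \<Rightarrow> real"
    unfolding n_def e_def sum_full_cycle_mult_subfull_cycle[OF S, of H, symmetric]
    by (subst sum.swap, rule sum.cong[OF refl], rule sum.swap)
  have "(\<Sum>c\<in>full_cycles S. \<Sum>c'\<in>full_cycles S. \<Sum>i\<in>S. \<Sum>d\<in>full_cycles (S - {i}).
      \<Sum>i'\<in>S. \<Sum>d'\<in>full_cycles (S - {i'}). g (c \<circ> (c' \<circ> (d \<circ> d')))) =
    (\<Sum>c\<in>full_cycles S. \<Sum>c'\<in>full_cycles S. \<Sum>i\<in>S. \<Sum>d\<in>full_cycles (S - {i}).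
      \<Sum>i'\<in>S. \<Sum>d'\<in>full_cycles (S - {i'}). g (c \<circ> d \<circ> (c' \<circ> d')))"
  proof (rule sum.cong[OF refl], rule sum.cong[OF refl])
    fix c c' assume c': "c' \<in> full_cycles S"
    show "(\<Sum>i\<in>S. \<Sum>d\<in>full_cycles (S - {i}). \<Sum>i'\<in>S. \<Sum>d'\<in>full_cycles (S - {i'}). g (c \<circ> (c' \<circ> (d \<circ> d')))) =
      (\<Sum>i\<in>S. \<Sum>d\<in>full_cycles (S - {i}). \<Sum>i'\<in>S. \<Sum>d'\<in>full_cycles (S - {i'}). g (c \<circ> d \<circ> (c' \<circ> d')))"
      using sum_subfull_cycles_commute[OF S(1) full_cycles_permutes[OF c'],
        of "\<lambda>x. \<Sum>i'\<in>S. \<Sum>d'\<in>full_cycles (S - {i'}). g (c \<circ> (x \<circ> d'))"]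
      by (simp only: comp_assoc)
  qed
  also have "\<dots> = (\<Sum>c\<in>full_cycles S. \<Sum>i\<in>S. \<Sum>d\<in>full_cycles (S - {i}). \<Sum>c'\<in>full_cycles S.
      \<Sum>i'\<in>S. \<Sum>d'\<in>full_cycles (S - {i'}). g (c \<circ> d \<circ> (c' \<circ> d')))"
    by (rule sum.cong[OF refl], subst sum.swap, rule sum.cong[OF refl], rule sum.swap)
  also have "\<dots> = (\<Sum>c\<in>full_cycles S. \<Sum>i\<in>S. \<Sum>d\<in>full_cycles (S - {i}). fact (n - 2) * (\<Sum>z\<in>?P. e z * g (c \<circ> d \<circ> z)))"
    by (intro sum.cong refl F)
  also have "\<dots> = fact (n - 2) * (\<Sum>y\<in>?P. e y * (fact (n - 2) * (\<Sum>z\<in>?P. e z * g (y \<circ> z))))"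
    by (rule F)
  also have "\<dots> = fact (n - 2) * fact (n - 2) * (\<Sum>y\<in>?P. \<Sum>z\<in>?P. e y * e z * g (y \<circ> z))"
    by (simp only: sum_distrib_left ac_simps)
  also have "(\<Sum>y\<in>?P. \<Sum>z\<in>?P. e y * e z * g (y \<circ> z)) = (\<Sum>y\<in>?P. \<Sum>w\<in>?P. e y * e (inv_into UNIV y \<circ> w) * g w)"
  proof (rule sum.cong[OF refl])
    fix y assume "y \<in> ?P"
    hence y: "y permutes S" by simp
    have "(\<Sum>z\<in>?P. e y * e z * g (y \<circ> z)) = (\<Sum>z\<in>?P. e y * e (inv_into UNIV y \<circ> (y \<circ> z)) * g (y \<circ> z))"
      by (simp only: comp_assoc[symmetric] permutes_inv_o[OF y] id_comp)
    also have "\<dots> = (\<Sum>w\<in>?P. e y * e (inv_into UNIV y \<circ> w) * g w)"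
      by (rule sum_permutes_compose_left[OF y])
    finally show "(\<Sum>z\<in>?P. e y * e z * g (y \<circ> z)) = \<dots>" .
  qed
  also have "\<dots> = (\<Sum>w\<in>?P. (\<Sum>y\<in>?P. e y * e (inv_into UNIV y \<circ> w)) * g w)"
    unfolding sum_distrib_right by (rule sum.swap)
  also have "\<dots> = (\<Sum>w\<in>?P. fact n * ((1 + of_int (sign w)) * g w))"
  proof (rule sum.cong[OF refl])
    fix w assume w: "w \<in> ?P"
    \<comment> \<open>The sign is multiplicative with square 1. The terms linear in the sign of
      \<open>y\<close> disappear in the sum by \<open>sum_sign_permutes\<close>.\<close>
    have "(\<Sum>y\<in>?P. e y * e (inv_into UNIV y \<circ> w)) =
      (\<Sum>y\<in>?P. (1 + of_int (sign w)) - (1 + of_int (sign w)) * of_int (sign y))"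
    proof (rule sum.cong[OF refl])
      fix y assume y: "y \<in> ?P"
      have p: "permutation y" "permutation w" using w y permutes_imp_permutation[OF S(1)] by auto
      hence "sign (inv_into UNIV y \<circ> w) = sign y * sign w"
        by (simp add: sign_compose permutation_inverse sign_inverse)
      moreover have "real_of_int (sign y) * real_of_int (sign y) = 1" by (metis of_int_1 of_int_mult sign_idempotent)
      ultimately show "e y * e (inv_into UNIV y \<circ> w) = (1 + of_int (sign w)) - (1 + of_int (sign w)) * of_int (sign y)"
        unfolding e_def by (simp add: algebra_simps)
    qed
    also have "\<dots> = real (card ?P) * (1 + of_int (sign w)) - (1 + of_int (sign w)) * (\<Sum>y\<in>?P. of_int (sign y))"
      unfolding sum_subtractf sum_distrib_left by simp
    also have "\<dots> = fact n * (1 + of_int (sign w))"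
      unfolding sum_sign_permutes[OF S] card_permutations[OF refl S(1), folded n_def] by simp
    finally show "(\<Sum>y\<in>?P. e y * e (inv_into UNIV y \<circ> w)) * g w = fact n * ((1 + of_int (sign w)) * g w)"
      by simp
  qed
  also have "\<dots> = fact n * ((\<Sum>w\<in>?P. g w) + (\<Sum>w\<in>?P. of_int (sign w) * g w))"
    unfolding sum_distrib_left[symmetric] sum.distrib[symmetric] by (simp add: algebra_simps)
  also have "\<dots> = fact n * (fact n * fact n * (hook_mult n 0 a * hook_mult n 0 b)
      + fact n * fact n * (hook_mult n (n - 1) a * hook_mult n (n - 1) b))"
    unfolding g_def n_def sum_cycle_pairing[OF S(1) ne] ..
  also have "fact (n - 2) * fact (n - 2) * \<dots> = fact (n - 2) * fact (n - 2) * fact n * fact n * fact n *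
      (hook_mult n 0 a * hook_mult n 0 b + hook_mult n (n - 1) a * hook_mult n (n - 1) b)"
    by (simp only: algebra_simps)
  finally show ?thesis unfolding g_def .
qed

section \<open>Colourings and monomial matrices\<close>

lemma sum_PiE_Un:
  fixes h :: "('a \<Rightarrow> 'c) \<Rightarrow> 'b::comm_monoid_add"
  assumes "A \<inter> B = {}"
  shows "(\<Sum>c\<in>PiE (A \<union> B) (\<lambda>_. Z). h c) =
    (\<Sum>u\<in>PiE A (\<lambda>_. Z). \<Sum>v\<in>PiE B (\<lambda>_. Z). h (\<lambda>j. if j \<in> A then u j else v j))"
proof -
  have "(\<Sum>c\<in>PiE (A \<union> B) (\<lambda>_. Z). h c) =
    (\<Sum>(u, v)\<in>PiE A (\<lambda>_. Z) \<times> PiE B (\<lambda>_. Z). h (\<lambda>j. if j \<in> A then u j else v j))"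
    by (rule sum.reindex_bij_witness[of _ "\<lambda>(u, v) j. if j \<in> A then u j else v j" "\<lambda>c. (restrict c A, restrict c B)"])
       (use assms in \<open>auto simp: fun_eq_iff PiE_def Pi_def extensional_def restrict_def
         intro!: arg_cong[where f = h]\<close>)
  thus ?thesis by (simp add: sum.cartesian_product)
qed

text \<open>All colours but one are free, and the last is then determined as a quotient in
  \<open>Z\<close>. The factor \<open>card Z\<close> on the left replaces an exponent
  \<open>card C - 1\<close> on the right.\<close>

lemma card_PiE_prod_eq:
  fixes Z :: "complex set"
  assumes Z: "finite Z" "\<And>x y. x \<in> Z \<Longrightarrow> y \<in> Z \<Longrightarrow> x / y \<in> Z" "0 \<notin> Z"
    and C: "finite C" "C \<noteq> {}" "e \<in> Z"
  shows "real (card Z) * real (card {c \<in> PiE C (\<lambda>_. Z). prod c C = e}) = real (card Z) ^ card C"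
proof -
  have one: "1 \<in> Z" using Z(2)[OF C(3) C(3)] C(3) Z(3) by (metis divide_self)
  have m: "x * y \<in> Z" if "x \<in> Z" "y \<in> Z" for x y
    using Z(2)[OF that(1) Z(2)[OF one that(2)]] by simp
  obtain x where x: "x \<in> C" using C(2) by blast
  define D where "D = C - {x}"
  have D: "finite D" "{x} \<inter> D = {}" "C = {x} \<union> D" "card C = Suc (card D)"
    using C(1) x by (auto simp: D_def simp del: card_Diff_insert card_Diff_singleton intro!: card_Suc_Diff1[symmetric])
  have fin: "finite (PiE C (\<lambda>_. Z))" by (rule finite_PiE[OF C(1)]) (rule Z(1))
  have pD: "prod v D \<in> Z" if "v \<in> PiE D (\<lambda>_. Z)" for v
  proof -
    have "\<forall>j\<in>D. v j \<in> Z" using that by auto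
    with D(1) show ?thesis by (induction D rule: finite_induct) (auto simp: one m)
  qed
  have "real (card {c \<in> PiE C (\<lambda>_. Z). prod c C = e}) = (\<Sum>c\<in>PiE C (\<lambda>_. Z). if prod c C = e then 1 else 0)"
    using sum.inter_filter[OF fin, of "\<lambda>_. 1 :: real" "\<lambda>c. prod c C = e"] by simp
  also have "\<dots> = (\<Sum>u\<in>PiE {x} (\<lambda>_. Z). \<Sum>v\<in>PiE D (\<lambda>_. Z). if u x * prod v D = e then 1 else 0)"
  proof -
    have "prod (\<lambda>j. if j \<in> {x} then u j else v j) ({x} \<union> D) = u x * prod v D" for u v :: "'a \<Rightarrow> complex"
      using D(1,2) by (subst prod.union_disjoint) (auto intro!: arg_cong2[of _ _ _ _ "(*)"] prod.cong)
    thus ?thesis unfolding D(3) sum_PiE_Un[OF D(2)] by simp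
  qed
  also have "\<dots> = (\<Sum>v\<in>PiE D (\<lambda>_. Z). \<Sum>u\<in>PiE {x} (\<lambda>_. Z). if u x * prod v D = e then 1 else 0)"
    by (rule sum.swap)
  also have "\<dots> = (\<Sum>v\<in>PiE D (\<lambda>_. Z). 1)"
  proof (rule sum.cong[OF refl])
    fix v assume v: "v \<in> PiE D (\<lambda>_. Z)"
    define q where "q = prod v D"
    have q: "q \<in> Z" "q \<noteq> 0" using pD[OF v] Z(3) by (auto simp: q_def)
    have "(\<Sum>u\<in>PiE {x} (\<lambda>_. Z). if u x * q = e then 1 else 0 :: real) = (\<Sum>y\<in>Z. if y * q = e then 1 else 0)"
      by (rule sum.reindex_bij_witness[of _ "\<lambda>y. (\<lambda>j\<in>{x}. y)" "\<lambda>u. u x"])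
         (auto simp: fun_eq_iff PiE_def extensional_def)
    also have "\<dots> = (\<Sum>y\<in>Z. if y = e / q then 1 else 0)"
      using q by (intro sum.cong refl) (auto simp: field_simps)
    also have "\<dots> = 1" using Z(1) Z(2)[OF C(3) q(1)] by simp
    finally show "(\<Sum>u\<in>PiE {x} (\<lambda>_. Z). if u x * prod v D = e then 1 else 0 :: real) = 1" unfolding q_def .
  qed
  also have "\<dots> = real (card Z) ^ card D" using D(1) by (simp add: card_PiE)
  finally show ?thesis unfolding D(4) by simp
qed

text \<open>By induction on the blocks: functions of the form $\alpha + \beta [e = 1]$ on \<open>Z\<close> are closed
  under convolution.\<close>

lemma sum_weighted_colourings:
  fixes Z :: "complex set" and a :: real and \<C> :: "'a set set"
  assumes Z: "finite Z" "\<And>x y. x \<in> Z \<Longrightarrow> y \<in> Z \<Longrightarrow> x / y \<in> Z" "0 \<notin> Z" "1 \<in> Z"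
    and \<C>: "finite \<C>" "\<And>C. C \<in> \<C> \<Longrightarrow> finite C" "\<And>C. C \<in> \<C> \<Longrightarrow> C \<noteq> {}"
      "\<And>C D. C \<in> \<C> \<Longrightarrow> D \<in> \<C> \<Longrightarrow> C \<noteq> D \<Longrightarrow> C \<inter> D = {}"
    and e: "e \<in> Z"
  defines "r \<equiv> real (card Z)"
  shows "r * (\<Sum>c | c \<in> PiE (\<Union>\<C>) (\<lambda>_. Z) \<and> prod c (\<Union>\<C>) = e.
      (1 + r * a) ^ card {C \<in> \<C>. prod c C = 1}) =
    r ^ card (\<Union>\<C>) * ((a + 1) ^ card \<C> - a ^ card \<C> + (if e = 1 then r * a ^ card \<C> else 0))"
  using \<C> e
proof (induction \<C> arbitrary: e rule: finite_induct)
  case empty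
  have "{c. c \<in> PiE {} (\<lambda>_. Z) \<and> prod c {} = e} = (if e = 1 then {\<lambda>_. undefined} else {})"
    by (auto simp: PiE_def extensional_def fun_eq_iff)
  thus ?case by simp
next
  case (insert C \<C>)
  define U where "U = \<Union>\<C>"
  define s where "s = 1 + r * a"
  define k where "k = card \<C>"
  have C: "finite C" "C \<noteq> {}" using insert.prems by auto
  have U: "finite U" using insert.hyps insert.prems(1) by (auto simp: U_def)
  have CU: "C \<inter> U = {}" using insert.prems(3) insert.hyps(2) by (fastforce simp: U_def)
  have P: "finite (PiE X (\<lambda>_. Z))" if "finite X" for X :: "'a set" by (rule finite_PiE[OF that]) (rule Z(1))
  have m: "x * y \<in> Z" if "x \<in> Z" "y \<in> Z" for x y
    using Z(2)[OF that(1) Z(2)[OF Z(4) that(2)]] by simp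
  have pC: "prod v C \<in> Z" if "v \<in> PiE C (\<lambda>_. Z)" for v
  proof -
    have "\<forall>j\<in>C. v j \<in> Z" using that by auto
    with C(1) show ?thesis by (induction C rule: finite_induct) (auto simp: Z(4) m)
  qed
  define w where "w = (\<lambda>v :: 'a \<Rightarrow> complex. s ^ card {D \<in> \<C>. prod v D = 1})"
  define V where "V = (\<lambda>e. \<Sum>v | v \<in> PiE U (\<lambda>_. Z) \<and> prod v U = e. w v)"
  have IH: "r * V e = r ^ card U * ((a + 1) ^ k - a ^ k + (if e = 1 then r * a ^ k else 0))" if "e \<in> Z" for e
    unfolding V_def w_def U_def k_def s_def using insert.IH that insert.prems by auto
  have V: "V e = (\<Sum>v\<in>PiE U (\<lambda>_. Z). if prod v U = e then w v else 0)" for e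
    using sum.inter_filter[OF P[OF U], of w "\<lambda>v. prod v U = e"] by (simp add: V_def)
  define cc where "cc = (\<lambda>z. \<Sum>u\<in>PiE C (\<lambda>_. Z). if prod u C = z then 1 else 0 :: real)"
  \<comment> \<open>The product of the colours of one block is equidistributed on
    \<open>Z\<close>.\<close>
  have cc: "r * cc z = r ^ card C" if "z \<in> Z" for z
    using card_PiE_prod_eq[OF Z(1-3) C that] sum.inter_filter[OF P[OF C(1)], of "\<lambda>_. 1 :: real" "\<lambda>c. prod c C = z"]
    by (simp add: cc_def r_def)
  have "(\<Sum>c | c \<in> PiE (\<Union>(insert C \<C>)) (\<lambda>_. Z) \<and> prod c (\<Union>(insert C \<C>)) = e.
      s ^ card {D \<in> insert C \<C>. prod c D = 1}) =
    (\<Sum>c\<in>PiE (C \<union> U) (\<lambda>_. Z). if prod c (C \<union> U) = e then s ^ card {D \<in> insert C \<C>. prod c D = 1} else 0)"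
    using sum.inter_filter[OF P, of "C \<union> U" "\<lambda>c. s ^ card {D \<in> insert C \<C>. prod c D = 1}" "\<lambda>c. prod c (C \<union> U) = e"] C U
    by (simp add: U_def)
  also have "\<dots> = (\<Sum>u\<in>PiE C (\<lambda>_. Z). \<Sum>v\<in>PiE U (\<lambda>_. Z).
      if prod u C * prod v U = e then (if prod u C = 1 then s else 1) * w v else 0)"
    unfolding sum_PiE_Un[OF CU]
  proof (rule sum.cong[OF refl], rule sum.cong[OF refl])
    fix u v :: "'a \<Rightarrow> complex"
    define c where "c = (\<lambda>j. if j \<in> C then u j else v j)"
    have c1: "prod c C = prod u C" by (rule prod.cong) (auto simp: c_def)
    have c2: "prod c D = prod v D" if "D \<subseteq> U" for D
      by (rule prod.cong) (use that CU in \<open>auto simp: c_def\<close>)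
    have "prod c (C \<union> U) = prod u C * prod v U"
      using prod.union_disjoint[OF C(1) U CU, of c] c1 c2[of U] by simp
    moreover have "s ^ card {D \<in> insert C \<C>. prod c D = 1} = (if prod u C = 1 then s else 1) * w v"
    proof -
      have "{D \<in> \<C>. prod c D = 1} = {D \<in> \<C>. prod v D = 1}"
        using c2 by (auto simp: U_def) (metis Union_upper)+
      moreover have "{D \<in> insert C \<C>. prod c D = 1} =
          (if prod u C = 1 then insert C {D \<in> \<C>. prod c D = 1} else {D \<in> \<C>. prod c D = 1})"
        using c1 by auto
      ultimately show ?thesis using insert.hyps by (simp add: w_def)
    qed
    ultimately show "(if prod (\<lambda>j. if j \<in> C then u j else v j) (C \<union> U) = e
        then s ^ card {D \<in> insert C \<C>. prod (\<lambda>j. if j \<in> C then u j else v j) D = 1} else 0) =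
      (if prod u C * prod v U = e then (if prod u C = 1 then s else 1) * w v else 0)"
      unfolding c_def[symmetric] by simp
  qed
  also have "\<dots> = (\<Sum>u\<in>PiE C (\<lambda>_. Z). (if prod u C = 1 then s else 1) * V (e / prod u C))"
  proof (rule sum.cong[OF refl])
    fix u assume "u \<in> PiE C (\<lambda>_. Z)"
    hence "prod u C \<noteq> 0" using pC Z(3) by metis
    hence "prod u C * y = e \<longleftrightarrow> y = e / prod u C" for y by (auto simp: field_simps)
    thus "(\<Sum>v\<in>PiE U (\<lambda>_. Z). if prod u C * prod v U = e then (if prod u C = 1 then s else 1) * w v else 0) =
        (if prod u C = 1 then s else 1) * V (e / prod u C)"
      unfolding V sum_distrib_left by (intro sum.cong refl) simp
  qed
  \<comment> \<open>Sorting the colourings of the new block by their product \<open>z\<close>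
    exhibits the sum as a convolution on \<open>Z\<close> of the weight of that block with the sum
    \<open>V\<close> over the other blocks.\<close>
  also have "\<dots> = (\<Sum>u\<in>PiE C (\<lambda>_. Z). \<Sum>z\<in>Z. (if prod u C = z then 1 else 0) * ((if z = 1 then s else 1) * V (e / z)))"
  proof (rule sum.cong[OF refl])
    fix u assume "u \<in> PiE C (\<lambda>_. Z)"
    hence "(\<Sum>z\<in>Z. if prod u C = z then (if z = 1 then s else 1) * V (e / z) else 0) =
      (if prod u C = 1 then s else 1) * V (e / prod u C)"
      using Z(1) pC by (subst sum.delta') auto
    thus "(if prod u C = 1 then s else 1) * V (e / prod u C) =
      (\<Sum>z\<in>Z. (if prod u C = z then 1 else 0) * ((if z = 1 then s else 1) * V (e / z)))"
      by (simp add: if_distrib[of "\<lambda>x. x * _"] cong: if_cong)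
  qed
  also have "\<dots> = (\<Sum>z\<in>Z. cc z * ((if z = 1 then s else 1) * V (e / z)))"
    unfolding cc_def sum_distrib_right by (rule sum.swap)
  finally have eq: "(\<Sum>c | c \<in> PiE (\<Union>(insert C \<C>)) (\<lambda>_. Z) \<and> prod c (\<Union>(insert C \<C>)) = e.
      s ^ card {D \<in> insert C \<C>. prod c D = 1}) = (\<Sum>z\<in>Z. cc z * ((if z = 1 then s else 1) * V (e / z)))" .
  have r0: "r > 0" using Z(1,4) by (auto simp: r_def card_gt_0_iff)
  define \<alpha> where "\<alpha> = a ^ k"
  define u where "u = (a + 1) ^ k - \<alpha>"
  have "r * (r * (\<Sum>z\<in>Z. cc z * ((if z = 1 then s else 1) * V (e / z)))) =
      (\<Sum>z\<in>Z. (r * cc z) * ((if z = 1 then s else 1) * (r * V (e / z))))"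
    unfolding sum_distrib_left by (intro sum.cong refl) (simp only: ac_simps)
  also have "\<dots> = (\<Sum>z\<in>Z. r ^ card C * ((if z = 1 then s else 1) *
      (r ^ card U * (u + (if z = e then r * \<alpha> else 0)))))"
  proof (rule sum.cong[OF refl])
    fix z assume z: "z \<in> Z"
    hence "z \<noteq> 0" using Z(3) by metis
    hence "e / z = 1 \<longleftrightarrow> z = e" by auto
    thus "(r * cc z) * ((if z = 1 then s else 1) * (r * V (e / z))) = r ^ card C * ((if z = 1 then s else 1) *
      (r ^ card U * (u + (if z = e then r * \<alpha> else 0))))"
      unfolding cc[OF z] IH[OF Z(2)[OF insert.prems(4) z]] u_def \<alpha>_def by simp
  qed
  also have "\<dots> = r ^ card C * r ^ card U * (\<Sum>z\<in>Z. u + (if z = e then r * \<alpha> else 0) +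
      (if z = 1 then r * a * (u + (if e = 1 then r * \<alpha> else 0)) else 0))"
    unfolding sum_distrib_left by (intro sum.cong refl) (auto simp: s_def algebra_simps)
  also have "(\<Sum>z\<in>Z. u + (if z = e then r * \<alpha> else 0) +
      (if z = 1 then r * a * (u + (if e = 1 then r * \<alpha> else 0)) else 0)) =
      r * u + r * \<alpha> + r * a * (u + (if e = 1 then r * \<alpha> else 0))"
    using Z(1,4) insert.prems(4) by (simp add: sum.distrib r_def)
  also have "r ^ card C * r ^ card U * \<dots> = r * (r ^ (card C + card U) *
      ((a + 1) ^ Suc k - a ^ Suc k + (if e = 1 then r * a ^ Suc k else 0)))"
    unfolding u_def \<alpha>_def by (simp add: power_add algebra_simps)
  finally have "r * (r * (\<Sum>z\<in>Z. cc z * ((if z = 1 then s else 1) * V (e / z)))) = \<dots>" .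
  hence "r * (\<Sum>z\<in>Z. cc z * ((if z = 1 then s else 1) * V (e / z))) = r ^ (card C + card U) *
      ((a + 1) ^ Suc k - a ^ Suc k + (if e = 1 then r * a ^ Suc k else 0))" using r0 by simp
  moreover have "card (\<Union>(insert C \<C>)) = card C + card U" "card (insert C \<C>) = Suc k"
    using C U CU insert.hyps by (simp_all add: card_Un_disjoint U_def k_def)
  ultimately show ?case unfolding eq[unfolded s_def] s_def by simp
qed

section \<open>Monomial matrices as pairs of a permutation and a colouring of the columns\<close>

definition monomial_mat :: "nat \<Rightarrow> (nat \<Rightarrow> nat) \<Rightarrow> (nat \<Rightarrow> complex) \<Rightarrow> complex mat" where
  "monomial_mat n p c = mat n n (\<lambda>(i, j). if i = p j then c j else 0)"

lemma monomial_mat_carrier [simp]: "monomial_mat n p c \<in> carrier_mat n n"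
  by (simp add: monomial_mat_def)

lemma dim_monomial_mat [simp]:
  "dim_row (monomial_mat n p c) = n" "dim_col (monomial_mat n p c) = n"
  by (simp_all add: monomial_mat_def)

lemma index_monomial_mat [simp]:
  "i < n \<Longrightarrow> j < n \<Longrightarrow> monomial_mat n p c $$ (i, j) = (if i = p j then c j else 0)"
  by (simp add: monomial_mat_def)

lemma permutes_lt: "p permutes {0..<n} \<Longrightarrow> j < n \<Longrightarrow> p j < (n :: nat)"
  using permutes_in_image[of p "{0..<n}" j] by simp

text \<open>The entry of the right factor in column j lies in row \<open>q j\<close> and therefore
  meets the colour \<open>c (q j)\<close>. The restriction to the index set makes the new colouring
  extensional, as \<open>monomial_mat_inject\<close> needs in order to recover it from the
  matrix.\<close>

lemma monomial_mat_mult: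
  assumes "q permutes {0..<n}"
  shows "monomial_mat n p c * monomial_mat n q d = monomial_mat n (p \<circ> q) (\<lambda>j\<in>{0..<n}. c (q j) * d j)"
proof (rule eq_matI)
  fix i j assume "i < dim_row (monomial_mat n (p \<circ> q) (\<lambda>j\<in>{0..<n}. c (q j) * d j))"
    "j < dim_col (monomial_mat n (p \<circ> q) (\<lambda>j\<in>{0..<n}. c (q j) * d j))"
  hence ij: "i < n" "j < n" by (simp_all add: monomial_mat_def)
  have qj: "q j < n" by (rule permutes_lt[OF assms ij(2)])
  have "(monomial_mat n p c * monomial_mat n q d) $$ (i, j) =
      (\<Sum>k\<in>{0..<n}. (if i = p k then c k else 0) * (if k = q j then d j else 0))"
    using ij by (simp add: monomial_mat_def scalar_prod_def)
  also have "\<dots> = (\<Sum>k\<in>{0..<n}. if k = q j then (if i = p k then c k else 0) * d j else 0)"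
    by (rule sum.cong) auto
  also have "\<dots> = (if i = p (q j) then c (q j) * d j else 0)" using qj by (simp add: sum.delta)
  finally show "(monomial_mat n p c * monomial_mat n q d) $$ (i, j) =
      monomial_mat n (p \<circ> q) (\<lambda>j\<in>{0..<n}. c (q j) * d j) $$ (i, j)"
    using ij by simp
qed (simp_all add: monomial_mat_def)

lemma perm_part_monomial_mat:
  assumes p: "p permutes {0..<n}" and c: "\<And>j. j < n \<Longrightarrow> c j \<noteq> 0"
  shows "perm_part n (monomial_mat n p c) = p"
  unfolding perm_part_def
proof (rule the_equality)
  have entry: "(D * perm_matrix n q) $$ (i, j) = D $$ (i, i) * (if i = q j then 1 else 0)"
    if "D \<in> carrier_mat n n" "diagonal_mat D" "i < n" "j < n" for D :: "complex mat" and q i j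
  proof -
    have "(D * perm_matrix n q) $$ (i, j) = (\<Sum>k\<in>{0..<n}. D $$ (i, k) * (if k = q j then 1 else 0))"
      using that by (simp add: perm_matrix_def scalar_prod_def)
    also have "\<dots> = (\<Sum>k\<in>{0..<n}. if k = i then D $$ (i, i) * (if i = q j then 1 else 0) else 0)"
      using that unfolding diagonal_mat_def by (intro sum.cong) auto
    also have "\<dots> = D $$ (i, i) * (if i = q j then 1 else 0)" using that by (simp add: sum.delta)
    finally show ?thesis .
  qed
  \<comment> \<open>Multiplication by a diagonal matrix from the left scales rows, so the colour of
    column j has to be placed in row \<open>p j\<close>.\<close>
  define D where "D = mat n n (\<lambda>(i, j). if i = j then c (inv_into UNIV p i) else 0)"
  have D: "D \<in> carrier_mat n n" "diagonal_mat D" by (auto simp: D_def diagonal_mat_def)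
  have "monomial_mat n p c = D * perm_matrix n p"
  proof (rule eq_matI)
    fix i j assume "i < dim_row (D * perm_matrix n p)" "j < dim_col (D * perm_matrix n p)"
    hence ij: "i < n" "j < n" by (simp_all add: D_def perm_matrix_def)
    show "monomial_mat n p c $$ (i, j) = (D * perm_matrix n p) $$ (i, j)"
      unfolding entry[OF D ij] using ij permutes_inverses(2)[OF p] by (auto simp: D_def)
  qed (simp_all add: monomial_mat_def D_def perm_matrix_def)
  thus "p permutes {0..<n} \<and> (\<exists>D\<in>carrier_mat n n. diagonal_mat D \<and> monomial_mat n p c = D * perm_matrix n p)"
    using p D by blast
  fix q assume "q permutes {0..<n} \<and> (\<exists>D\<in>carrier_mat n n. diagonal_mat D \<and> monomial_mat n p c = D * perm_matrix n q)"
  then obtain E where q: "q permutes {0..<n}"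
    and E: "E \<in> carrier_mat n n" "diagonal_mat E" "monomial_mat n p c = E * perm_matrix n q" by blast
  have "q j = p j" if "j < n" for j
  proof (rule ccontr)
    assume "q j \<noteq> p j"
    hence "(E * perm_matrix n q) $$ (p j, j) = 0"
      using entry[OF E(1,2) permutes_lt[OF p that] that] by simp
    moreover have "monomial_mat n p c $$ (p j, j) = c j" using permutes_lt[OF p that] that by simp
    ultimately show False using E(3) c[OF that] by simp
  qed
  moreover have "q j = p j" if "\<not> j < n" for j
    using permutes_not_in[OF q, of j] permutes_not_in[OF p, of j] that by simp
  ultimately show "q = p" by blast
qed

lemma monomial_mat_inject:
  assumes p: "p permutes {0..<n}" "\<And>j. j < n \<Longrightarrow> c j \<noteq> 0" "c \<in> extensional {0..<n}"
    and q: "q permutes {0..<n}" "\<And>j. j < n \<Longrightarrow> d j \<noteq> 0" "d \<in> extensional {0..<n}"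
    and eq: "monomial_mat n p c = monomial_mat n q d"
  shows "p = q \<and> c = d"
proof
  have "p = perm_part n (monomial_mat n p c)" by (rule perm_part_monomial_mat[OF p(1,2), symmetric])
  also have "\<dots> = q" unfolding eq by (rule perm_part_monomial_mat[OF q(1,2)])
  finally show pq: "p = q" .
  show "c = d"
  proof (rule extensionalityI[OF p(3) q(3)])
    fix j assume "j \<in> {0..<n}"
    hence j: "j < n" by simp
    have "monomial_mat n p c $$ (p j, j) = monomial_mat n q d $$ (p j, j)" by (simp only: eq)
    thus "c j = d j" using j permutes_lt[OF p(1) j] pq by simp
  qed
qed

section \<open>The reflection group in coordinates\<close>

locale complex_reflection =
  fixes r n :: nat and \<zeta> :: complex
  assumes r2: "r \<ge> 2" and n1: "n \<ge> 1" and prim: "primitive_root_of_unity r \<zeta>"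
begin

definition Z :: "complex set" where "Z = {z. z ^ r = 1}"

abbreviation G :: "complex mat set" where "G \<equiv> refl_group r \<zeta> n"

abbreviation I :: "nat set" where "I \<equiv> {0..<n}"

definition colourings :: "(nat \<Rightarrow> complex) set" where "colourings = PiE I (\<lambda>_. Z)"

lemma I: "finite I" "I \<noteq> {}" "card I = n" using n1 by auto

lemma card_Z: "card Z = r" "finite Z"
  using r2 card_roots_unity_eq[of r] finite_roots_unity[of r] by (auto simp: Z_def)

lemma powers_inj: "inj_on (\<lambda>k. \<zeta> ^ k) {..<r}"
proof -
  have nz: "\<zeta> \<noteq> 0" using prim r2 unfolding primitive_root_of_unity_def by (auto simp: power_0_left)
  have "\<zeta> ^ i \<noteq> \<zeta> ^ j" if "i < j" "j < r" for i j
  proof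
    assume "\<zeta> ^ i = \<zeta> ^ j"
    also have "\<zeta> ^ j = \<zeta> ^ i * \<zeta> ^ (j - i)" using that by (simp flip: power_add)
    finally have "\<zeta> ^ (j - i) = 1" using nz by simp
    moreover have "0 < j - i" "j - i < r" using that by auto
    ultimately show False using prim unfolding primitive_root_of_unity_def by blast
  qed
  thus ?thesis by (intro inj_onI) (metis lessThan_iff linorder_neqE_nat)
qed

text \<open>By primitivity the powers of \<open>\<zeta>\<close> are r distinct roots of unity, and
  there are no more than r of them.\<close>

lemma Z_eq_powers: "Z = (\<lambda>k. \<zeta> ^ k) ` {..<r}"
proof (rule card_subset_eq[symmetric])
  show "finite Z" by (rule card_Z)
  have "\<zeta> ^ r = 1" using prim by (simp add: primitive_root_of_unity_def)
  thus "(\<lambda>k. \<zeta> ^ k) ` {..<r} \<subseteq> Z" by (auto simp: Z_def) (metis mult.commute power_mult power_one)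
  show "card ((\<lambda>k. \<zeta> ^ k) ` {..<r}) = card Z" using card_image[OF powers_inj] card_Z by simp
qed

lemma Z: "1 \<in> Z" "0 \<notin> Z" "x \<in> Z \<Longrightarrow> y \<in> Z \<Longrightarrow> x / y \<in> Z" "x \<in> Z \<Longrightarrow> y \<in> Z \<Longrightarrow> x * y \<in> Z" "\<zeta> \<in> Z" "\<zeta> \<noteq> 1"
proof -
  show "\<zeta> \<noteq> 1" using prim r2 unfolding primitive_root_of_unity_def by (auto dest: spec[of _ 1])
qed (use prim r2 in \<open>auto simp: Z_def power_divide power_mult_distrib power_0_left primitive_root_of_unity_def\<close>)

lemma power_eq_one_iff: "k < r \<Longrightarrow> \<zeta> ^ k = 1 \<longleftrightarrow> k = 0"
  using prim unfolding primitive_root_of_unity_def by (metis gr0I power_0)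

lemma power_eq_iff: "k < r \<Longrightarrow> \<zeta> ^ k = \<zeta> \<longleftrightarrow> k = 1"
  using inj_onD[OF powers_inj, of k 1] r2 by auto

lemma finite_colourings: "finite colourings"
  unfolding colourings_def by (rule finite_PiE) (use card_Z in auto)

lemma colouring: "c \<in> colourings \<Longrightarrow> j < n \<Longrightarrow> c j \<in> Z" "c \<in> colourings \<Longrightarrow> j < n \<Longrightarrow> c j \<noteq> 0"
  "c \<in> colourings \<Longrightarrow> c \<in> extensional I"
proof -
  show a: "c \<in> colourings \<Longrightarrow> j < n \<Longrightarrow> c j \<in> Z" for c j by (auto simp: colourings_def)
  show "c \<in> colourings \<Longrightarrow> j < n \<Longrightarrow> c j \<noteq> 0" using a Z(2) by metis
  show "c \<in> colourings \<Longrightarrow> c \<in> extensional I" by (simp add: colourings_def PiE_def)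
qed

lemma prod_colouring:
  assumes "c \<in> colourings" "C \<subseteq> I"
  shows "prod c C \<in> Z"
proof -
  have "finite C" using assms(2) finite_subset by blast
  thus ?thesis using assms(2)
    by (induction C rule: finite_induct) (use colouring(1)[OF assms(1)] Z in auto)
qed

lemma monomial_mat_mem:
  assumes p: "p permutes I" and c: "c \<in> colourings"
  shows "monomial_mat n p c \<in> G"
proof -
  have e: "monomial_mat n p c $$ (i, j) \<noteq> 0 \<longleftrightarrow> i = p j" if "i < n" "j < n" for i j
    using that colouring(2)[OF c] by simp
  have "\<exists>!j. j < n \<and> monomial_mat n p c $$ (i, j) \<noteq> 0" if i: "i < n" for i
  proof (rule ex1I[of _ "inv_into UNIV p i"])
    show "inv_into UNIV p i < n \<and> monomial_mat n p c $$ (i, inv_into UNIV p i) \<noteq> 0"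
      using e[OF i] permutes_lt[OF permutes_inv[OF p] i] permutes_inverses(1)[OF p] by simp
    show "j = inv_into UNIV p i" if "j < n \<and> monomial_mat n p c $$ (i, j) \<noteq> 0" for j
      using that e[OF i] permutes_inverses(2)[OF p] by metis
  qed
  moreover have "\<exists>!i. i < n \<and> monomial_mat n p c $$ (i, j) \<noteq> 0" if j: "j < n" for j
    using e[OF _ j] permutes_lt[OF p j] by metis
  moreover have "monomial_mat n p c $$ (i, j) \<in> {\<zeta> ^ k | k. k < r}"
    if "i < n" "j < n" "monomial_mat n p c $$ (i, j) \<noteq> 0" for i j
  proof -
    have "monomial_mat n p c $$ (i, j) = c j" using that by (simp split: if_splits)
    moreover have "c j \<in> Z" by (rule colouring(1)[OF c that(2)])
    ultimately show ?thesis unfolding Z_eq_powers by auto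
  qed
  ultimately show ?thesis unfolding refl_group_def by simp
qed

lemma refl_group_cases:
  assumes "x \<in> G"
  obtains p c where "p permutes I" "c \<in> colourings" "x = monomial_mat n p c"
proof -
  have x: "x \<in> carrier_mat n n" "\<And>i. i < n \<Longrightarrow> \<exists>!j. j < n \<and> x $$ (i, j) \<noteq> 0"
    "\<And>j. j < n \<Longrightarrow> \<exists>!i. i < n \<and> x $$ (i, j) \<noteq> 0"
    "\<And>i j. i < n \<Longrightarrow> j < n \<Longrightarrow> x $$ (i, j) \<noteq> 0 \<Longrightarrow> x $$ (i, j) \<in> {\<zeta> ^ k | k. k < r}"
    using assms unfolding refl_group_def by auto
  define p where "p = (\<lambda>j. if j < n then (THE i. i < n \<and> x $$ (i, j) \<noteq> 0) else j)"
  have p: "p j < n" "x $$ (p j, j) \<noteq> 0" if "j < n" for j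
    using theI'[OF x(3)[OF that]] that by (auto simp: p_def)
  have pu: "i = p j" if "i < n" "j < n" "x $$ (i, j) \<noteq> 0" for i j
    using x(3)[OF that(2)] p[OF that(2)] that by blast
  have inj: "inj_on p I"
  proof (rule inj_onI)
    fix j k assume "j \<in> I" "k \<in> I" "p j = p k"
    thus "j = k" using x(2)[of "p j"] p[of j] p[of k] by (metis atLeastLessThan_iff)
  qed
  have "p permutes I"
  proof (rule bij_imp_permutes)
    have "p ` I \<subseteq> I" using p by auto
    thus "bij_betw p I I" using inj by (simp add: bij_betw_def endo_inj_surj)
  qed (simp add: p_def)
  moreover have "(\<lambda>j\<in>I. x $$ (p j, j)) \<in> colourings"
    unfolding colourings_def restrict_PiE_iff
  proof
    fix j assume "j \<in> I"
    hence "x $$ (p j, j) \<in> {\<zeta> ^ k | k. k < r}" using x(4) p by simp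
    thus "x $$ (p j, j) \<in> Z" unfolding Z_eq_powers by blast
  qed
  moreover have "x = monomial_mat n p (\<lambda>j\<in>I. x $$ (p j, j))"
    by (rule eq_matI) (use x(1) pu in auto)
  ultimately show ?thesis by (rule that)
qed

lemma monomial_mat_bij:
  "bij_betw (\<lambda>(p, c). monomial_mat n p c) ({p. p permutes I} \<times> colourings) G"
  unfolding bij_betw_def
proof
  show "inj_on (\<lambda>(p, c). monomial_mat n p c) ({p. p permutes I} \<times> colourings)"
  proof (rule inj_onI)
    fix x y assume xy: "x \<in> {p. p permutes I} \<times> colourings" "y \<in> {p. p permutes I} \<times> colourings"
      "(case x of (p, c) \<Rightarrow> monomial_mat n p c) = (case y of (p, c) \<Rightarrow> monomial_mat n p c)"
    obtain p c where x: "x = (p, c)" by (cases x)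
    obtain q d where y: "y = (q, d)" by (cases y)
    have "p permutes I" "q permutes I" "c \<in> colourings" "d \<in> colourings" using xy x y by auto
    hence "p = q \<and> c = d"
      using xy(3) by (intro monomial_mat_inject colouring(2)) (simp_all add: x y colouring(3))
    thus "x = y" by (simp add: x y)
  qed
  show "(\<lambda>(p, c). monomial_mat n p c) ` ({p. p permutes I} \<times> colourings) = G"
  proof (intro subset_antisym subsetI)
    fix x assume "x \<in> G"
    then obtain p c where "p permutes I" "c \<in> colourings" "x = monomial_mat n p c"
      by (rule refl_group_cases)
    thus "x \<in> (\<lambda>(p, c). monomial_mat n p c) ` ({p. p permutes I} \<times> colourings)"
      by (intro image_eqI[of _ _ "(p, c)"]) auto
  qed (auto intro: monomial_mat_mem)
qed

lemma sum_refl_group: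
  "(\<Sum>x\<in>G. h x) = (\<Sum>p | p permutes I. \<Sum>c\<in>colourings. h (monomial_mat n p c))"
  using sum.reindex_bij_betw[OF monomial_mat_bij, of h]
  by (simp add: sum.cartesian_product case_prod_beta')

lemma card_colourings: "card colourings = r ^ n"
  unfolding colourings_def by (subst card_PiE) (auto simp: card_Z)

lemma finite_refl_group: "finite G"
  using bij_betw_finite[OF monomial_mat_bij] finite_colourings finite_permutations[OF I(1)] by auto

lemma card_refl_group: "card G = fact n * r ^ n"
  using bij_betw_same_card[OF monomial_mat_bij] card_permutations[OF I(3) I(1)]
  by (simp add: card_cartesian_product card_colourings)

lemma refl_group_mult:
  assumes "x \<in> G" "y \<in> G"
  shows "x * y \<in> G"
proof -
  obtain p c where x: "p permutes I" "c \<in> colourings" "x = monomial_mat n p c"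
    by (rule refl_group_cases[OF assms(1)])
  obtain q d where y: "q permutes I" "d \<in> colourings" "y = monomial_mat n q d"
    by (rule refl_group_cases[OF assms(2)])
  have "(\<lambda>j\<in>I. c (q j) * d j) \<in> colourings"
    using x y permutes_lt[OF y(1)] Z(4) colouring(1) by (auto simp: colourings_def)
  thus ?thesis
    unfolding x(3) y(3) monomial_mat_mult[OF y(1)]
    by (intro monomial_mat_mem permutes_compose x y)
qed

lemma perm_part_colouring:
  assumes "p permutes I" "c \<in> colourings"
  shows "perm_part n (monomial_mat n p c) = p"
  by (rule perm_part_monomial_mat[OF assms(1)]) (rule colouring(2)[OF assms(2)])

lemma cycle_product_monomial_mat:
  assumes "p permutes I" "c \<in> colourings" "C \<subseteq> I"
  shows "cycle_product n (monomial_mat n p c) C = prod c C"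
  unfolding cycle_product_def perm_part_colouring[OF assms(1,2)]
  by (rule prod.cong) (use assms permutes_lt in auto)

lemma mat_type_monomial_mat:
  assumes "p permutes I" "c \<in> colourings"
  shows "mat_type r \<zeta> n (monomial_mat n p c) =
    map (\<lambda>j. image_mset card (mset_set {C \<in> orbit p ` I. prod c C = \<zeta> ^ j})) [0..<r]"
proof -
  have "cycle_product n (monomial_mat n p c) C = prod c C" if C: "C \<in> orbit p ` I" for C
  proof (rule cycle_product_monomial_mat[OF assms])
    from C obtain i where "i \<in> I" "C = orbit p i" by (rule imageE)
    thus "C \<subseteq> I" using permutes_orbit_subset[OF assms(1)] by simp
  qed
  hence "{C \<in> orbit p ` I. cycle_product n (monomial_mat n p c) C = \<zeta> ^ j} = {C \<in> orbit p ` I. prod c C = \<zeta> ^ j}" for j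
    by (intro Collect_cong conj_cong refl) simp
  thus ?thesis
    unfolding mat_type_def cycle_sets_def perm_part_colouring[OF assms] by (simp only:)
qed

lemma ell_monomial_mat:
  assumes "p permutes I" "c \<in> colourings"
  shows "ell r \<zeta> n (monomial_mat n p c) = card {C \<in> orbit p ` I. prod c C = 1}"
  unfolding ell_def mat_type_monomial_mat[OF assms] using r2 by simp

lemma num_cycles_le: "p permutes I \<Longrightarrow> num_cycles I p \<le> n"
  unfolding num_cycles_def using card_image_le[OF I(1), of "orbit p"] I(3) by simp

lemma ell_le:
  assumes "x \<in> G"
  shows "ell r \<zeta> n x \<le> n"
proof -
  obtain p c where x: "p permutes I" "c \<in> colourings" "x = monomial_mat n p c"
    by (rule refl_group_cases[OF assms])
  have "card {C \<in> orbit p ` I. prod c C = 1} \<le> num_cycles I p"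
    unfolding num_cycles_def by (rule card_mono) auto
  thus ?thesis unfolding x(3) ell_monomial_mat[OF x(1,2)] using num_cycles_le[OF x(1)] by simp
qed

text \<open>Ensures that \<open>class_value\<close> really is a value of the function for every
  index up to n; on an empty class its description would not be unique.\<close>

lemma ell_class_nonempty:
  assumes "i \<le> n"
  shows "ell_class r \<zeta> n i \<noteq> {}"
proof -
  \<comment> \<open>A diagonal matrix with i entries 1 and all others equal to
    \<open>\<zeta>\<close>, which is not 1 because r \<ge> 2.\<close>
  define c where "c = (\<lambda>j\<in>I. if j < i then 1 else \<zeta>)"
  have c: "c \<in> colourings" by (auto simp: c_def colourings_def Z)
  have o: "orbit id j = {j}" for j :: nat by (simp add: orbit_eq_singleton_iff)
  have "{C \<in> orbit id ` I. prod c C = 1} = (\<lambda>j. {j}) ` {0..<i}"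
    using assms Z(6) by (auto simp: o c_def image_iff split: if_splits)
  hence "card {C \<in> orbit id ` I. prod c C = 1} = i" by (simp add: card_image)
  hence "ell r \<zeta> n (monomial_mat n id c) = i" using ell_monomial_mat[OF permutes_id c] by simp
  thus ?thesis using monomial_mat_mem[OF permutes_id c] by (auto simp: ell_class_def)
qed

end

section \<open>Averages over conjugacy classes\<close>

definition avg :: "'a set \<Rightarrow> ('a \<Rightarrow> real) \<Rightarrow> real" where
  "avg A f = (\<Sum>x\<in>A. f x) / real (card A)"

lemma avg_swap: "avg A (\<lambda>x. avg B (\<lambda>y. f x y)) = avg B (\<lambda>y. avg A (\<lambda>x. f x y))"
  unfolding avg_def sum_divide_distrib[symmetric] by (subst sum.swap) simp

lemma avg_cong: "(\<And>x. x \<in> A \<Longrightarrow> f x = g x) \<Longrightarrow> avg A f = avg A g"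
  unfolding avg_def by (simp cong: sum.cong)

lemma orbit_image_eq_singleton:
  assumes "finite S" "p permutes S" "S \<noteq> {}"
  shows "orbit p ` S = {S} \<longleftrightarrow> num_cycles S p = 1" "S \<in> orbit p ` S \<Longrightarrow> num_cycles S p = 1"
proof -
  have a: "orbit p ` S = {S}" if "num_cycles S p = 1"
  proof -
    obtain C where "orbit p ` S = {C}" using \<open>num_cycles S p = 1\<close> unfolding num_cycles_def by (rule card_1_singletonE)
    moreover have "\<Union>(orbit p ` S) = S" by (rule Union_orbits[OF assms(1,2)])
    ultimately show ?thesis by simp
  qed
  thus "orbit p ` S = {S} \<longleftrightarrow> num_cycles S p = 1" by (auto simp: num_cycles_def)
  assume "S \<in> orbit p ` S"
  then obtain a where S: "S = orbit p a" by (rule imageE)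
  have "orbit p x = S" if "x \<in> S" for x
    using orbit_eq_of_mem[OF assms(1,2), of x a] that by (simp only: S)
  hence "orbit p ` S = (\<lambda>_. S) ` S" by (rule image_cong[OF refl])
  thus "num_cycles S p = 1" using assms(3) by (simp add: num_cycles_def image_constant_conv)
qed

lemma full_cycles_remove_iff:
  assumes S: "finite S" "i \<in> S" "S - {i} \<noteq> {}" and p: "p permutes S"
  shows "p \<in> full_cycles (S - {i}) \<longleftrightarrow> {i} \<in> orbit p ` S \<and> S - {i} \<in> orbit p ` S"
proof
  assume "p \<in> full_cycles (S - {i})"
  hence p': "p permutes S - {i}" "num_cycles (S - {i}) p = 1" by (auto simp: full_cycles_def)
  have "orbit p ` insert i (S - {i}) = insert {i} (orbit p ` (S - {i}))"
    by (rule orbit_insert_fixed) (use S p' in auto)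
  moreover have "orbit p ` (S - {i}) = {S - {i}}"
    using orbit_image_eq_singleton(1)[of "S - {i}" p] S p' by simp
  ultimately show "{i} \<in> orbit p ` S \<and> S - {i} \<in> orbit p ` S"
    using S(2) by (simp add: insert_absorb)
next
  assume A: "{i} \<in> orbit p ` S \<and> S - {i} \<in> orbit p ` S"
  then obtain x y where xy: "{i} = orbit p x" "S - {i} = orbit p y" by blast
  have "i \<in> orbit p x" using xy(1) by blast
  hence "orbit p i = {i}" using orbit_eq_of_mem[OF S(1) p] xy(1) by simp
  hence pi: "p i = i" by (simp add: orbit_eq_singleton_iff)
  have p': "p permutes S - {i}" by (rule permutes_superset[OF p]) (use pi in auto)
  have "y \<in> S - {i}" using mem_orbit_self[OF S(1) p, of y] xy(2) by simp
  hence "S - {i} \<in> orbit p ` (S - {i})" using xy(2) by (rule rev_image_eqI)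
  hence "num_cycles (S - {i}) p = 1" using orbit_image_eq_singleton(2)[of "S - {i}" p] S p' by simp
  thus "p \<in> full_cycles (S - {i})" using p' by (simp add: full_cycles_def)
qed

lemma orbit_image_full_cycle_remove:
  assumes S: "finite S" "i \<in> S" "S - {i} \<noteq> {}" and p: "p \<in> full_cycles (S - {i})"
  shows "orbit p ` S = {{i}, S - {i}}" "p permutes S" "p i = i"
proof -
  have p': "p permutes S - {i}" "num_cycles (S - {i}) p = 1" using p by (auto simp: full_cycles_def)
  show "p permutes S" by (rule permutes_subset[OF p'(1)]) auto
  show "p i = i" by (rule permutes_not_in[OF p'(1)]) simp
  have "orbit p ` insert i (S - {i}) = insert {i} (orbit p ` (S - {i}))"
    by (rule orbit_insert_fixed) (use S p' in auto)
  moreover have "orbit p ` (S - {i}) = {S - {i}}"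
    using orbit_image_eq_singleton(1)[of "S - {i}" p] S p' by simp
  ultimately show "orbit p ` S = {{i}, S - {i}}" using S(2) by (simp add: insert_absorb)
qed

section \<open>The conjugacy classes of the sequences and their images among the
  permutations\<close>

context complex_reflection
begin

lemma remove_nonempty:
  assumes "n \<ge> 2"
  shows "I - {i} \<noteq> {}"
proof
  assume "I - {i} = {}"
  hence "card I \<le> card {i}" by (intro card_mono) auto
  thus False using assms I(3) by simp
qed

abbreviation \<pi> :: "complex mat \<Rightarrow> nat \<Rightarrow> nat" where "\<pi> \<equiv> perm_part n"

text \<open>The total colour. It is the determinant up to the sign of the permutation part, hence
  multiplicative, and it is all that survives of the colours once the first factor of a sequence is
  averaged.\<close>

definition \<delta> :: "complex mat \<Rightarrow> complex" where "\<delta> x = cycle_product n x I"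

lemma \<delta>_monomial_mat: "p permutes I \<Longrightarrow> c \<in> colourings \<Longrightarrow> \<delta> (monomial_mat n p c) = prod c I"
  unfolding \<delta>_def by (rule cycle_product_monomial_mat) auto

lemma mult_colouring:
  assumes "q permutes I" "c \<in> colourings" "d \<in> colourings"
  shows "(\<lambda>j\<in>I. c (q j) * d j) \<in> colourings" "prod (\<lambda>j\<in>I. c (q j) * d j) I = prod c I * prod d I"
proof -
  show "(\<lambda>j\<in>I. c (q j) * d j) \<in> colourings"
    using assms permutes_lt[OF assms(1)] Z(4) colouring(1) by (auto simp: colourings_def)
  have "prod (\<lambda>j\<in>I. c (q j) * d j) I = (\<Prod>j\<in>I. c (q j)) * prod d I"
    by (simp add: prod.distrib)
  also have "(\<Prod>j\<in>I. c (q j)) = prod c I" using prod.permute[OF assms(1), of c] by (simp add: comp_def)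
  finally show "prod (\<lambda>j\<in>I. c (q j) * d j) I = prod c I * prod d I" .
qed

lemma \<pi>_\<delta>_mult:
  assumes "x \<in> G" "y \<in> G"
  shows "\<pi> (x * y) = \<pi> x \<circ> \<pi> y" "\<delta> (x * y) = \<delta> x * \<delta> y"
proof -
  obtain p c where x: "p permutes I" "c \<in> colourings" "x = monomial_mat n p c"
    by (rule refl_group_cases[OF assms(1)])
  obtain q d where y: "q permutes I" "d \<in> colourings" "y = monomial_mat n q d"
    by (rule refl_group_cases[OF assms(2)])
  note m = mult_colouring[OF y(1) x(2) y(2)]
  have pq: "p \<circ> q permutes I" by (rule permutes_compose[OF y(1) x(1)])
  show "\<pi> (x * y) = \<pi> x \<circ> \<pi> y"
    unfolding x(3) y(3) monomial_mat_mult[OF y(1)] perm_part_colouring[OF pq m(1)]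
      perm_part_colouring[OF x(1,2)] perm_part_colouring[OF y(1,2)] ..
  show "\<delta> (x * y) = \<delta> x * \<delta> y"
    unfolding x(3) y(3) monomial_mat_mult[OF y(1)] \<delta>_monomial_mat[OF pq m(1)]
      \<delta>_monomial_mat[OF x(1,2)] \<delta>_monomial_mat[OF y(1,2)] m(2) ..
qed

lemma sum_pairs:
  assumes "X \<subseteq> G" and "\<And>p c. p permutes I \<Longrightarrow> c \<in> colourings \<Longrightarrow> monomial_mat n p c \<in> X \<longleftrightarrow> P p c"
  shows "(\<Sum>x\<in>X. h x) = (\<Sum>p | p permutes I. \<Sum>c\<in>colourings. if P p c then h (monomial_mat n p c) else 0)"
proof -
  have "(\<Sum>x\<in>X. h x) = (\<Sum>x\<in>G. if x \<in> X then h x else 0)"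
    using sum.inter_restrict[OF finite_refl_group, of h X] assms(1) by (simp add: Int_absorb1)
  also have "\<dots> = (\<Sum>p | p permutes I. \<Sum>c\<in>colourings. if P p c then h (monomial_mat n p c) else 0)"
    unfolding sum_refl_group by (intro sum.cong refl) (simp add: assms(2))
  finally show ?thesis .
qed

lemma conj_class_iff:
  assumes "p permutes I" "c \<in> colourings" "length lam = r"
  shows "monomial_mat n p c \<in> conj_class r \<zeta> n lam \<longleftrightarrow>
    (\<forall>j<r. image_mset card (mset_set {C \<in> orbit p ` I. prod c C = \<zeta> ^ j}) = lam ! j)"
  unfolding conj_class_def using monomial_mat_mem[OF assms(1,2)] assms(3)
  by (auto simp: mat_type_monomial_mat[OF assms(1,2)] list_eq_iff_nth_eq)

lemma conj_class_subset: "conj_class r \<zeta> n lam \<subseteq> G"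
  by (auto simp: conj_class_def)

lemma conj_class_full_cycle:
  assumes lam: "length lam = r" "\<And>j. j < r \<Longrightarrow> lam ! j = (if j = k then {#n#} else {#})"
    and k: "k < r" and p: "p permutes I" and c: "c \<in> colourings"
  shows "monomial_mat n p c \<in> conj_class r \<zeta> n lam \<longleftrightarrow> p \<in> full_cycles I \<and> prod c I = \<zeta> ^ k"
proof -
  let ?X = "\<lambda>j. {C \<in> orbit p ` I. prod c C = \<zeta> ^ j}"
  have "(\<forall>j<r. image_mset card (mset_set (?X j)) = (if j = k then {#n#} else {#})) \<longleftrightarrow>
      p \<in> full_cycles I \<and> prod c I = \<zeta> ^ k"
  proof
    assume A: "\<forall>j<r. image_mset card (mset_set (?X j)) = (if j = k then {#n#} else {#})"
    have m: "image_mset card (mset_set (?X k)) = {#n#}" using A k by simp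
    hence "size (mset_set (?X k)) = 1" by (metis size_image_mset size_single)
    hence "card (?X k) = 1" by simp
    then obtain C where X: "?X k = {C}" by (rule card_1_singletonE)
    hence C: "C \<in> orbit p ` I" "prod c C = \<zeta> ^ k" by blast+
    have "card C = n" using m unfolding X by simp
    moreover have "C \<subseteq> I" using C(1) permutes_orbit_subset[OF p] by (metis imageE)
    ultimately have CI: "C = I" using card_subset_eq[OF I(1)] I(3) by simp
    hence "num_cycles I p = 1" using orbit_image_eq_singleton(2)[OF I(1) p I(2)] C(1) by simp
    thus "p \<in> full_cycles I \<and> prod c I = \<zeta> ^ k" using p C(2) CI by (simp add: full_cycles_def)
  next
    assume A: "p \<in> full_cycles I \<and> prod c I = \<zeta> ^ k"
    hence o: "orbit p ` I = {I}" using orbit_image_eq_singleton(1)[OF I(1) p I(2)] by (simp add: full_cycles_def)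
    have "?X j = (if j = k then {I} else {})" if "j < r" for j
      using A inj_onD[OF powers_inj, of j k] that k unfolding o by auto
    thus "\<forall>j<r. image_mset card (mset_set (?X j)) = (if j = k then {#n#} else {#})" by simp
  qed
  thus ?thesis unfolding conj_class_iff[OF p c lam(1)] using lam(2) by simp
qed

text \<open>Distinct cycles are disjoint, so lengths n - 1 and 1 exhaust all points. The cycles are
  assumed distinct because for n = 2 their lengths do not tell them apart.\<close>

lemma two_cycles_complementary:
  assumes n2: "n \<ge> 2" and p: "p permutes I" and R: "R \<in> orbit p ` I" and F: "F \<in> orbit p ` I"
    and ne: "R \<noteq> F" and cd: "card R = n - 1" "card F = 1"
  obtains i where "i \<in> I" "F = {i}" "R = I - {i}" "p \<in> full_cycles (I - {i})"
proof -
  obtain i where Fi: "F = {i}" using cd(2) by (rule card_1_singletonE)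
  obtain x where x: "R = orbit p x" "x \<in> I" using R by (rule imageE)
  obtain y where y: "F = orbit p y" "y \<in> I" using F by (rule imageE)
  have sub: "R \<subseteq> I" "F \<subseteq> I" using permutes_orbit_subset[OF p] x y by simp_all
  have "i \<notin> R"
  proof
    assume "i \<in> R"
    hence "orbit p i = R" "orbit p i = F"
      using orbit_eq_of_mem[OF I(1) p] x(1) y(1) Fi by (metis, metis singletonI)
    thus False using ne by simp
  qed
  hence "R \<subseteq> I - {i}" using sub by blast
  moreover have "card (I - {i}) = n - 1" using sub(2) Fi I by simp
  ultimately have RI: "R = I - {i}" using card_subset_eq[of "I - {i}" R] cd(1) by simp
  have i: "i \<in> I" using sub(2) Fi by simp
  have "p \<in> full_cycles (I - {i})"
    unfolding full_cycles_remove_iff[OF I(1) i remove_nonempty[OF n2] p] using R F unfolding RI Fi by simp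
  thus ?thesis by (rule that[OF i Fi RI])
qed

lemma conj_class_subfull_cycle_coloured:
  assumes n2: "n \<ge> 2"
    and lam: "length lam = r" "\<And>j. j < r \<Longrightarrow> lam ! j = (if j = 0 then {#n - 1#} else if j = 1 then {#1#} else {#})"
    and p: "p permutes I" and c: "c \<in> colourings"
  shows "monomial_mat n p c \<in> conj_class r \<zeta> n lam \<longleftrightarrow>
    (\<exists>i\<in>I. p \<in> full_cycles (I - {i}) \<and> c i = \<zeta> \<and> prod c (I - {i}) = 1)"
proof -
  let ?X = "\<lambda>j. {C \<in> orbit p ` I. prod c C = \<zeta> ^ j}"
  let ?lam = "\<lambda>j::nat. if j = 0 then {#n - 1#} else if j = 1 then {#1#} else {#}"
  note ne = remove_nonempty[OF n2]
  have "(\<forall>j<r. image_mset card (mset_set (?X j)) = ?lam j) \<longleftrightarrow>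
      (\<exists>i\<in>I. p \<in> full_cycles (I - {i}) \<and> c i = \<zeta> \<and> prod c (I - {i}) = 1)"
  proof
    assume A: "\<forall>j<r. image_mset card (mset_set (?X j)) = ?lam j"
    have m: "image_mset card (mset_set (?X 0)) = {#n - 1#}" "image_mset card (mset_set (?X 1)) = {#1#}"
      using A[rule_format, of 0] A[rule_format, of 1] r2 by simp_all
    have "card (?X 0) = 1" using arg_cong[OF m(1), of size] by simp
    then obtain R where X0: "?X 0 = {R}" by (rule card_1_singletonE)
    have "card (?X 1) = 1" using arg_cong[OF m(2), of size] by simp
    then obtain F where X1: "?X 1 = {F}" by (rule card_1_singletonE)
    note X = X0 X1
    have R: "R \<in> orbit p ` I" "prod c R = 1" and F: "F \<in> orbit p ` I" "prod c F = \<zeta>"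
      using X by (auto simp: set_eq_iff)
    have cd: "card R = n - 1" "card F = 1" using m unfolding X by simp_all
    have "R \<noteq> F" using R(2) F(2) Z(6) by auto
    then obtain i where i: "i \<in> I" "F = {i}" "R = I - {i}" "p \<in> full_cycles (I - {i})"
      by (rule two_cycles_complementary[OF n2 p R(1) F(1) _ cd])
    thus "\<exists>i\<in>I. p \<in> full_cycles (I - {i}) \<and> c i = \<zeta> \<and> prod c (I - {i}) = 1"
      using R(2) F(2) by auto
  next
    assume "\<exists>i\<in>I. p \<in> full_cycles (I - {i}) \<and> c i = \<zeta> \<and> prod c (I - {i}) = 1"
    then obtain i where i: "i \<in> I" "p \<in> full_cycles (I - {i})" "c i = \<zeta>" "prod c (I - {i}) = 1" by blast
    note o = orbit_image_full_cycle_remove(1)[OF I(1) i(1) ne i(2)]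
    have X0: "?X 0 = {I - {i}}" unfolding o using i Z(6) by auto
    have X1: "?X 1 = {{i}}" unfolding o using i Z(6) by auto
    have Xj: "?X j = {}" if "j < r" "j \<noteq> 0" "j \<noteq> 1" for j
    proof -
      have "\<zeta> ^ j \<noteq> 1" "\<zeta> ^ j \<noteq> \<zeta>" using power_eq_one_iff[OF that(1)] power_eq_iff[OF that(1)] that by simp_all
      thus ?thesis unfolding o using i by auto
    qed
    have cI: "card (I - {i}) = n - 1" using i I by simp
    show "\<forall>j<r. image_mset card (mset_set (?X j)) = ?lam j"
    proof (intro allI impI)
      fix j assume j: "j < r"
      consider "j = 0" | "j = 1" | "j \<noteq> 0" "j \<noteq> 1" by blast
      thus "image_mset card (mset_set (?X j)) = ?lam j"
      proof cases
        case 3 thus ?thesis unfolding Xj[OF j 3] by simp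
      qed (use X0 X1 cI in simp_all)
    qed
  qed
  thus ?thesis unfolding conj_class_iff[OF p c lam(1)] using lam(2) by simp
qed

text \<open>For n = 2 the partition has two equal parts, and either point may serve as the witness
  \<open>i\<close>. The existential form covers this case too; the ambiguity is accounted for by the
  multiplicity in \<open>avg_subfull_cycle_class\<close>.\<close>

lemma conj_class_subfull_cycle_uncoloured:
  assumes n2: "n \<ge> 2"
    and lam: "length lam = r" "\<And>j. j < r \<Longrightarrow> lam ! j = (if j = 0 then {#n - 1, 1#} else {#})"
    and p: "p permutes I" and c: "c \<in> colourings"
  shows "monomial_mat n p c \<in> conj_class r \<zeta> n lam \<longleftrightarrow>
    (\<exists>i\<in>I. p \<in> full_cycles (I - {i}) \<and> c i = 1 \<and> prod c (I - {i}) = 1)"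
proof -
  let ?X = "\<lambda>j. {C \<in> orbit p ` I. prod c C = \<zeta> ^ j}"
  let ?lam = "\<lambda>j::nat. if j = 0 then {#n - 1, 1#} else {#}"
  note ne = remove_nonempty[OF n2]
  have "(\<forall>j<r. image_mset card (mset_set (?X j)) = ?lam j) \<longleftrightarrow>
      (\<exists>i\<in>I. p \<in> full_cycles (I - {i}) \<and> c i = 1 \<and> prod c (I - {i}) = 1)"
  proof
    assume A: "\<forall>j<r. image_mset card (mset_set (?X j)) = ?lam j"
    have m: "image_mset card (mset_set (?X 0)) = {#n - 1, 1#}"
      using A[rule_format, of 0] r2 by simp
    have "card (?X 0) = 2" using arg_cong[OF m, of size] by simp
    then obtain C D where X: "?X 0 = {C, D}" "C \<noteq> D" by (auto simp: card_2_iff)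
    have "{#card C, card D#} = {#n - 1, 1#}" using m X(2) unfolding X(1) by simp
    hence "card C = n - 1 \<and> card D = 1 \<or> card D = n - 1 \<and> card C = 1"
      by (auto simp: add_eq_conv_ex)
    then obtain R F where RF: "?X 0 = {R, F}" "R \<noteq> F" and cd: "card R = n - 1" "card F = 1"
      using X that[of C D] that[of D C] by (auto simp: insert_commute)
    have R: "R \<in> orbit p ` I" "prod c R = 1" and F: "F \<in> orbit p ` I" "prod c F = 1"
      using RF(1) by (auto simp: set_eq_iff)
    obtain i where i: "i \<in> I" "F = {i}" "R = I - {i}" "p \<in> full_cycles (I - {i})"
      by (rule two_cycles_complementary[OF n2 p R(1) F(1) RF(2) cd])
    thus "\<exists>i\<in>I. p \<in> full_cycles (I - {i}) \<and> c i = 1 \<and> prod c (I - {i}) = 1"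
      using R(2) F(2) by auto
  next
    assume "\<exists>i\<in>I. p \<in> full_cycles (I - {i}) \<and> c i = 1 \<and> prod c (I - {i}) = 1"
    then obtain i where i: "i \<in> I" "p \<in> full_cycles (I - {i})" "c i = 1" "prod c (I - {i}) = 1" by blast
    note o = orbit_image_full_cycle_remove(1)[OF I(1) i(1) ne i(2)]
    have X0: "?X 0 = {I - {i}, {i}}" unfolding o using i by auto
    have Xj: "?X j = {}" if "j < r" "j \<noteq> 0" for j
      unfolding o using i power_eq_one_iff[OF that(1)] that(2) by auto
    have "card (I - {i}) = n - 1" using i I by simp
    moreover have "I - {i} \<noteq> {i}" by blast
    ultimately have "image_mset card (mset_set (?X 0)) = ?lam 0" unfolding X0 by simp
    moreover have "image_mset card (mset_set (?X j)) = ?lam j" if "j < r" "j \<noteq> 0" for j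
      unfolding Xj[OF that] using that by simp
    ultimately show "\<forall>j<r. image_mset card (mset_set (?X j)) = ?lam j" by metis
  qed
  thus ?thesis unfolding conj_class_iff[OF p c lam(1)] using lam(2) by simp
qed

lemma card_colourings_prod:
  assumes "e \<in> Z"
  shows "real r * real (card {c \<in> colourings. prod c I = e}) = real r ^ n"
  using card_PiE_prod_eq[OF card_Z(2) Z(3) Z(2) I(1,2) assms]
  unfolding colourings_def[symmetric] card_Z(1) I(3) by simp

text \<open>Every full cycle carries the same number \<open>N\<close> of colourings with product
  \<open>e\<close>, so the permutation part of a random element is a uniform full cycle and the
  total colour is constant.\<close>

lemma avg_full_cycle_class:
  assumes X: "X \<subseteq> G"
    and iff: "\<And>p c. p permutes I \<Longrightarrow> c \<in> colourings \<Longrightarrow> monomial_mat n p c \<in> X \<longleftrightarrow> p \<in> full_cycles I \<and> prod c I = e"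
    and e: "e \<in> Z"
  shows "avg X (\<lambda>x. H (\<pi> x)) = (\<Sum>p\<in>full_cycles I. H p) / fact (n - 1)" "X \<noteq> {}"
    "x \<in> X \<Longrightarrow> \<delta> x = e" "real r * real (card X) = fact (n - 1) * real r ^ n"
proof -
  define N where "N = real (card {c \<in> colourings. prod c I = e})"
  have rN: "real r * N = real r ^ n" unfolding N_def by (rule card_colourings_prod[OF e])
  hence N0: "N \<noteq> 0" using r2 by auto
  have F: "(\<Sum>x\<in>X. H (\<pi> x)) = N * (\<Sum>p\<in>full_cycles I. H p)" for H :: "(nat \<Rightarrow> nat) \<Rightarrow> real"
  proof -
    have "(\<Sum>x\<in>X. H (\<pi> x)) = (\<Sum>p | p permutes I. \<Sum>c\<in>colourings.
        if p \<in> full_cycles I \<and> prod c I = e then H (\<pi> (monomial_mat n p c)) else 0)"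
      by (rule sum_pairs[OF X iff])
    also have "\<dots> = (\<Sum>p | p permutes I. if p \<in> full_cycles I then N * H p else 0)"
    proof (rule sum.cong[OF refl])
      fix p assume "p \<in> {p. p permutes I}"
      hence p: "p permutes I" by simp
      have "(\<Sum>c\<in>colourings. if p \<in> full_cycles I \<and> prod c I = e then H (\<pi> (monomial_mat n p c)) else 0) =
        (\<Sum>c\<in>colourings. if prod c I = e then (if p \<in> full_cycles I then H p else 0) else 0)"
        by (intro sum.cong refl) (simp add: perm_part_colouring[OF p])
      also have "\<dots> = (\<Sum>c\<in>{c \<in> colourings. prod c I = e}. if p \<in> full_cycles I then H p else 0)"
        by (rule sum.inter_filter[OF finite_colourings, symmetric])
      also have "\<dots> = (if p \<in> full_cycles I then N * H p else 0)" by (simp add: N_def)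
      finally show "(\<Sum>c\<in>colourings. if p \<in> full_cycles I \<and> prod c I = e then H (\<pi> (monomial_mat n p c)) else 0) =
        (if p \<in> full_cycles I then N * H p else 0)" .
    qed
    also have "\<dots> = (\<Sum>p\<in>{p \<in> {p. p permutes I}. p \<in> full_cycles I}. N * H p)"
      by (rule sum.inter_filter[symmetric]) (rule finite_permutations[OF I(1)])
    also have "{p \<in> {p. p permutes I}. p \<in> full_cycles I} = full_cycles I"
      by (auto simp: full_cycles_permutes)
    finally show ?thesis by (simp add: sum_distrib_left)
  qed
  have c: "real (card X) = N * fact (n - 1)"
    using F[of "\<lambda>_. 1"] card_full_cycles[OF I(1,2)] I(3) by simp
  thus "avg X (\<lambda>x. H (\<pi> x)) = (\<Sum>p\<in>full_cycles I. H p) / fact (n - 1)"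
    unfolding avg_def F using N0 by simp
  show "real r * real (card X) = fact (n - 1) * real r ^ n" unfolding c using rN by simp
  show "X \<noteq> {}" using c N0 by auto
  assume x: "x \<in> X"
  hence "x \<in> G" using X by blast
  then obtain p d where pd: "p permutes I" "d \<in> colourings" "x = monomial_mat n p d" by (rule refl_group_cases)
  show "\<delta> x = e" using x iff[OF pd(1,2)] \<delta>_monomial_mat[OF pd(1,2)] unfolding pd(3) by simp
qed

text \<open>Pairs of an element and a fixed point that exhibits it as a member are counted in two
  ways. An element may have several such points, but always the same number \<open>m\<close>, which
  cancels in the average. So the permutation part is distributed like a full cycle on the complement
  of a uniformly chosen point.\<close>

lemma avg_subfull_cycle_class:
  assumes n2: "n \<ge> 2" and X: "X \<subseteq> G" and e: "e \<in> Z" and m: "m > 0"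
    and iff: "\<And>p c. p permutes I \<Longrightarrow> c \<in> colourings \<Longrightarrow> monomial_mat n p c \<in> X \<longleftrightarrow>
      (\<exists>i\<in>I. p \<in> full_cycles (I - {i}) \<and> c i = e \<and> prod c (I - {i}) = 1)"
    and mult: "\<And>p c. p permutes I \<Longrightarrow> c \<in> colourings \<Longrightarrow> monomial_mat n p c \<in> X \<Longrightarrow>
      card {i \<in> I. p \<in> full_cycles (I - {i}) \<and> c i = e \<and> prod c (I - {i}) = 1} = m"
  shows "avg X (\<lambda>x. H (\<pi> x)) = (\<Sum>i\<in>I. \<Sum>p\<in>full_cycles (I - {i}). H p) / (real n * fact (n - 2))" "X \<noteq> {}"
    "x \<in> X \<Longrightarrow> \<delta> x = e"
proof -
  have ci: "card (I - {i}) = n - 1" "I - {i} \<noteq> {}" if "i \<in> I" for i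
  proof -
    show "card (I - {i}) = n - 1" using that I by simp
    thus "I - {i} \<noteq> {}" using n2 by force
  qed
  \<comment> \<open>The colour of \<open>i\<close> is prescribed, and of the colourings of the other
    n - 1 points one in r has product 1.\<close>
  define N where "N = real r ^ (n - 1) / real r"
  have N0: "N \<noteq> 0" using r2 by (simp add: N_def)
  have N: "(\<Sum>c\<in>colourings. if c i = e \<and> prod c (I - {i}) = 1 then 1 else 0) = N" if i: "i \<in> I" for i
  proof -
    have II: "I = {i} \<union> (I - {i})" "{i} \<inter> (I - {i}) = {}" using i by auto
    have "(\<Sum>c\<in>colourings. if c i = e \<and> prod c (I - {i}) = 1 then 1 else 0 :: real) =
      (\<Sum>u\<in>PiE {i} (\<lambda>_. Z). \<Sum>v\<in>PiE (I - {i}) (\<lambda>_. Z). if u i = e \<and> prod v (I - {i}) = 1 then 1 else 0)"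
    proof -
      have "prod (\<lambda>j. if j \<in> {i} then u j else v j) (I - {i}) = prod v (I - {i})" for u v :: "nat \<Rightarrow> complex"
        by (rule prod.cong) auto
      thus ?thesis unfolding colourings_def
        by (subst (1) II(1), subst sum_PiE_Un[OF II(2)]) simp
    qed
    also have "\<dots> = (\<Sum>u\<in>PiE {i} (\<lambda>_. Z). if u i = e then (\<Sum>v\<in>PiE (I - {i}) (\<lambda>_. Z). if prod v (I - {i}) = 1 then 1 else 0) else 0)"
      by (intro sum.cong refl) simp
    also have "(\<Sum>v\<in>PiE (I - {i}) (\<lambda>_. Z). if prod v (I - {i}) = 1 then 1 else 0 :: real) = N"
    proof -
      have fin: "finite (PiE (I - {i}) (\<lambda>_. Z))" by (rule finite_PiE) (use card_Z in auto)
      have "real r * real (card {v \<in> PiE (I - {i}) (\<lambda>_. Z). prod v (I - {i}) = 1}) = real r ^ (n - 1)"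
        using card_PiE_prod_eq[OF card_Z(2) Z(3) Z(2) _ ci(2)[OF i] Z(1)] unfolding card_Z(1) ci(1)[OF i] by simp
      thus ?thesis
        using sum.inter_filter[OF fin, of "\<lambda>_. 1 :: real" "\<lambda>v. prod v (I - {i}) = 1"] r2
        by (simp add: N_def field_simps)
    qed
    also have "(\<Sum>u\<in>PiE {i} (\<lambda>_. Z). if u i = e then N else 0) = (\<Sum>y\<in>Z. if y = e then N else 0)"
      by (rule sum.reindex_bij_witness[of _ "\<lambda>y. (\<lambda>j\<in>{i}. y)" "\<lambda>u. u i"])
         (auto simp: fun_eq_iff PiE_def extensional_def)
    also have "\<dots> = N" using card_Z(2) e by simp
    finally show ?thesis .
  qed
  have F: "real m * (\<Sum>x\<in>X. H (\<pi> x)) = N * (\<Sum>i\<in>I. \<Sum>p\<in>full_cycles (I - {i}). H p)" for H :: "(nat \<Rightarrow> nat) \<Rightarrow> real"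
  proof -
    define Q where "Q = (\<lambda>p c i. p \<in> full_cycles (I - {i}) \<and> c i = e \<and> prod c (I - {i}) = (1 :: complex))"
    have "real m * (\<Sum>x\<in>X. H (\<pi> x)) = real m * (\<Sum>p | p permutes I. \<Sum>c\<in>colourings.
        if \<exists>i\<in>I. Q p c i then H (\<pi> (monomial_mat n p c)) else 0)"
      unfolding Q_def by (rule arg_cong[OF sum_pairs[OF X iff]])
    also have "\<dots> = (\<Sum>p | p permutes I. \<Sum>c\<in>colourings. \<Sum>i\<in>I. if Q p c i then H p else 0)"
      unfolding sum_distrib_left
    proof (rule sum.cong[OF refl], rule sum.cong[OF refl])
      fix p c assume "p \<in> {p. p permutes I}" and c: "c \<in> colourings"
      hence p: "p permutes I" by simp
      have "(\<Sum>i\<in>I. if Q p c i then H p else 0) = real (card {i \<in> I. Q p c i}) * H p"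
        using sum.inter_filter[OF I(1), of "\<lambda>_. H p" "Q p c"] by simp
      also have "\<dots> = (if \<exists>i\<in>I. Q p c i then real m * H p else 0)"
      proof (cases "\<exists>i\<in>I. Q p c i")
        case True
        thus ?thesis using mult[OF p c] iff[OF p c] unfolding Q_def by auto
      next
        case False
        hence "{i \<in> I. Q p c i} = {}" by blast
        thus ?thesis using False by simp
      qed
      finally show "real m * (if \<exists>i\<in>I. Q p c i then H (\<pi> (monomial_mat n p c)) else 0) =
        (\<Sum>i\<in>I. if Q p c i then H p else 0)" by (simp add: perm_part_colouring[OF p c])
    qed
    also have "\<dots> = (\<Sum>i\<in>I. \<Sum>p | p permutes I. \<Sum>c\<in>colourings. if Q p c i then H p else 0)"
      by (rule trans[OF sum.cong[OF refl sum.swap] sum.swap])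
    also have "\<dots> = (\<Sum>i\<in>I. N * (\<Sum>p\<in>full_cycles (I - {i}). H p))"
    proof (rule sum.cong[OF refl])
      fix i assume i: "i \<in> I"
      have "(\<Sum>p | p permutes I. \<Sum>c\<in>colourings. if Q p c i then H p else 0) =
        (\<Sum>p | p permutes I. if p \<in> full_cycles (I - {i}) then N * H p else 0)"
      proof (rule sum.cong[OF refl])
        fix p
        have "(\<Sum>c\<in>colourings. if Q p c i then H p else 0) = (if p \<in> full_cycles (I - {i}) then H p else 0) *
            (\<Sum>c\<in>colourings. if c i = e \<and> prod c (I - {i}) = 1 then 1 else 0)"
          unfolding sum_distrib_left Q_def by (intro sum.cong refl) auto
        thus "(\<Sum>c\<in>colourings. if Q p c i then H p else 0) = (if p \<in> full_cycles (I - {i}) then N * H p else 0)"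
          unfolding N[OF i] by simp
      qed
      also have "\<dots> = (\<Sum>p\<in>{p \<in> {p. p permutes I}. p \<in> full_cycles (I - {i})}. N * H p)"
        by (rule sum.inter_filter[symmetric]) (rule finite_permutations[OF I(1)])
      also have "{p \<in> {p. p permutes I}. p \<in> full_cycles (I - {i})} = full_cycles (I - {i})"
        using orbit_image_full_cycle_remove(2)[OF I(1) i ci(2)[OF i]] by blast
      finally show "(\<Sum>p | p permutes I. \<Sum>c\<in>colourings. if Q p c i then H p else 0) =
        N * (\<Sum>p\<in>full_cycles (I - {i}). H p)" by (simp add: sum_distrib_left)
    qed
    finally show ?thesis by (simp add: sum_distrib_left)
  qed
  have "(\<Sum>i\<in>I. \<Sum>p\<in>full_cycles (I - {i}). 1 :: real) = real n * fact (n - 2)"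
  proof -
    have "(\<Sum>p\<in>full_cycles (I - {i}). 1 :: real) = fact (n - 2)" if "i \<in> I" for i
      using card_full_cycles[of "I - {i}"] ci[OF that] by (simp add: numeral_2_eq_2)
    thus ?thesis using I(3) by simp
  qed
  hence c: "real m * real (card X) = N * (real n * fact (n - 2))" using F[of "\<lambda>_. 1"] by simp
  show "avg X (\<lambda>x. H (\<pi> x)) = (\<Sum>i\<in>I. \<Sum>p\<in>full_cycles (I - {i}). H p) / (real n * fact (n - 2))"
  proof -
    have "avg X (\<lambda>x. H (\<pi> x)) = (real m * (\<Sum>x\<in>X. H (\<pi> x))) / (real m * real (card X))"
      unfolding avg_def using m by simp
    thus ?thesis unfolding F c using N0 by simp
  qed
  have "N * (real n * fact (n - 2)) \<noteq> 0" using N0 n1 by simp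
  thus "X \<noteq> {}" using c by auto
  assume x: "x \<in> X"
  hence "x \<in> G" using X by blast
  then obtain p d where pd: "p permutes I" "d \<in> colourings" "x = monomial_mat n p d" by (rule refl_group_cases)
  then obtain i where i: "i \<in> I" "d i = e" "prod d (I - {i}) = 1" using x iff by blast
  have "prod d I = d i * prod d (I - {i})" by (rule prod.remove[OF I(1) i(1)])
  thus "\<delta> x = e" using \<delta>_monomial_mat[OF pd(1,2)] i unfolding pd(3) by simp
qed

text \<open>The full cycle on \<open>I - {i}\<close> has the fixed point \<open>j\<close> in its
  support, so the support is \<open>{j}\<close>.\<close>

lemma full_cycles_two_fixed_points:
  assumes n2: "n \<ge> 2" and ij: "i \<in> I" "j \<in> I" "i \<noteq> j"
    and p: "p \<in> full_cycles (I - {i})" "p \<in> full_cycles (I - {j})"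
  shows "n = 2" "p = id"
proof -
  have c: "card (I - {i}) = n - 1" using ij I by simp
  hence ne: "I - {i} \<noteq> {}" using n2 by force
  have "j \<in> I - {j} \<or> p j = j" using permutes_not_in[OF full_cycles_permutes[OF p(2)], of j] by blast
  hence pj: "orbit p j = {j}" by (simp add: orbit_eq_singleton_iff)
  have "orbit p ` (I - {i}) = {I - {i}}"
    using orbit_image_eq_singleton(1)[of "I - {i}" p] p(1) ne by (simp add: full_cycles_def)
  hence I': "I - {i} = {j}" using pj ij by blast
  thus "n = 2" using c n2 by simp
  have "p permutes {j}" using full_cycles_permutes[OF p(1)] I' by simp
  thus "p = id" by simp
qed

text \<open>If \<open>n = 2\<close> and \<open>e = 1\<close>, the only possible element is the identity, which has two fixed
  points.\<close>

lemma card_fixed_coloured: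
  assumes n2: "n \<ge> 2" and ex: "\<exists>i\<in>I. p \<in> full_cycles (I - {i}) \<and> c i = e \<and> prod c (I - {i}) = 1"
  shows "e \<noteq> 1 \<or> n > 2 \<Longrightarrow> card {i \<in> I. p \<in> full_cycles (I - {i}) \<and> c i = e \<and> prod c (I - {i}) = 1} = 1"
    "e = 1 \<Longrightarrow> n = 2 \<Longrightarrow> card {i \<in> I. p \<in> full_cycles (I - {i}) \<and> c i = e \<and> prod c (I - {i}) = 1} = 2"
proof -
  let ?P = "\<lambda>i. p \<in> full_cycles (I - {i}) \<and> c i = e \<and> prod c (I - {i}) = 1"
  obtain i where i: "i \<in> I" "?P i" using ex by blast
  {
    assume a: "e \<noteq> 1 \<or> n > 2"
    have "j = i" if j: "j \<in> I" "?P j" for j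
    proof (rule ccontr)
      assume ne: "j \<noteq> i"
      have n: "n = 2" using full_cycles_two_fixed_points(1)[OF n2 j(1) i(1) ne] i j by blast
      have "I - {i} = {j}" using n i(1) j(1) ne by auto
      hence "c j = 1" using i by simp
      thus False using j a n by simp
    qed
    hence "{i \<in> I. ?P i} = {i}" using i by blast
    thus "card {i \<in> I. ?P i} = 1" by simp
  }
  {
    assume a: "e = 1" "n = 2"
    define j where "j = 1 - i"
    have "i = 0 \<or> i = 1" using i(1) a(2) by auto
    hence I2: "I = {i, j}" "i \<noteq> j" using a(2) by (auto simp: j_def)
    have Ii: "I - {i} = {j}" "I - {j} = {i}" using I2 by auto
    have "p permutes {j}" using i full_cycles_permutes Ii by metis
    hence "p = id" by simp
    hence "p \<in> full_cycles (I - {j})" unfolding Ii full_cycles_singleton by simp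
    moreover have "c j = 1" using i(2) unfolding Ii by simp
    moreover have "prod c (I - {j}) = 1" using i(2) a(1) unfolding Ii by simp
    ultimately have Pj: "?P j" using a(1) by blast
    have "j \<in> I" unfolding I2(1) by blast
    hence "{i, j} \<subseteq> {k \<in> I. ?P k}" using i Pj by blast
    moreover have "{k \<in> I. ?P k} \<subseteq> I" by blast
    ultimately have "{k \<in> I. ?P k} = {i, j}" unfolding I2(1)[symmetric] by (rule subset_antisym[rotated])
    thus "card {i \<in> I. ?P i} = 2" using I2(2) by simp
  }
qed

end

section \<open>Expectations as iterated averages\<close>

lemma expectation_Pi_pmf_insert:
  fixes h :: "('a \<Rightarrow> 'b) \<Rightarrow> real"
  assumes "finite A" "x \<notin> A" "finite K" "K \<noteq> {}" "P x = pmf_of_set K" "\<And>u. u \<in> A \<Longrightarrow> finite (set_pmf (P u))"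
  shows "measure_pmf.expectation (Pi_pmf (insert x A) d P) h =
    avg K (\<lambda>y. measure_pmf.expectation (Pi_pmf A d P) (\<lambda>f. h (f(x := y))))"
proof -
  have fin: "finite (set_pmf (Pi_pmf A d P))"
    unfolding set_Pi_pmf[OF assms(1)] using assms(1,6) by (intro finite_PiE_dflt) auto
  have "Pi_pmf (insert x A) d P = pmf_of_set K \<bind> (\<lambda>y. map_pmf (\<lambda>f. f(x := y)) (Pi_pmf A d P))"
    unfolding Pi_pmf_insert'[OF assms(1,2)] assms(5) map_pmf_def ..
  hence "measure_pmf.expectation (Pi_pmf (insert x A) d P) h =
      (\<Sum>y\<in>K. measure_pmf.expectation (map_pmf (\<lambda>f. f(x := y)) (Pi_pmf A d P)) h /\<^sub>R real (card K))"
    using pmf_expectation_bind_pmf_of_set[OF assms(4,3), of "\<lambda>y. map_pmf (\<lambda>f. f(x := y)) (Pi_pmf A d P)" h] fin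
    by simp
  thus ?thesis by (simp add: avg_def sum_divide_distrib sum_distrib_left divide_inverse mult.commute)
qed

text \<open>The joint distribution is unrolled one coordinate at a time. After this the averages
  over the classes can be interchanged and evaluated separately.\<close>

lemma mu_seq_two:
  assumes "finite K" "K \<noteq> {}" "finite L" "L \<noteq> {}" "L \<subseteq> carrier_mat n n"
  shows "mu_seq r \<zeta> n [K, L] i j = avg K (\<lambda>k. avg L (\<lambda>l.
    real (card ((\<lambda>x. k * l * x) ` ell_class r \<zeta> n i \<inter> ell_class r \<zeta> n j))))"
proof -
  let ?P = "\<lambda>u. pmf_of_set ([K, L] ! u)"
  have s: "{0..<length [K, L]} = {0, 1}" "map k [0..<length [K, L]] = [k 0, k 1]" for k :: "nat \<Rightarrow> complex mat"
    by (auto simp: upt_rec)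
  \<comment> \<open>The fold ends in the unit matrix, and dropping it requires the last factor to
    have n columns.\<close>
  have one: "l * 1\<^sub>m n = l" if "l \<in> L" for l using assms(5) that by auto
  have e0: "measure_pmf.expectation (Pi_pmf {0, 1} (1\<^sub>m n) ?P) h =
      avg K (\<lambda>y. measure_pmf.expectation (Pi_pmf {1} (1\<^sub>m n) ?P) (\<lambda>f. h (f(0 := y))))" for h
    by (rule expectation_Pi_pmf_insert) (use assms in \<open>auto simp: set_pmf_of_set[OF assms(4,3)]\<close>)
  have e1: "measure_pmf.expectation (Pi_pmf {1} (1\<^sub>m n) ?P) h =
      avg L (\<lambda>y. measure_pmf.expectation (Pi_pmf {} (1\<^sub>m n) ?P) (\<lambda>f. h (f(1 := y))))" for h
    by (rule expectation_Pi_pmf_insert) (use assms in \<open>auto simp: set_pmf_of_set[OF assms(4,3)]\<close>)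
  show ?thesis
    unfolding mu_seq_def s e0 e1 by (intro avg_cong) (simp add: one)
qed

lemma mu_seq_four:
  assumes "finite K" "K \<noteq> {}" "finite L" "L \<noteq> {}" "finite M" "M \<noteq> {}" "finite N" "N \<noteq> {}"
    "N \<subseteq> carrier_mat n n"
  shows "mu_seq r \<zeta> n [K, L, M, N] i j = avg K (\<lambda>k. avg L (\<lambda>l. avg M (\<lambda>m. avg N (\<lambda>x.
    real (card ((\<lambda>y. k * (l * (m * x)) * y) ` ell_class r \<zeta> n i \<inter> ell_class r \<zeta> n j))))))"
proof -
  let ?P = "\<lambda>u. pmf_of_set ([K, L, M, N] ! u)"
  have s: "{0..<length [K, L, M, N]} = {0, 1, 2, 3}"
    "map k [0..<length [K, L, M, N]] = [k 0, k 1, k 2, k 3]" for k :: "nat \<Rightarrow> complex mat"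
    by (auto simp: upt_rec numeral_eq_Suc)
  have one: "l * 1\<^sub>m n = l" if "l \<in> N" for l using assms(9) that by auto
  have e0: "measure_pmf.expectation (Pi_pmf {0, 1, 2, 3} (1\<^sub>m n) ?P) h =
      avg K (\<lambda>y. measure_pmf.expectation (Pi_pmf {1, 2, 3} (1\<^sub>m n) ?P) (\<lambda>f. h (f(0 := y))))" for h
    by (rule expectation_Pi_pmf_insert) (use assms in \<open>auto simp: set_pmf_of_set[OF assms(4,3)] set_pmf_of_set[OF assms(6,5)]
      set_pmf_of_set[OF assms(8,7)]\<close>)
  have e1: "measure_pmf.expectation (Pi_pmf {1, 2, 3} (1\<^sub>m n) ?P) h =
      avg L (\<lambda>y. measure_pmf.expectation (Pi_pmf {2, 3} (1\<^sub>m n) ?P) (\<lambda>f. h (f(1 := y))))" for h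
    by (rule expectation_Pi_pmf_insert) (use assms in \<open>auto simp: set_pmf_of_set[OF assms(4,3)] set_pmf_of_set[OF assms(6,5)]
      set_pmf_of_set[OF assms(8,7)]\<close>)
  have e2: "measure_pmf.expectation (Pi_pmf {2, 3} (1\<^sub>m n) ?P) h =
      avg M (\<lambda>y. measure_pmf.expectation (Pi_pmf {3} (1\<^sub>m n) ?P) (\<lambda>f. h (f(2 := y))))" for h
    by (rule expectation_Pi_pmf_insert) (use assms in \<open>auto simp: set_pmf_of_set[OF assms(4,3)] set_pmf_of_set[OF assms(6,5)]
      set_pmf_of_set[OF assms(8,7)]\<close>)
  have e3: "measure_pmf.expectation (Pi_pmf {3} (1\<^sub>m n) ?P) h =
      avg N (\<lambda>y. measure_pmf.expectation (Pi_pmf {} (1\<^sub>m n) ?P) (\<lambda>f. h (f(3 := y))))" for h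
    by (rule expectation_Pi_pmf_insert) (use assms in \<open>auto simp: set_pmf_of_set[OF assms(4,3)] set_pmf_of_set[OF assms(6,5)]
      set_pmf_of_set[OF assms(8,7)]\<close>)
  show ?thesis
    unfolding mu_seq_def s e0 e1 e2 e3 by (intro avg_cong) (simp add: one)
qed

section \<open>Averaging over colours\<close>

context complex_reflection
begin

text \<open>The formula is a Fourier expansion on \<open>Z\<close>: the weight 1 + ra [colour 1] of
  a cycle has transform a + 1 at the trivial character and \<open>a\<close> at all others, and the
  nontrivial characters sum up to r [e = 1] - 1 at \<open>e\<close>.\<close>

lemma sum_colourings_ell:
  assumes p: "p permutes I" and e: "e \<in> Z"
  shows "real r * (\<Sum>c | c \<in> colourings \<and> prod c I = e. (1 + real r * a) ^ ell r \<zeta> n (monomial_mat n p c)) =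
    real r ^ n * ((a + 1) ^ num_cycles I p - a ^ num_cycles I p + (if e = 1 then real r * a ^ num_cycles I p else 0))"
proof -
  have U: "\<Union>(orbit p ` I) = I" by (rule Union_orbits[OF I(1) p])
  have "real (card Z) * (\<Sum>c | c \<in> PiE (\<Union>(orbit p ` I)) (\<lambda>_. Z) \<and> prod c (\<Union>(orbit p ` I)) = e.
      (1 + real (card Z) * a) ^ card {C \<in> orbit p ` I. prod c C = 1}) =
    real (card Z) ^ card (\<Union>(orbit p ` I)) * ((a + 1) ^ card (orbit p ` I) - a ^ card (orbit p ` I)
      + (if e = 1 then real (card Z) * a ^ card (orbit p ` I) else 0))"
  proof (rule sum_weighted_colourings[OF card_Z(2) Z(3) Z(2) Z(1)])
    fix C assume "C \<in> orbit p ` I"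
    then obtain x where x: "C = orbit p x" by (rule imageE)
    show "finite C" unfolding x by (rule finite_orbit_permutes[OF I(1) p])
    show "C \<noteq> {}" unfolding x by (rule orbit_nonempty)
    fix D assume "D \<in> orbit p ` I" and ne: "C \<noteq> D"
    then obtain y where y: "D = orbit p y" by blast
    have "y \<notin> orbit p x" using orbit_eq_of_mem[OF I(1) p] ne x y by metis
    thus "C \<inter> D = {}" unfolding x y by (rule orbit_disjoint[OF I(1) p])
  qed (use e I in auto)
  moreover have "(\<Sum>c | c \<in> colourings \<and> prod c I = e. (1 + real r * a) ^ ell r \<zeta> n (monomial_mat n p c)) =
      (\<Sum>c | c \<in> colourings \<and> prod c I = e. (1 + real r * a) ^ card {C \<in> orbit p ` I. prod c C = 1})"
    by (intro sum.cong refl) (simp add: ell_monomial_mat[OF p])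
  ultimately show ?thesis
    unfolding U card_Z(1) I(3) colourings_def[symmetric] num_cycles_def[symmetric] by (simp only:)
qed

text \<open>The contribution of a fixed product \<open>g\<close> of class elements to the form at (1
  + ra)^ell and (1 + rb)^ell, before the expectation and the factor 1/|G|; see
  \<open>sum_ell_transition\<close>.\<close>

definition corr :: "nat \<Rightarrow> nat \<Rightarrow> complex mat \<Rightarrow> real" where
  "corr a b g = (\<Sum>x\<in>G. (1 + real r * real a) ^ ell r \<zeta> n x * (1 + real r * real b) ^ ell r \<zeta> n (g * x))"

text \<open>The first summand is the share of the trivial character of \<open>Z\<close>. The factor
  of the second, r - 1 or -1, is the sum of the nontrivial characters at the total colour
  \<open>e\<close>.\<close>

definition \<Theta> :: "nat \<Rightarrow> nat \<Rightarrow> (nat \<Rightarrow> nat) \<Rightarrow> complex \<Rightarrow> real" where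
  "\<Theta> a b p e = cycle_pairing I (Suc a) (Suc b) p + (if e = 1 then real r - 1 else -1) * cycle_pairing I a b p"

text \<open>Multiplying by a matrix with fixed permutation \<open>q\<close> and colouring
  \<open>u\<close> permutes and rescales the colours invertibly, and multiplies their total product
  by that of \<open>u\<close>.\<close>

lemma sum_mult_colouring:
  assumes q: "q permutes I" and u: "u \<in> colourings"
  shows "(\<Sum>w | w \<in> colourings \<and> prod w I = e. H (\<lambda>j\<in>I. w (q j) * u j)) =
    (\<Sum>v | v \<in> colourings \<and> prod v I = e * prod u I. H v)"
proof (rule sum.reindex_bij_witness[of _ "\<lambda>v. \<lambda>j\<in>I. v (inv_into UNIV q j) / u (inv_into UNIV q j)" "\<lambda>w. \<lambda>j\<in>I. w (q j) * u j"])
  let ?q' = "inv_into UNIV q"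
  have q': "?q' permutes I" by (rule permutes_inv[OF q])
  have qq: "?q' (q j) = j" "q (?q' j) = j" for j using permutes_inverses[OF q] by auto
  have lt: "q j < n" "?q' j < n" if "j < n" for j using permutes_lt[OF q that] permutes_lt[OF q' that] by auto
  have uz: "u j \<noteq> 0" if "j < n" for j using colouring(2)[OF u that] .
  fix w assume w: "w \<in> {w. w \<in> colourings \<and> prod w I = e}"
  hence wc: "w \<in> colourings" by simp
  show "(\<lambda>j\<in>I. (\<lambda>j\<in>I. w (q j) * u j) (?q' j) / u (?q' j)) = w"
    by (rule extensionalityI[OF restrict_extensional colouring(3)[OF wc]]) (simp add: lt uz qq)
  show "(\<lambda>j\<in>I. w (q j) * u j) \<in> {v. v \<in> colourings \<and> prod v I = e * prod u I}"
    using mult_colouring[OF q wc u] w by simp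
next
  let ?q' = "inv_into UNIV q"
  have q': "?q' permutes I" by (rule permutes_inv[OF q])
  have qq: "?q' (q j) = j" "q (?q' j) = j" for j using permutes_inverses[OF q] by auto
  have lt: "q j < n" "?q' j < n" if "j < n" for j using permutes_lt[OF q that] permutes_lt[OF q' that] by auto
  have uz: "u j \<noteq> 0" if "j < n" for j using colouring(2)[OF u that] .
  fix v assume v: "v \<in> {v. v \<in> colourings \<and> prod v I = e * prod u I}"
  hence vc: "v \<in> colourings" by simp
  define w where "w = (\<lambda>j\<in>I. v (?q' j) / u (?q' j))"
  have wc: "w \<in> colourings"
    unfolding w_def colourings_def restrict_PiE_iff using colouring(1)[OF vc] colouring(1)[OF u] lt Z(3) by auto
  show e: "(\<lambda>j\<in>I. w (q j) * u j) = v"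
    by (rule extensionalityI[OF restrict_extensional colouring(3)[OF vc]]) (simp add: w_def lt uz qq)
  have "prod w I * prod u I = e * prod u I"
    using mult_colouring(2)[OF q wc u] v unfolding e by simp
  moreover have "prod u I \<noteq> 0" using prod_colouring[OF u subset_refl] Z(2) by metis
  ultimately show "w \<in> {w. w \<in> colourings \<and> prod w I = e}" using wc by simp
qed simp

text \<open>Fix the permutation part \<open>q\<close> of x. When \<open>w\<close> runs through its
  fibre, the colouring of the product runs uniformly through those with total colour
  \<open>e\<close> times that of x, whatever the individual colours of x are. Only the total colour
  z of x links the two factors, so the sum is that of U(z) V(ez) over \<open>Z\<close>, to which
  \<open>sum_colourings_ell\<close> applies twice. The factor r^2 clears the two
  denominators.\<close>

lemma sum_corr_colourings:
  assumes p: "p permutes I" and e: "e \<in> Z"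
  shows "real r ^ 2 * (\<Sum>w | w \<in> colourings \<and> prod w I = e. corr a b (monomial_mat n p w)) =
    real r ^ (2 * n + 1) * \<Theta> a b p e"
proof -
  define s where "s = 1 + real r * real a"
  define t where "t = 1 + real r * real b"
  let ?l = "\<lambda>q c. ell r \<zeta> n (monomial_mat n q c)"
  let ?col = "\<lambda>e. {w. w \<in> colourings \<and> prod w I = e}"
  define U where "U = (\<lambda>q z. \<Sum>u\<in>?col z. s ^ ?l q u)"
  define V where "V = (\<lambda>q z. \<Sum>v\<in>?col z. t ^ ?l q v)"
  have rp: "real r ^ (2 * n + 1) = real r * (real r ^ n * real r ^ n)"
    by (simp add: power_add[symmetric] mult_2)
  have per: "real r ^ 2 * (\<Sum>u\<in>colourings. s ^ ?l q u * V (p \<circ> q) (e * prod u I)) =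
      real r ^ (2 * n + 1) * ((real a + 1) ^ num_cycles I q * (real b + 1) ^ num_cycles I (p \<circ> q) +
        (if e = 1 then real r - 1 else -1) * (real a ^ num_cycles I q * real b ^ num_cycles I (p \<circ> q)))"
    if q: "q permutes I" for q
  proof -
    have pq: "p \<circ> q permutes I" by (rule permutes_compose[OF q p])
    define \<alpha> where "\<alpha> = real a ^ num_cycles I q"
    define x where "x = (real a + 1) ^ num_cycles I q - \<alpha>"
    define \<beta> where "\<beta> = real b ^ num_cycles I (p \<circ> q)"
    define y where "y = (real b + 1) ^ num_cycles I (p \<circ> q) - \<beta>"
    have U: "real r * U q z = real r ^ n * (x + (if z = 1 then real r * \<alpha> else 0))" if "z \<in> Z" for z
      unfolding U_def s_def x_def \<alpha>_def by (rule sum_colourings_ell[OF q that])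
    have V: "real r * V (p \<circ> q) z = real r ^ n * (y + (if z = 1 then real r * \<beta> else 0))" if "z \<in> Z" for z
      unfolding V_def t_def y_def \<beta>_def by (rule sum_colourings_ell[OF pq that])
    have "(\<Sum>u\<in>colourings. s ^ ?l q u * V (p \<circ> q) (e * prod u I)) =
        (\<Sum>z\<in>Z. \<Sum>u\<in>?col z. s ^ ?l q u * V (p \<circ> q) (e * prod u I))"
      by (rule sum.group[OF finite_colourings card_Z(2), symmetric]) (auto intro: prod_colouring)
    also have "\<dots> = (\<Sum>z\<in>Z. U q z * V (p \<circ> q) (e * z))"
      unfolding U_def sum_distrib_right by (intro sum.cong refl) auto
    finally have "real r ^ 2 * (\<Sum>u\<in>colourings. s ^ ?l q u * V (p \<circ> q) (e * prod u I)) =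
        (\<Sum>z\<in>Z. (real r * U q z) * (real r * V (p \<circ> q) (e * z)))"
      by (simp add: sum_distrib_left power2_eq_square ac_simps)
    also have "\<dots> = (\<Sum>z\<in>Z. (real r ^ n * (x + (if z = 1 then real r * \<alpha> else 0))) *
        (real r ^ n * (y + (if e * z = 1 then real r * \<beta> else 0))))"
      by (intro sum.cong refl arg_cong2[of _ _ _ _ "(*)"] U V Z(4) e)
    \<comment> \<open>The two point masses sit at z = 1 and z = 1/e. Their product contributes only
      if these points coincide, that is, for e = 1.\<close>
    also have "\<dots> = (\<Sum>z\<in>Z. real r ^ n * real r ^ n * (x * y + (if z = 1 / e then real r * x * \<beta> else 0)
        + (if z = 1 then real r * \<alpha> * y + (if e = 1 then real r * real r * \<alpha> * \<beta> else 0) else 0)))"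
    proof (rule sum.cong[OF refl])
      fix z
      have "e \<noteq> 0" using e Z(2) by metis
      hence "e * z = 1 \<longleftrightarrow> z = 1 / e" by (auto simp: field_simps)
      thus "(real r ^ n * (x + (if z = 1 then real r * \<alpha> else 0))) *
          (real r ^ n * (y + (if e * z = 1 then real r * \<beta> else 0))) =
        real r ^ n * real r ^ n * (x * y + (if z = 1 / e then real r * x * \<beta> else 0)
        + (if z = 1 then real r * \<alpha> * y + (if e = 1 then real r * real r * \<alpha> * \<beta> else 0) else 0))"
        by (auto simp: algebra_simps)
    qed
    also have "\<dots> = real r ^ n * real r ^ n * (real r * (x * y) + real r * x * \<beta> +
        (real r * \<alpha> * y + (if e = 1 then real r * real r * \<alpha> * \<beta> else 0)))"
      unfolding sum_distrib_left[symmetric]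
      using card_Z Z(1) Z(3)[OF Z(1) e] by (simp add: sum.distrib)
    also have "\<dots> = real r ^ (2 * n + 1) * ((x + \<alpha>) * (y + \<beta>) + (if e = 1 then real r - 1 else -1) * (\<alpha> * \<beta>))"
      unfolding rp by (simp add: algebra_simps)
    finally show ?thesis unfolding x_def y_def \<alpha>_def \<beta>_def by simp
  qed
  have "(\<Sum>w\<in>?col e. corr a b (monomial_mat n p w)) =
    (\<Sum>w\<in>?col e. \<Sum>q | q permutes I. \<Sum>u\<in>colourings. s ^ ?l q u * t ^ ?l (p \<circ> q) (\<lambda>j\<in>I. w (q j) * u j))"
    unfolding corr_def sum_refl_group s_def t_def
    by (intro sum.cong refl) (simp add: monomial_mat_mult)
  also have "\<dots> = (\<Sum>q | q permutes I. \<Sum>u\<in>colourings. \<Sum>w\<in>?col e. s ^ ?l q u * t ^ ?l (p \<circ> q) (\<lambda>j\<in>I. w (q j) * u j))"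
    by (rule trans[OF sum.swap sum.cong[OF refl sum.swap]])
  also have "\<dots> = (\<Sum>q | q permutes I. \<Sum>u\<in>colourings. s ^ ?l q u * V (p \<circ> q) (e * prod u I))"
  proof (rule sum.cong[OF refl], rule sum.cong[OF refl])
    fix q u assume "q \<in> {q. q permutes I}" and u: "u \<in> colourings"
    hence q: "q permutes I" by simp
    show "(\<Sum>w\<in>?col e. s ^ ?l q u * t ^ ?l (p \<circ> q) (\<lambda>j\<in>I. w (q j) * u j)) = s ^ ?l q u * V (p \<circ> q) (e * prod u I)"
      unfolding V_def sum_mult_colouring[OF q u, of "\<lambda>c. t ^ ?l (p \<circ> q) c", symmetric] sum_distrib_left ..
  qed
  finally have "real r ^ 2 * (\<Sum>w\<in>?col e. corr a b (monomial_mat n p w)) =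
      (\<Sum>q | q permutes I. real r ^ 2 * (\<Sum>u\<in>colourings. s ^ ?l q u * V (p \<circ> q) (e * prod u I)))"
    by (simp only: sum_distrib_left)
  also have "\<dots> = (\<Sum>q | q permutes I. real r ^ (2 * n + 1) * ((real a + 1) ^ num_cycles I q * (real b + 1) ^ num_cycles I (p \<circ> q) +
        (if e = 1 then real r - 1 else -1) * (real a ^ num_cycles I q * real b ^ num_cycles I (p \<circ> q))))"
    by (rule sum.cong[OF refl]) (simp only: per mem_Collect_eq)
  also have "\<dots> = real r ^ (2 * n + 1) * \<Theta> a b p e"
    unfolding \<Theta>_def cycle_pairing_def sum_distrib_left[symmetric] sum.distrib by (simp add: add.commute[of 1])
  finally show ?thesis .
qed

text \<open>A random element of this class is a uniform full cycle with uniform colours of product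
  1. Its product with \<open>y\<close> has uniform colours of product \<open>\<delta> y\<close>,
  which is the average computed in \<open>sum_corr_colourings\<close>. From here on the matrix
  \<open>y\<close> matters only through \<open>\<pi> y\<close> and
  \<open>\<delta> y\<close>.\<close>

lemma avg_corr:
  assumes X: "X \<subseteq> G"
    and iff: "\<And>p c. p permutes I \<Longrightarrow> c \<in> colourings \<Longrightarrow> monomial_mat n p c \<in> X \<longleftrightarrow> p \<in> full_cycles I \<and> prod c I = 1"
    and y: "y \<in> G"
  shows "avg X (\<lambda>k. corr a b (k * y)) =
    real r ^ n / fact (n - 1) * (\<Sum>p\<in>full_cycles I. \<Theta> a b (p \<circ> \<pi> y) (\<delta> y))"
proof -
  obtain q d where yd: "q permutes I" "d \<in> colourings" "y = monomial_mat n q d" by (rule refl_group_cases[OF y])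
  have pd: "\<pi> y = q" "\<delta> y = prod d I"
    unfolding yd(3) by (simp_all add: perm_part_colouring \<delta>_monomial_mat yd)
  have cX: "real r * real (card X) = fact (n - 1) * real r ^ n"
    by (rule avg_full_cycle_class(4)[OF X iff Z(1)])
  have "(\<Sum>k\<in>X. corr a b (k * y)) = (\<Sum>p | p permutes I. \<Sum>c\<in>colourings.
      if p \<in> full_cycles I \<and> prod c I = 1 then corr a b (monomial_mat n p c * y) else 0)"
    by (rule sum_pairs[OF X iff])
  also have "\<dots> = (\<Sum>p | p permutes I. if p \<in> full_cycles I then
      (\<Sum>w | w \<in> colourings \<and> prod w I = prod d I. corr a b (monomial_mat n (p \<circ> q) w)) else 0)"
  proof (rule sum.cong[OF refl])
    fix p assume "p \<in> {p. p permutes I}"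
    have "(\<Sum>c\<in>colourings. if prod c I = 1 then corr a b (monomial_mat n p c * y) else 0) =
        (\<Sum>c | c \<in> colourings \<and> prod c I = 1. corr a b (monomial_mat n (p \<circ> q) (\<lambda>j\<in>I. c (q j) * d j)))"
      unfolding yd(3) monomial_mat_mult[OF yd(1)]
      using sum.inter_filter[OF finite_colourings] by (simp add: sum.inter_filter[OF finite_colourings, symmetric])
    also have "\<dots> = (\<Sum>w | w \<in> colourings \<and> prod w I = prod d I. corr a b (monomial_mat n (p \<circ> q) w))"
      using sum_mult_colouring[OF yd(1,2), of "\<lambda>w. corr a b (monomial_mat n (p \<circ> q) w)" 1] by simp
    finally show "(\<Sum>c\<in>colourings. if p \<in> full_cycles I \<and> prod c I = 1 then corr a b (monomial_mat n p c * y) else 0) =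
      (if p \<in> full_cycles I then (\<Sum>w | w \<in> colourings \<and> prod w I = prod d I. corr a b (monomial_mat n (p \<circ> q) w)) else 0)"
      by simp
  qed
  also have "\<dots> = (\<Sum>p\<in>{p \<in> {p. p permutes I}. p \<in> full_cycles I}.
      \<Sum>w | w \<in> colourings \<and> prod w I = prod d I. corr a b (monomial_mat n (p \<circ> q) w))"
    by (rule sum.inter_filter[symmetric]) (rule finite_permutations[OF I(1)])
  also have "{p \<in> {p. p permutes I}. p \<in> full_cycles I} = full_cycles I"
    by (auto simp: full_cycles_permutes)
  finally have "real r ^ 2 * (\<Sum>k\<in>X. corr a b (k * y)) =
      (\<Sum>p\<in>full_cycles I. real r ^ 2 * (\<Sum>w | w \<in> colourings \<and> prod w I = prod d I. corr a b (monomial_mat n (p \<circ> q) w)))"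
    by (simp only: sum_distrib_left)
  also have "\<dots> = (\<Sum>p\<in>full_cycles I. real r ^ (2 * n + 1) * \<Theta> a b (p \<circ> q) (prod d I))"
    by (intro sum.cong refl sum_corr_colourings permutes_compose[OF yd(1)] full_cycles_permutes prod_colouring[OF yd(2)]) auto
  finally have S: "real r ^ 2 * (\<Sum>k\<in>X. corr a b (k * y)) =
      real r ^ (2 * n + 1) * (\<Sum>p\<in>full_cycles I. \<Theta> a b (p \<circ> q) (prod d I))" by (simp only: sum_distrib_left)
  have r0: "real r \<noteq> 0" using r2 by simp
  have "avg X (\<lambda>k. corr a b (k * y)) = (real r ^ 2 * (\<Sum>k\<in>X. corr a b (k * y))) / (real r * (real r * real (card X)))"
    using r0 by (simp add: avg_def power2_eq_square)
  also have "\<dots> = real r ^ n / fact (n - 1) * (\<Sum>p\<in>full_cycles I. \<Theta> a b (p \<circ> q) (prod d I))"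
  proof -
    have "real r ^ (2 * n + 1) = real r * (real r ^ n * real r ^ n)"
      by (simp add: power_add[symmetric] mult_2)
    thus ?thesis unfolding S cX using r0 by (simp add: field_simps)
  qed
  finally show ?thesis unfolding pd .
qed

section \<open>From class counts to sums over the group\<close>

lemma refl_group_mult_cancel:
  assumes "g \<in> G" "x \<in> G" "y \<in> G" "g * x = g * y"
  shows "x = y"
proof -
  obtain p c where g: "p permutes I" "c \<in> colourings" "g = monomial_mat n p c" by (rule refl_group_cases[OF assms(1)])
  obtain q d where x: "q permutes I" "d \<in> colourings" "x = monomial_mat n q d" by (rule refl_group_cases[OF assms(2)])
  obtain s f where y: "s permutes I" "f \<in> colourings" "y = monomial_mat n s f" by (rule refl_group_cases[OF assms(3)])
  note mx = mult_colouring(1)[OF x(1) g(2) x(2)] and my = mult_colouring(1)[OF y(1) g(2) y(2)]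
  have eq: "monomial_mat n (p \<circ> q) (\<lambda>j\<in>I. c (q j) * d j) = monomial_mat n (p \<circ> s) (\<lambda>j\<in>I. c (s j) * f j)"
    using assms(4) unfolding g(3) x(3) y(3) monomial_mat_mult[OF x(1)] monomial_mat_mult[OF y(1)] .
  have "p \<circ> q = p \<circ> s \<and> (\<lambda>j\<in>I. c (q j) * d j) = (\<lambda>j\<in>I. c (s j) * f j)"
    by (rule monomial_mat_inject[OF _ _ _ _ _ _ eq])
       (fact permutes_compose[OF x(1) g(1)] permutes_compose[OF y(1) g(1)] colouring(2)[OF mx]
         colouring(2)[OF my] colouring(3)[OF mx] colouring(3)[OF my])+
  hence e: "p \<circ> q = p \<circ> s" "(\<lambda>j\<in>I. c (q j) * d j) = (\<lambda>j\<in>I. c (s j) * f j)" by blast+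
  have "q j = s j" for j using fun_cong[OF e(1), of j] permutes_inj[OF g(1)] by (simp add: inj_eq)
  hence qs: "q = s" by blast
  have "d = f"
  proof (rule extensionalityI[OF colouring(3)[OF x(2)] colouring(3)[OF y(2)]])
    fix j assume j: "j \<in> I"
    have "c (q j) \<noteq> 0" using colouring(2)[OF g(2)] permutes_lt[OF x(1)] j by simp
    thus "d j = f j" using fun_cong[OF e(2), of j] j qs by simp
  qed
  thus ?thesis using qs x y by simp
qed

text \<open>Left multiplication by \<open>g\<close> is injective, so the cardinality counts the x in
  the i-th class whose image lies in the j-th; each x of the group occurs for exactly one pair (i,
  j).\<close>

lemma sum_ell_transition:
  fixes s t :: real
  assumes g: "g \<in> G"
  shows "(\<Sum>i=0..n. \<Sum>j=0..n. s ^ i * t ^ j *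
      real (card ((\<lambda>x. g * x) ` ell_class r \<zeta> n i \<inter> ell_class r \<zeta> n j))) =
    (\<Sum>x\<in>G. s ^ ell r \<zeta> n x * t ^ ell r \<zeta> n (g * x))"
proof -
  have c: "real (card ((\<lambda>x. g * x) ` ell_class r \<zeta> n i \<inter> ell_class r \<zeta> n j)) =
      (\<Sum>x\<in>G. if ell r \<zeta> n x = i \<and> ell r \<zeta> n (g * x) = j then 1 else 0)" for i j
  proof -
    have "(\<lambda>x. g * x) ` ell_class r \<zeta> n i \<inter> ell_class r \<zeta> n j =
        (\<lambda>x. g * x) ` {x \<in> G. ell r \<zeta> n x = i \<and> ell r \<zeta> n (g * x) = j}"
      using refl_group_mult[OF g] by (auto simp: ell_class_def)
    moreover have "inj_on (\<lambda>x. g * x) {x \<in> G. ell r \<zeta> n x = i \<and> ell r \<zeta> n (g * x) = j}"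
      using refl_group_mult_cancel[OF g] by (auto intro!: inj_onI)
    ultimately have "card ((\<lambda>x. g * x) ` ell_class r \<zeta> n i \<inter> ell_class r \<zeta> n j) =
        card {x \<in> G. ell r \<zeta> n x = i \<and> ell r \<zeta> n (g * x) = j}" by (simp add: card_image)
    thus ?thesis
      using sum.inter_filter[OF finite_refl_group, of "\<lambda>_. 1 :: real" "\<lambda>x. ell r \<zeta> n x = i \<and> ell r \<zeta> n (g * x) = j"]
      by simp
  qed
  have "(\<Sum>i=0..n. \<Sum>j=0..n. s ^ i * t ^ j * real (card ((\<lambda>x. g * x) ` ell_class r \<zeta> n i \<inter> ell_class r \<zeta> n j))) =
    (\<Sum>x\<in>G. \<Sum>i=0..n. \<Sum>j=0..n. s ^ i * t ^ j * (if ell r \<zeta> n x = i \<and> ell r \<zeta> n (g * x) = j then 1 else 0))"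
    unfolding c sum_distrib_left by (rule trans[OF sum.cong[OF refl sum.swap] sum.swap])
  also have "\<dots> = (\<Sum>x\<in>G. s ^ ell r \<zeta> n x * t ^ ell r \<zeta> n (g * x))"
  proof (rule sum.cong[OF refl])
    fix x assume x: "x \<in> G"
    have l: "ell r \<zeta> n x \<in> {0..n}" "ell r \<zeta> n (g * x) \<in> {0..n}"
      using ell_le[OF x] ell_le[OF refl_group_mult[OF g x]] by simp_all
    have "(\<Sum>i=0..n. \<Sum>j=0..n. s ^ i * t ^ j * (if ell r \<zeta> n x = i \<and> ell r \<zeta> n (g * x) = j then 1 else 0)) =
      (\<Sum>i=0..n. if ell r \<zeta> n x = i then s ^ i * (\<Sum>j=0..n. if ell r \<zeta> n (g * x) = j then t ^ j else 0) else 0)"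
      unfolding sum_distrib_left by (rule sum.cong[OF refl]) (auto intro!: sum.cong)
    also have "\<dots> = s ^ ell r \<zeta> n x * t ^ ell r \<zeta> n (g * x)" using l by simp
    finally show "(\<Sum>i=0..n. \<Sum>j=0..n. s ^ i * t ^ j * (if ell r \<zeta> n x = i \<and> ell r \<zeta> n (g * x) = j then 1 else 0)) =
      s ^ ell r \<zeta> n x * t ^ ell r \<zeta> n (g * x)" .
  qed
  finally show ?thesis .
qed

section \<open>The four classes that occur in the form\<close>

abbreviation class_A :: "complex mat set" where
  "class_A \<equiv> conj_class r \<zeta> n ({#n#} # replicate (r - 1) {#})"
abbreviation class_B :: "complex mat set" where
  "class_B \<equiv> conj_class r \<zeta> n ({#} # {#n#} # replicate (r - 2) {#})"
abbreviation class_C :: "complex mat set" where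
  "class_C \<equiv> conj_class r \<zeta> n ({#n - 1#} # {#1#} # replicate (r - 2) {#})"
abbreviation class_D :: "complex mat set" where
  "class_D \<equiv> conj_class r \<zeta> n ({#n - 1, 1#} # replicate (r - 1) {#})"

lemma finite_conj_class: "finite (conj_class r \<zeta> n lam)"
  by (rule finite_subset[OF conj_class_subset finite_refl_group])

lemma class_A_iff:
  assumes "p permutes I" "c \<in> colourings"
  shows "monomial_mat n p c \<in> class_A \<longleftrightarrow> p \<in> full_cycles I \<and> prod c I = 1"
  using conj_class_full_cycle[OF _ _ _ assms, of "{#n#} # replicate (r - 1) {#}" 0] r2
  by (auto simp: nth_Cons split: nat.splits)

lemma class_B_iff:
  assumes "p permutes I" "c \<in> colourings"
  shows "monomial_mat n p c \<in> class_B \<longleftrightarrow> p \<in> full_cycles I \<and> prod c I = \<zeta>"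
  using conj_class_full_cycle[OF _ _ _ assms, of "{#} # {#n#} # replicate (r - 2) {#}" 1] r2
  by (auto simp: nth_Cons split: nat.splits)

lemma class_C_iff:
  assumes "n \<ge> 2" "p permutes I" "c \<in> colourings"
  shows "monomial_mat n p c \<in> class_C \<longleftrightarrow>
    (\<exists>i\<in>I. p \<in> full_cycles (I - {i}) \<and> c i = \<zeta> \<and> prod c (I - {i}) = 1)"
  by (rule conj_class_subfull_cycle_coloured[OF assms(1) _ _ assms(2,3)])
     (use r2 in \<open>auto simp: nth_Cons split: nat.splits\<close>)

lemma class_D_iff:
  assumes "n \<ge> 2" "p permutes I" "c \<in> colourings"
  shows "monomial_mat n p c \<in> class_D \<longleftrightarrow>
    (\<exists>i\<in>I. p \<in> full_cycles (I - {i}) \<and> c i = 1 \<and> prod c (I - {i}) = 1)"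
  by (rule conj_class_subfull_cycle_uncoloured[OF assms(1) _ _ assms(2,3)])
     (use r2 in \<open>auto simp: nth_Cons split: nat.splits\<close>)

lemmas avg_class_A = avg_full_cycle_class[OF conj_class_subset class_A_iff Z(1)]
lemmas avg_class_B = avg_full_cycle_class[OF conj_class_subset class_B_iff Z(5)]

lemma avg_class_C:
  assumes n2: "n \<ge> 2"
  shows "avg class_C (\<lambda>x. H (\<pi> x)) = (\<Sum>i\<in>I. \<Sum>p\<in>full_cycles (I - {i}). H p) / (real n * fact (n - 2))"
    "class_C \<noteq> {}" "x \<in> class_C \<Longrightarrow> \<delta> x = \<zeta>"
proof -
  have m: "card {i \<in> I. p \<in> full_cycles (I - {i}) \<and> c i = \<zeta> \<and> prod c (I - {i}) = 1} = 1"
    if "p permutes I" "c \<in> colourings" "monomial_mat n p c \<in> class_C" for p c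
    using card_fixed_coloured(1)[OF n2] class_C_iff[OF n2 that(1,2)] that(3) Z(6) by blast
  have one: "(0 :: nat) < 1" by simp
  show "avg class_C (\<lambda>x. H (\<pi> x)) = (\<Sum>i\<in>I. \<Sum>p\<in>full_cycles (I - {i}). H p) / (real n * fact (n - 2))"
    by (rule avg_subfull_cycle_class(1)[where m = 1 and e = \<zeta>])
       (fact n2 conj_class_subset Z(5) one class_C_iff[OF n2] m)+
  show "class_C \<noteq> {}"
    by (rule avg_subfull_cycle_class(2)[where m = 1 and e = \<zeta>])
       (fact n2 conj_class_subset Z(5) one class_C_iff[OF n2] m)+
  show "\<delta> x = \<zeta>" if x: "x \<in> class_C"
    by (rule avg_subfull_cycle_class(3)[where m = 1 and e = \<zeta> and X = class_C])
       (fact n2 conj_class_subset Z(5) one class_C_iff[OF n2] m x)+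
qed

lemma avg_class_D:
  assumes n2: "n \<ge> 2"
  shows "avg class_D (\<lambda>x. H (\<pi> x)) = (\<Sum>i\<in>I. \<Sum>p\<in>full_cycles (I - {i}). H p) / (real n * fact (n - 2))"
    "class_D \<noteq> {}" "x \<in> class_D \<Longrightarrow> \<delta> x = 1"
proof -
  \<comment> \<open>For n = 2 the class consists of the identity matrix, which is exhibited by
    either of its two fixed points.\<close>
  define k where "k = (if n = 2 then 2 else 1 :: nat)"
  have m: "card {i \<in> I. p \<in> full_cycles (I - {i}) \<and> c i = 1 \<and> prod c (I - {i}) = 1} = k"
    if "p permutes I" "c \<in> colourings" "monomial_mat n p c \<in> class_D" for p c
  proof -
    have ex: "\<exists>i\<in>I. p \<in> full_cycles (I - {i}) \<and> c i = 1 \<and> prod c (I - {i}) = 1"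
      using class_D_iff[OF n2 that(1,2)] that(3) by blast
    show ?thesis
    proof (cases "n = 2")
      case True
      thus ?thesis using card_fixed_coloured(2)[OF n2 ex refl] by (simp add: k_def)
    next
      case False
      thus ?thesis using card_fixed_coloured(1)[OF n2 ex] n2 by (simp add: k_def)
    qed
  qed
  have k: "k > 0" by (simp add: k_def)
  show "avg class_D (\<lambda>x. H (\<pi> x)) = (\<Sum>i\<in>I. \<Sum>p\<in>full_cycles (I - {i}). H p) / (real n * fact (n - 2))"
    by (rule avg_subfull_cycle_class(1)[where m = k and e = 1])
       (fact n2 conj_class_subset Z(1) k class_D_iff[OF n2] m)+
  show "class_D \<noteq> {}"
    by (rule avg_subfull_cycle_class(2)[where m = k and e = 1])
       (fact n2 conj_class_subset Z(1) k class_D_iff[OF n2] m)+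
  show "\<delta> x = 1" if x: "x \<in> class_D"
    by (rule avg_subfull_cycle_class(3)[where m = k and e = 1 and X = class_D])
       (fact n2 conj_class_subset Z(1) k class_D_iff[OF n2] m x)+
qed

section \<open>The form at powers of 1 + ra and 1 + rb\<close>

definition bilinear :: "nat \<Rightarrow> nat \<Rightarrow> (nat \<Rightarrow> nat \<Rightarrow> real) \<Rightarrow> real" where
  "bilinear a b f = (\<Sum>i=0..n. \<Sum>j=0..n. (1 + real r * real a) ^ i * (1 + real r * real b) ^ j * f i j)"

text \<open>Linearity in the kernel lets the evaluation pass through all class averages and through
  the convex combination, down to one fixed group element.\<close>

lemma bilinear_avg: "bilinear a b (\<lambda>i j. avg K (\<lambda>k. f k i j)) = avg K (\<lambda>k. bilinear a b (f k))"
  unfolding bilinear_def avg_def sum_divide_distrib sum_distrib_left times_divide_eq_right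
  by (rule sym, rule trans[OF sum.swap sum.cong[OF refl sum.swap]])

lemma bilinear_add: "bilinear a b (\<lambda>i j. f i j + g i j) = bilinear a b f + bilinear a b g"
  by (simp add: bilinear_def sum.distrib distrib_left)

lemma bilinear_scale: "bilinear a b (\<lambda>i j. c * f i j) = c * bilinear a b f"
  by (simp add: bilinear_def sum_distrib_left mult.left_commute)

lemma bilinear_transition:
  assumes "g \<in> G"
  shows "bilinear a b (\<lambda>i j. real (card ((\<lambda>x. g * x) ` ell_class r \<zeta> n i \<inter> ell_class r \<zeta> n j))) = corr a b g"
  unfolding bilinear_def corr_def by (rule sum_ell_transition[OF assms])

lemma carrier: "conj_class r \<zeta> n lam \<subseteq> carrier_mat n n"
  unfolding conj_class_def refl_group_def by blast

text \<open>The average over the first class is taken innermost and evaluated by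
  \<open>avg_corr\<close>. The second class then enters only through its permutation parts and its
  common total colour.\<close>

lemma bilinear_mu_seq_two:
  fixes lam
  defines "L \<equiv> conj_class r \<zeta> n lam"
  assumes L: "L \<noteq> {}" "\<And>x. x \<in> L \<Longrightarrow> \<delta> x = e"
  shows "bilinear a b (mu_seq r \<zeta> n [class_A, L]) =
    avg L (\<lambda>l. real r ^ n / fact (n - 1) * (\<Sum>p\<in>full_cycles I. \<Theta> a b (p \<circ> \<pi> l) e))"
proof -
  have G: "x \<in> G" if "x \<in> conj_class r \<zeta> n lam'" for x lam' using that conj_class_subset by blast
  have "mu_seq r \<zeta> n [class_A, L] = (\<lambda>i j. avg class_A (\<lambda>k. avg L (\<lambda>l.
      real (card ((\<lambda>x. k * l * x) ` ell_class r \<zeta> n i \<inter> ell_class r \<zeta> n j)))))"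
    by (intro ext mu_seq_two finite_conj_class avg_class_A(2))
       (use L(1) finite_conj_class carrier in \<open>simp_all add: L_def\<close>)
  hence "bilinear a b (mu_seq r \<zeta> n [class_A, L]) = avg class_A (\<lambda>k. avg L (\<lambda>l.
      bilinear a b (\<lambda>i j. real (card ((\<lambda>x. k * l * x) ` ell_class r \<zeta> n i \<inter> ell_class r \<zeta> n j)))))"
    by (simp only: bilinear_avg)
  also have "\<dots> = avg class_A (\<lambda>k. avg L (\<lambda>l. corr a b (k * l)))"
    by (intro avg_cong bilinear_transition refl_group_mult G) (simp_all add: L_def)
  also have "\<dots> = avg L (\<lambda>l. avg class_A (\<lambda>k. corr a b (k * l)))" by (rule avg_swap)
  also have "\<dots> = avg L (\<lambda>l. real r ^ n / fact (n - 1) * (\<Sum>p\<in>full_cycles I. \<Theta> a b (p \<circ> \<pi> l) e))"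
  proof (rule avg_cong)
    fix l assume l: "l \<in> L"
    hence "l \<in> G" using G by (simp add: L_def)
    from avg_corr[OF conj_class_subset class_A_iff this]
    show "avg class_A (\<lambda>k. corr a b (k * l)) = real r ^ n / fact (n - 1) * (\<Sum>p\<in>full_cycles I. \<Theta> a b (p \<circ> \<pi> l) e)"
      unfolding L(2)[OF l] .
  qed
  finally show ?thesis .
qed

lemma bilinear_mu_seq_four:
  fixes lam\<^sub>1 lam\<^sub>2 lam\<^sub>3
  defines "L \<equiv> conj_class r \<zeta> n lam\<^sub>1" and "M \<equiv> conj_class r \<zeta> n lam\<^sub>2" and "N \<equiv> conj_class r \<zeta> n lam\<^sub>3"
  assumes L: "L \<noteq> {}" "\<And>x. x \<in> L \<Longrightarrow> \<delta> x = e\<^sub>1" and M: "M \<noteq> {}" "\<And>x. x \<in> M \<Longrightarrow> \<delta> x = e\<^sub>2"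
    and N: "N \<noteq> {}" "\<And>x. x \<in> N \<Longrightarrow> \<delta> x = e\<^sub>3"
  shows "bilinear a b (mu_seq r \<zeta> n [class_A, L, M, N]) =
    avg L (\<lambda>l. avg M (\<lambda>m. avg N (\<lambda>x. real r ^ n / fact (n - 1) *
      (\<Sum>p\<in>full_cycles I. \<Theta> a b (p \<circ> (\<pi> l \<circ> (\<pi> m \<circ> \<pi> x))) (e\<^sub>1 * (e\<^sub>2 * e\<^sub>3))))))"
proof -
  have G: "x \<in> G" if "x \<in> conj_class r \<zeta> n lam'" for x lam' using that conj_class_subset by blast
  have "mu_seq r \<zeta> n [class_A, L, M, N] = (\<lambda>i j. avg class_A (\<lambda>k. avg L (\<lambda>l. avg M (\<lambda>m. avg N (\<lambda>x.
      real (card ((\<lambda>y. k * (l * (m * x)) * y) ` ell_class r \<zeta> n i \<inter> ell_class r \<zeta> n j)))))))"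
    by (intro ext mu_seq_four finite_conj_class avg_class_A(2))
       (use L(1) M(1) N(1) finite_conj_class carrier in \<open>simp_all add: L_def M_def N_def\<close>)
  hence "bilinear a b (mu_seq r \<zeta> n [class_A, L, M, N]) = avg class_A (\<lambda>k. avg L (\<lambda>l. avg M (\<lambda>m. avg N (\<lambda>x.
      bilinear a b (\<lambda>i j. real (card ((\<lambda>y. k * (l * (m * x)) * y) ` ell_class r \<zeta> n i \<inter> ell_class r \<zeta> n j)))))))"
    by (simp only: bilinear_avg)
  also have "\<dots> = avg class_A (\<lambda>k. avg L (\<lambda>l. avg M (\<lambda>m. avg N (\<lambda>x. corr a b (k * (l * (m * x)))))))"
    by (intro avg_cong bilinear_transition refl_group_mult G) (simp_all add: L_def M_def N_def)
  \<comment> \<open>The average over the leading class is moved past the other three, so that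
    \<open>avg_corr\<close> applies with their product in place of \<open>y\<close>.\<close>
  also have "\<dots> = avg L (\<lambda>l. avg M (\<lambda>m. avg N (\<lambda>x. avg class_A (\<lambda>k. corr a b (k * (l * (m * x)))))))"
    unfolding avg_swap[of class_A] ..
  also have "\<dots> = avg L (\<lambda>l. avg M (\<lambda>m. avg N (\<lambda>x. real r ^ n / fact (n - 1) *
      (\<Sum>p\<in>full_cycles I. \<Theta> a b (p \<circ> (\<pi> l \<circ> (\<pi> m \<circ> \<pi> x))) (e\<^sub>1 * (e\<^sub>2 * e\<^sub>3))))))"
  proof (intro avg_cong)
    fix l m x assume l: "l \<in> L" and m: "m \<in> M" and x: "x \<in> N"
    have lG: "l \<in> G" and mG: "m \<in> G" and xG: "x \<in> G" using l m x G by (simp_all add: L_def M_def N_def)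
    have mx: "m * x \<in> G" and lmx: "l * (m * x) \<in> G" using refl_group_mult lG mG xG by blast+
    have "\<pi> (l * (m * x)) = \<pi> l \<circ> (\<pi> m \<circ> \<pi> x)" "\<delta> (l * (m * x)) = e\<^sub>1 * (e\<^sub>2 * e\<^sub>3)"
      unfolding \<pi>_\<delta>_mult[OF lG mx] \<pi>_\<delta>_mult[OF mG xG] L(2)[OF l] M(2)[OF m] N(2)[OF x] by (rule refl)+
    with avg_corr[OF conj_class_subset class_A_iff lmx]
    show "avg class_A (\<lambda>k. corr a b (k * (l * (m * x)))) = real r ^ n / fact (n - 1) *
      (\<Sum>p\<in>full_cycles I. \<Theta> a b (p \<circ> (\<pi> l \<circ> (\<pi> m \<circ> \<pi> x))) (e\<^sub>1 * (e\<^sub>2 * e\<^sub>3)))" by simp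
  qed
  finally show ?thesis .
qed

definition colour_factor :: "complex \<Rightarrow> real" where
  "colour_factor e = (if e = 1 then real r - 1 else -1)"

lemma \<Theta>_eq: "\<Theta> a b p e = cycle_pairing I (Suc a) (Suc b) p + colour_factor e * cycle_pairing I a b p"
  by (simp add: \<Theta>_def colour_factor_def)

text \<open>The product of binomial coefficients (n+a-i choose n) (n+b-i choose n) from the target
  sum, since (a + 1) + n - 1 - i = n + a - i.\<close>

definition target_term :: "nat \<Rightarrow> nat \<Rightarrow> nat \<Rightarrow> real" where
  "target_term a b i = hook_mult n i (Suc a) * hook_mult n i (Suc b)"

text \<open>Lowering both arguments by one amounts to raising the index by one. So the two halves of
  \<open>\<Theta>\<close> yield terms with indices 0 to n - 1 and 1 to n.\<close>

lemma hook_mult_shift: "hook_mult n k a * hook_mult n k b = target_term a b (Suc k)"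
  by (simp add: target_term_def hook_mult_def)

lemma fact_n: "(fact n :: real) = real n * fact (n - 1)"
  using n1 by (simp add: fact_reduce)

text \<open>Stated for any class that is uniform on full cycles, so as to serve for total colour 1
  and for total colour \<open>\<zeta>\<close>; only \<open>colour_factor\<close> differs.\<close>

lemma bilinear_full_full:
  fixes lam
  defines "X \<equiv> conj_class r \<zeta> n lam"
  assumes X: "X \<noteq> {}" "\<And>x. x \<in> X \<Longrightarrow> \<delta> x = e"
    "\<And>H. avg X (\<lambda>x. H (\<pi> x)) = (\<Sum>p\<in>full_cycles I. H p) / fact (n - 1)"
  shows "bilinear a b (mu_seq r \<zeta> n [class_A, X]) = real r ^ n * fact n *
    ((\<Sum>k<n. target_term a b k) + colour_factor e * (\<Sum>k<n. target_term a b (Suc k)))"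
proof -
  have "bilinear a b (mu_seq r \<zeta> n [class_A, X]) =
      avg X (\<lambda>x. real r ^ n / fact (n - 1) * (\<Sum>p\<in>full_cycles I. \<Theta> a b (p \<circ> \<pi> x) e))"
    unfolding X_def by (rule bilinear_mu_seq_two) (use X in \<open>simp_all add: X_def\<close>)
  also have "\<dots> = (\<Sum>q\<in>full_cycles I. real r ^ n / fact (n - 1) * (\<Sum>p\<in>full_cycles I. \<Theta> a b (p \<circ> q) e)) / fact (n - 1)"
    by (rule X(3))
  also have "(\<Sum>q\<in>full_cycles I. real r ^ n / fact (n - 1) * (\<Sum>p\<in>full_cycles I. \<Theta> a b (p \<circ> q) e)) =
      real r ^ n / fact (n - 1) * ((\<Sum>p\<in>full_cycles I. \<Sum>q\<in>full_cycles I. cycle_pairing I (Suc a) (Suc b) (p \<circ> q)) +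
        colour_factor e * (\<Sum>p\<in>full_cycles I. \<Sum>q\<in>full_cycles I. cycle_pairing I a b (p \<circ> q)))"
    unfolding sum_distrib_left[symmetric] \<Theta>_eq
    by (subst sum.swap) (simp add: sum.distrib sum_distrib_left)
  also have "\<dots> = real r ^ n / fact (n - 1) * (fact (n - 1) * fact (n - 1) * fact n *
      ((\<Sum>k<n. target_term a b k) + colour_factor e * (\<Sum>k<n. target_term a b (Suc k))))"
    unfolding sum_cycle_pairing_full_full[OF I(1,2)] I(3) target_term_def[symmetric]
    unfolding hook_mult_shift
    by (simp add: distrib_left)
  finally show ?thesis by simp
qed

text \<open>The product of the permutation parts is a uniform odd permutation, so each window
  contributes its first minus its last term; the total colour \<open>\<zeta>\<close> makes the
  second window negative.\<close>

lemma bilinear_full_subfull: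
  assumes n2: "n \<ge> 2"
  shows "bilinear a b (mu_seq r \<zeta> n [class_A, class_C]) = real r ^ n * fact n *
    ((target_term a b 0 - target_term a b (n - 1)) - (target_term a b 1 - target_term a b n))"
proof -
  have I2: "card I \<ge> 2" using n2 I(3) by simp
  have "bilinear a b (mu_seq r \<zeta> n [class_A, class_C]) =
      avg class_C (\<lambda>x. real r ^ n / fact (n - 1) * (\<Sum>p\<in>full_cycles I. \<Theta> a b (p \<circ> \<pi> x) \<zeta>))"
    by (rule bilinear_mu_seq_two[OF avg_class_C(2,3)[OF n2]])
  also have "\<dots> = (\<Sum>i\<in>I. \<Sum>q\<in>full_cycles (I - {i}). real r ^ n / fact (n - 1) * (\<Sum>p\<in>full_cycles I. \<Theta> a b (p \<circ> q) \<zeta>))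
      / (real n * fact (n - 2))"
    by (rule avg_class_C(1)[OF n2])
  also have "(\<Sum>i\<in>I. \<Sum>q\<in>full_cycles (I - {i}). real r ^ n / fact (n - 1) * (\<Sum>p\<in>full_cycles I. \<Theta> a b (p \<circ> q) \<zeta>)) =
      real r ^ n / fact (n - 1) *
        ((\<Sum>p\<in>full_cycles I. \<Sum>i\<in>I. \<Sum>q\<in>full_cycles (I - {i}). cycle_pairing I (Suc a) (Suc b) (p \<circ> q)) -
        (\<Sum>p\<in>full_cycles I. \<Sum>i\<in>I. \<Sum>q\<in>full_cycles (I - {i}). cycle_pairing I a b (p \<circ> q)))"
  proof -
    have sw: "(\<Sum>i\<in>I. \<Sum>q\<in>full_cycles (I - {i}). \<Sum>p\<in>full_cycles I. h p q) =
        (\<Sum>p\<in>full_cycles I. \<Sum>i\<in>I. \<Sum>q\<in>full_cycles (I - {i}). h p q)" for h :: "(nat \<Rightarrow> nat) \<Rightarrow> (nat \<Rightarrow> nat) \<Rightarrow> real"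
      by (rule trans[OF sum.cong[OF refl sum.swap] sum.swap])
    show ?thesis
      unfolding sum_distrib_left[symmetric] sw \<Theta>_eq colour_factor_def using Z(6) by (simp add: sum.distrib sum_subtractf sum_negf)
  qed
  also have "\<dots> = real r ^ n / fact (n - 1) * (fact (n - 2) * fact n * fact n *
      ((target_term a b 0 - target_term a b (n - 1)) - (target_term a b 1 - target_term a b n)))"
    unfolding sum_cycle_pairing_full_subfull[OF I(1) I2] I(3) target_term_def[symmetric]
    unfolding hook_mult_shift
    using n1 by (simp add: right_diff_distrib)
  also have "\<dots> / (real n * fact (n - 2)) = real r ^ n * fact n *
      ((target_term a b 0 - target_term a b (n - 1)) - (target_term a b 1 - target_term a b n))"
    using n1 unfolding fact_n by (simp add: field_simps)
  finally show ?thesis .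
qed

text \<open>Here the permutation parts multiply to a uniform even permutation, and each window
  contributes the sum of its end terms. The class \<open>X\<close> is left open because its total
  colour is the only difference between the last two sequences.\<close>

lemma bilinear_full_full_subfull_subfull:
  fixes lam
  defines "X \<equiv> conj_class r \<zeta> n lam"
  assumes n2: "n \<ge> 2" and X: "X \<noteq> {}" "\<And>x. x \<in> X \<Longrightarrow> \<delta> x = e"
    "\<And>H. avg X (\<lambda>x. H (\<pi> x)) = (\<Sum>i\<in>I. \<Sum>p\<in>full_cycles (I - {i}). H p) / (real n * fact (n - 2))"
  shows "bilinear a b (mu_seq r \<zeta> n [class_A, class_A, X, class_D]) = real r ^ n * fact n *
    ((target_term a b 0 + target_term a b (n - 1)) + colour_factor e * (target_term a b 1 + target_term a b n))"
proof -
  have I2: "card I \<ge> 2" using n2 I(3) by simp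
  define c where "c = real r ^ n / fact (n - 1)"
  define c' where "c' = real n * (fact (n - 2) :: real)"
  define h where "h = (\<lambda>q. c * (\<Sum>p\<in>full_cycles I. \<Theta> a b (p \<circ> q) e))"
  have "bilinear a b (mu_seq r \<zeta> n [class_A, class_A, X, class_D]) =
      avg class_A (\<lambda>l. avg X (\<lambda>m. avg class_D (\<lambda>x. c * (\<Sum>p\<in>full_cycles I. \<Theta> a b (p \<circ> (\<pi> l \<circ> (\<pi> m \<circ> \<pi> x))) (1 * (e * 1))))))"
    unfolding X_def c_def
    by (rule bilinear_mu_seq_four[OF avg_class_A(2,3) _ _ avg_class_D(2,3)[OF n2]])
       (use X in \<open>simp_all add: X_def\<close>)
  also have "\<dots> = avg class_A (\<lambda>l. avg X (\<lambda>m. avg class_D (\<lambda>x. h (\<pi> l \<circ> (\<pi> m \<circ> \<pi> x)))))"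
    by (simp add: h_def)
  also have "\<dots> = avg class_A (\<lambda>l. avg X (\<lambda>m.
      (\<Sum>i'\<in>I. \<Sum>d'\<in>full_cycles (I - {i'}). h (\<pi> l \<circ> (\<pi> m \<circ> d'))) / c'))"
    unfolding c'_def by (intro avg_cong avg_class_D(1)[OF n2])
  also have "\<dots> = avg class_A (\<lambda>l. (\<Sum>i\<in>I. \<Sum>d\<in>full_cycles (I - {i}).
      (\<Sum>i'\<in>I. \<Sum>d'\<in>full_cycles (I - {i'}). h (\<pi> l \<circ> (d \<circ> d'))) / c') / c')"
    unfolding c'_def by (intro avg_cong X(3))
  also have "\<dots> = (\<Sum>q\<in>full_cycles I. (\<Sum>i\<in>I. \<Sum>d\<in>full_cycles (I - {i}).
      (\<Sum>i'\<in>I. \<Sum>d'\<in>full_cycles (I - {i'}). h (q \<circ> (d \<circ> d'))) / c') / c') / fact (n - 1)"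
    by (rule avg_class_A(1))
  also have "\<dots> = (\<Sum>q\<in>full_cycles I. \<Sum>i\<in>I. \<Sum>d\<in>full_cycles (I - {i}).
      \<Sum>i'\<in>I. \<Sum>d'\<in>full_cycles (I - {i'}). h (q \<circ> (d \<circ> d'))) / c' / c' / fact (n - 1)"
    by (simp only: sum_divide_distrib)
  also have "(\<Sum>q\<in>full_cycles I. \<Sum>i\<in>I. \<Sum>d\<in>full_cycles (I - {i}).
      \<Sum>i'\<in>I. \<Sum>d'\<in>full_cycles (I - {i'}). h (q \<circ> (d \<circ> d'))) =
    c * ((\<Sum>p\<in>full_cycles I. \<Sum>q\<in>full_cycles I. \<Sum>i\<in>I. \<Sum>d\<in>full_cycles (I - {i}).
      \<Sum>i'\<in>I. \<Sum>d'\<in>full_cycles (I - {i'}). cycle_pairing I (Suc a) (Suc b) (p \<circ> (q \<circ> (d \<circ> d')))) +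
    colour_factor e * (\<Sum>p\<in>full_cycles I. \<Sum>q\<in>full_cycles I. \<Sum>i\<in>I. \<Sum>d\<in>full_cycles (I - {i}).
      \<Sum>i'\<in>I. \<Sum>d'\<in>full_cycles (I - {i'}). cycle_pairing I a b (p \<circ> (q \<circ> (d \<circ> d')))))"
  proof -
    have sw: "(\<Sum>i\<in>I. \<Sum>q\<in>full_cycles (I - {i}). \<Sum>p\<in>full_cycles I. k p q) =
        (\<Sum>p\<in>full_cycles I. \<Sum>i\<in>I. \<Sum>q\<in>full_cycles (I - {i}). k p q)" for k :: "(nat \<Rightarrow> nat) \<Rightarrow> (nat \<Rightarrow> nat) \<Rightarrow> real"
      by (rule trans[OF sum.cong[OF refl sum.swap] sum.swap])
    have "(\<Sum>q\<in>full_cycles I. \<Sum>i\<in>I. \<Sum>d\<in>full_cycles (I - {i}).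
        \<Sum>i'\<in>I. \<Sum>d'\<in>full_cycles (I - {i'}). h (q \<circ> (d \<circ> d'))) =
      c * (\<Sum>q\<in>full_cycles I. \<Sum>p\<in>full_cycles I. \<Sum>i\<in>I. \<Sum>d\<in>full_cycles (I - {i}).
        \<Sum>i'\<in>I. \<Sum>d'\<in>full_cycles (I - {i'}). \<Theta> a b (p \<circ> (q \<circ> (d \<circ> d'))) e)"
      unfolding h_def sum_distrib_left[symmetric] sw ..
    also have "(\<Sum>q\<in>full_cycles I. \<Sum>p\<in>full_cycles I. \<Sum>i\<in>I. \<Sum>d\<in>full_cycles (I - {i}).
        \<Sum>i'\<in>I. \<Sum>d'\<in>full_cycles (I - {i'}). \<Theta> a b (p \<circ> (q \<circ> (d \<circ> d'))) e) =
      (\<Sum>p\<in>full_cycles I. \<Sum>q\<in>full_cycles I. \<Sum>i\<in>I. \<Sum>d\<in>full_cycles (I - {i}).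
        \<Sum>i'\<in>I. \<Sum>d'\<in>full_cycles (I - {i'}). \<Theta> a b (p \<circ> (q \<circ> (d \<circ> d'))) e)"
      by (rule sum.swap)
    finally show ?thesis unfolding \<Theta>_eq sum.distrib sum_distrib_left .
  qed
  also have "\<dots> = c * (fact (n - 2) * fact (n - 2) * fact n * fact n * fact n *
      ((target_term a b 0 + target_term a b (n - 1)) + colour_factor e * (target_term a b 1 + target_term a b n)))"
    unfolding sum_cycle_pairing_full_full_subfull_subfull[OF I(1) I2] I(3) target_term_def[symmetric]
    unfolding hook_mult_shift
    using n1 by (simp add: algebra_simps)
  also have "\<dots> / c' / c' / fact (n - 1) = real r ^ n * fact n *
      ((target_term a b 0 + target_term a b (n - 1)) + colour_factor e * (target_term a b 1 + target_term a b n))"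
    using n1 unfolding fact_n c_def c'_def by (simp add: field_simps)
  finally show ?thesis .
qed

theorem bilinear_mu:
  "bilinear a b (mu r \<zeta> n) = real r ^ n * fact n * (\<Sum>i=0..n. target_term a b i)"
proof -
  define T where "T = target_term a b"
  define K where "K = real r ^ n * fact n"
  have r0: "real r \<noteq> 0" using r2 by simp
  have cf: "colour_factor 1 = real r - 1" "colour_factor \<zeta> = - 1" using Z(6) by (simp_all add: colour_factor_def)
  note AA = bilinear_full_full[OF avg_class_A(2,3,1), of a b, folded T_def K_def, unfolded cf]
  note AB = bilinear_full_full[OF avg_class_B(2,3,1), of a b, folded T_def K_def, unfolded cf]
  show ?thesis
  proof (cases "n = 1")
    case True
    have S0: "(\<Sum>k<n. T k) = T 0" and S1: "(\<Sum>k<n. T (Suc k)) = T 1" by (simp_all add: True)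
    have "mu r \<zeta> n = (\<lambda>i j. 2 / real r * mu_seq r \<zeta> n [class_A, class_A] i j +
        (real r - 2) / real r * mu_seq r \<zeta> n [class_A, class_B] i j)"
      by (intro ext) (simp add: mu_def Let_def True)
    hence "bilinear a b (mu r \<zeta> n) = 2 / real r * (K * (T 0 + (real r - 1) * T 1)) +
        (real r - 2) / real r * (K * (T 0 + - 1 * T 1))"
      by (simp only: bilinear_add bilinear_scale AA AB S0 S1)
    \<comment> \<open>The coefficient of \<open>T 0\<close> is 2/r + (r-2)/r = 1, and that of
      \<open>T 1\<close> is 2 (r-1)/r - (r-2)/r = 1.\<close>
    also have "\<dots> = K * (T 0 + T 1)" using r0 by (simp add: field_simps)
    finally show ?thesis by (simp add: True K_def T_def)
  next
    case False
    hence n2: "n \<ge> 2" using n1 by simp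
    note AC = bilinear_full_subfull[OF n2, of a b, folded T_def K_def]
    note AADD = bilinear_full_full_subfull_subfull[OF n2 avg_class_D(2,3,1)[OF n2], of a b, folded T_def K_def, unfolded cf]
    note AACD = bilinear_full_full_subfull_subfull[OF n2 avg_class_C(2,3,1)[OF n2], of a b, folded T_def K_def, unfolded cf]
    \<comment> \<open>The inner terms, common to both windows. \<open>T 1\<close> and
      \<open>T (n - 1)\<close> are among them, but they are also carried separately, since their
      further contributions cancel.\<close>
    define M where "M = (\<Sum>k=1..<n. T k)"
    have S0: "(\<Sum>k<n. T k) = T 0 + M"
      unfolding M_def using n1 by (simp add: lessThan_atLeast0 sum.atLeast_Suc_lessThan)
    have S1: "(\<Sum>k<n. T (Suc k)) = M + T n"
    proof -
      have "(\<Sum>k<n. T (Suc k)) = (\<Sum>k=1..<Suc n. T k)"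
        unfolding lessThan_atLeast0 using sum.shift_bounds_Suc_ivl[of T 0 n] by simp
      thus ?thesis unfolding M_def using n1 by simp
    qed
    have S: "(\<Sum>i=0..n. T i) = T 0 + M + T n"
      using S0 by (simp add: atLeast0AtMost lessThan_Suc_atMost[symmetric])
    have "mu r \<zeta> n = (\<lambda>i j. 1 / real r * mu_seq r \<zeta> n [class_A, class_A] i j
        + (real r - 2) / (2 * real r) * mu_seq r \<zeta> n [class_A, class_B] i j
        + 1 / 4 * mu_seq r \<zeta> n [class_A, class_C] i j
        + 1 / (2 * real r) * mu_seq r \<zeta> n [class_A, class_A, class_D, class_D] i j
        + (real r - 2) / (4 * real r) * mu_seq r \<zeta> n [class_A, class_A, class_C, class_D] i j)"
      using False by (intro ext) (simp add: mu_def Let_def)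
    hence "bilinear a b (mu r \<zeta> n) = 1 / real r * (K * ((T 0 + M) + (real r - 1) * (M + T n)))
        + (real r - 2) / (2 * real r) * (K * ((T 0 + M) + - 1 * (M + T n)))
        + 1 / 4 * (K * ((T 0 - T (n - 1)) - (T 1 - T n)))
        + 1 / (2 * real r) * (K * ((T 0 + T (n - 1)) + (real r - 1) * (T 1 + T n)))
        + (real r - 2) / (4 * real r) * (K * ((T 0 + T (n - 1)) + - 1 * (T 1 + T n)))"
      by (simp only: bilinear_add bilinear_scale AA AB AC AADD AACD S0 S1)
    \<comment> \<open>The first two lines give T_0/2 + M + T_n/2, because 1/r + (r-2)/(2r) = (r-1)/r
      - (r-2)/(2r) = 1/2. The last two give a quarter of each of the four end terms, because 1/(2r)
      + (r-2)/(4r) = (r-1)/(2r) - (r-2)/(4r) = 1/4. The third line adds a quarter to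
      \<open>T 0\<close> and \<open>T n\<close> and removes the quarters of \<open>T 1\<close> and
      \<open>T (n - 1)\<close>.\<close>
    also have "\<dots> = K * (T 0 + M + T n)" using r0 by (simp add: field_simps)
    finally show ?thesis unfolding K_def[symmetric] T_def[symmetric] S .
  qed
qed

end

section \<open>The Foulkes basis\<close>

lemma coeff_one_minus_X_power: "((1 - fps_X :: real fps) ^ N) $ m = (-1) ^ m * of_nat (N choose m)"
proof (induction N arbitrary: m)
  case 0
  show ?case by (cases m) simp_all
next
  case (Suc N)
  have e: "(1 - fps_X :: real fps) ^ Suc N = (1 - fps_X) ^ N - fps_X * (1 - fps_X) ^ N"
    by (simp only: power_Suc left_diff_distrib mult_1_left)
  show ?case unfolding e fps_sub_nth by (cases m) (simp_all add: Suc.IH algebra_simps)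
qed

definition foulkes_coeff :: "nat \<Rightarrow> nat \<Rightarrow> nat \<Rightarrow> real" where
  "foulkes_coeff n i j = (if j \<le> i then (-1) ^ (i - j) * of_nat ((n + 1) choose (i - j)) else 0)"

text \<open>The coefficients of the Foulkes characters are those of (1 - x)^(n+1), and the numbers
  \<open>hook_mult n h (Suc j)\<close> are those of x^h / (1 - x)^(n+1). The sum is the i-th
  coefficient of the product x^h.\<close>

lemma foulkes_coeff_hook_mult:
  assumes "i \<le> n" "h \<le> n"
  shows "(\<Sum>j=0..n. foulkes_coeff n i j * hook_mult n h (Suc j)) = (if i = h then 1 else 0)"
proof -
  define B where "B = (Abs_fps (\<lambda>y. of_nat ((y + n - h) choose n)) :: real fps)"
  have "(\<Sum>j=0..n. foulkes_coeff n i j * hook_mult n h (Suc j)) =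
      (\<Sum>j=0..i. foulkes_coeff n i j * hook_mult n h (Suc j))"
    by (rule sum.mono_neutral_right) (use assms in \<open>auto simp: foulkes_coeff_def\<close>)
  also have "\<dots> = (\<Sum>j=0..i. B $ j * ((1 - fps_X) ^ Suc n) $ (i - j))"
    unfolding coeff_one_minus_X_power
    by (intro sum.cong refl) (simp add: foulkes_coeff_def hook_mult_def B_def)
  also have "\<dots> = (B * (1 - fps_X) ^ Suc n) $ i" by (rule fps_mult_nth[symmetric])
  also have "\<dots> = (if i = h then 1 else 0)"
    unfolding B_def fps_binomial_shift[OF assms(2)] by (simp add: fps_X_power_nth)
  finally show ?thesis .
qed

section \<open>Orthonormal bases and completeness in finite dimension\<close>

lemma orthonormal_family_coefficient:
  assumes V: "cfun.subspace V" and b: "\<And>i. i \<in> J \<Longrightarrow> b i \<in> V" and J: "finite J"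
    and add: "\<And>f g h. f \<in> V \<Longrightarrow> g \<in> V \<Longrightarrow> h \<in> V \<Longrightarrow> ip (f + g) h = ip f h + ip g h"
    and scale: "\<And>c f g. f \<in> V \<Longrightarrow> g \<in> V \<Longrightarrow> ip (fun_scale c f) g = c * ip f g"
    and on: "\<And>i j. i \<in> J \<Longrightarrow> j \<in> J \<Longrightarrow> ip (b i) (b j) = (if i = j then 1 else 0)"
    and j: "j \<in> J"
  shows "ip (\<Sum>i\<in>J. fun_scale (\<alpha> i) (b i)) (b j) = \<alpha> j"
proof -
  have z: "ip 0 h = 0" if "h \<in> V" for h
    using add[OF cfun.subspace_0[OF V] cfun.subspace_0[OF V] that] by simp
  have "ip (\<Sum>i\<in>K. fun_scale (\<alpha> i) (b i)) (b j) = (\<Sum>i\<in>K. \<alpha> i * ip (b i) (b j)) \<and>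
      (\<Sum>i\<in>K. fun_scale (\<alpha> i) (b i)) \<in> V" if "K \<subseteq> J" for K
    using finite_subset[OF that J] that
  proof (induction K rule: finite_induct)
    case empty
    show ?case unfolding sum.empty using z[OF b[OF j]] cfun.subspace_0[OF V] by (rule conjI)
  next
    case (insert k K)
    have k: "b k \<in> V" and sk: "fun_scale (\<alpha> k) (b k) \<in> V"
      using insert.prems b cfun.subspace_scale[OF V] by blast+
    from insert have IH: "ip (\<Sum>i\<in>K. fun_scale (\<alpha> i) (b i)) (b j) = (\<Sum>i\<in>K. \<alpha> i * ip (b i) (b j))"
      "(\<Sum>i\<in>K. fun_scale (\<alpha> i) (b i)) \<in> V" by blast+
    show ?case
      unfolding sum.insert[OF insert.hyps] add[OF sk IH(2) b[OF j]] scale[OF k b[OF j]] IH(1)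
      using cfun.subspace_add[OF V sk IH(2)] by blast
  qed
  hence "ip (\<Sum>i\<in>J. fun_scale (\<alpha> i) (b i)) (b j) = (\<Sum>i\<in>J. \<alpha> i * ip (b i) (b j))" by blast
  also have "\<dots> = (\<Sum>i\<in>J. if i = j then \<alpha> i else 0)"
    by (rule sum.cong) (use on j in auto)
  finally show ?thesis using J j by simp
qed

text \<open>Hermitian symmetry and positivity are not visible from the definition of the form, so
  they are derived from orthonormality: a sesquilinear form with an orthonormal basis is the
  standard one in coordinates. An orthonormal family is independent, and it spans because its size
  reaches the dimension bound given by \<open>T\<close>. Completeness is that of the
  coordinates.\<close>

lemma hilbert_space_orthonormal_basis:
  fixes b :: "'i \<Rightarrow> 'a \<Rightarrow> complex"
  assumes V: "cfun.subspace V" and J: "finite J" and b: "\<And>i. i \<in> J \<Longrightarrow> b i \<in> V"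
    and T: "finite T" "card T \<le> card J" "V \<subseteq> cfun.span T"
    and add: "\<And>f g h. f \<in> V \<Longrightarrow> g \<in> V \<Longrightarrow> h \<in> V \<Longrightarrow> ip (f + g) h = ip f h + ip g h"
    and scale: "\<And>c f g. f \<in> V \<Longrightarrow> g \<in> V \<Longrightarrow> ip (fun_scale c f) g = c * ip f g"
    and add': "\<And>f g h. f \<in> V \<Longrightarrow> g \<in> V \<Longrightarrow> h \<in> V \<Longrightarrow> ip h (f + g) = ip h f + ip h g"
    and scale': "\<And>c f g. f \<in> V \<Longrightarrow> g \<in> V \<Longrightarrow> ip g (fun_scale c f) = cnj c * ip g f"
    and on: "\<And>i j. i \<in> J \<Longrightarrow> j \<in> J \<Longrightarrow> ip (b i) (b j) = (if i = j then 1 else 0)"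
  shows "hilbert_space_on V ip \<and> orthonormal_basis_on V ip J b"
proof -
  define comb where "comb = (\<lambda>\<alpha>. \<Sum>i\<in>J. fun_scale (\<alpha> i) (b i))"
  have coef: "ip (comb \<alpha>) (b j) = \<alpha> j" if "j \<in> J" for \<alpha> j
    unfolding comb_def
    by (rule orthonormal_family_coefficient[where V = V and ip = ip and J = J])
       (fact V b J add scale on that)+
  have combV: "comb \<alpha> \<in> V" for \<alpha>
    unfolding comb_def by (intro cfun.subspace_sum[OF V] cfun.subspace_scale[OF V] b)
  have inj: "inj_on b J"
    using on by (intro inj_onI) (metis one_neq_zero)
  have ind: "cfun.independent (b ` J)"
  proof (rule cfun.independent_if_scalars_zero)
    fix f x assume s: "(\<Sum>x\<in>b ` J. fun_scale (f x) x) = 0" and "x \<in> b ` J"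
    then obtain j where j: "j \<in> J" "x = b j" by blast
    have "comb (f \<circ> b) = 0" using s unfolding comb_def sum.reindex[OF inj] by simp
    moreover have "comb (\<lambda>_. 0) = 0" by (simp add: comb_def fun_scale_def fun_eq_iff)
    ultimately show "f x = 0" using coef[OF j(1), of "f \<circ> b"] coef[OF j(1), of "\<lambda>_. 0"] j(2) by simp
  qed (use J in simp)
  have Vspan: "V \<subseteq> cfun.span (b ` J)"
  proof
    fix v assume v: "v \<in> V"
    show "v \<in> cfun.span (b ` J)"
    proof (rule ccontr)
      assume n: "v \<notin> cfun.span (b ` J)"
      \<comment> \<open>Otherwise \<open>V\<close> would contain card J + 1 independent vectors, all
        within the span of \<open>T\<close>.\<close>
      hence "cfun.independent (insert v (b ` J))" using ind by (rule cfun.independent_insertI)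
      moreover have "insert v (b ` J) \<subseteq> cfun.span T" using v b T(3) by auto
      ultimately have "card (insert v (b ` J)) \<le> card T" using cfun.independent_span_bound[OF T(1)] by blast
      moreover have "v \<notin> b ` J" using n cfun.span_base by metis
      ultimately show False using T(2) J card_image[OF inj] by simp
    qed
  qed
  hence span: "cfun.span (b ` J) = V" using cfun.span_minimal[OF _ V, of "b ` J"] b by blast
  have ex: "\<exists>\<alpha>. f = comb \<alpha>" if "f \<in> V" for f
  proof -
    have "cfun.subspace (range comb)"
    proof (rule cfun.subspaceI)
      have "comb (\<lambda>_. 0) = 0" by (simp add: comb_def fun_scale_def fun_eq_iff)
      thus "0 \<in> range comb" by (metis rangeI)
      have "comb \<alpha> + comb \<beta> = comb (\<lambda>i. \<alpha> i + \<beta> i)" for \<alpha> \<beta>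
        unfolding comb_def sum.distrib[symmetric] cfun.scale_left_distrib ..
      thus "f + g \<in> range comb" if "f \<in> range comb" "g \<in> range comb" for f g using that by fastforce
      have "fun_scale c (comb \<alpha>) = comb (\<lambda>i. c * \<alpha> i)" for c \<alpha>
        unfolding comb_def cfun.scale_sum_right cfun.scale_scale ..
      thus "fun_scale c f \<in> range comb" if "f \<in> range comb" for c f using that by fastforce
    qed
    moreover have "b j \<in> range comb" if "j \<in> J" for j
    proof -
      have "comb (\<lambda>i. if i = j then 1 else 0) = (\<Sum>i\<in>J. if i = j then b i else 0)"
        unfolding comb_def by (intro sum.cong refl) (auto simp: fun_scale_def fun_eq_iff)
      also have "\<dots> = b j" using sum.delta[OF J, of j b] that by simp
      finally have e: "comb (\<lambda>i. if i = j then 1 else 0) = b j" .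
      show ?thesis by (rule range_eqI[where f = comb, OF e[symmetric]])
    qed
    ultimately have "cfun.span (b ` J) \<subseteq> range comb" by (intro cfun.span_minimal) auto
    thus ?thesis using that span by blast
  qed
  have ip: "ip (comb \<alpha>) (comb \<beta>) = (\<Sum>i\<in>J. \<alpha> i * cnj (\<beta> i))" for \<alpha> \<beta>
  proof -
    have z: "ip f 0 = 0" if "f \<in> V" for f
      using add'[OF cfun.subspace_0[OF V] cfun.subspace_0[OF V] that] by simp
    have "ip (comb \<alpha>) (\<Sum>i\<in>K. fun_scale (\<beta> i) (b i)) = (\<Sum>i\<in>K. \<alpha> i * cnj (\<beta> i)) \<and>
        (\<Sum>i\<in>K. fun_scale (\<beta> i) (b i)) \<in> V" if "K \<subseteq> J" for K
      using finite_subset[OF that J] that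
    proof (induction K rule: finite_induct)
      case empty
      show ?case unfolding sum.empty using z[OF combV] cfun.subspace_0[OF V] by (rule conjI)
    next
      case (insert k K)
      have k: "k \<in> J" "b k \<in> V" and sk: "fun_scale (\<beta> k) (b k) \<in> V"
        using insert.prems b cfun.subspace_scale[OF V] by blast+
      from insert have IH: "ip (comb \<alpha>) (\<Sum>i\<in>K. fun_scale (\<beta> i) (b i)) = (\<Sum>i\<in>K. \<alpha> i * cnj (\<beta> i))"
        "(\<Sum>i\<in>K. fun_scale (\<beta> i) (b i)) \<in> V" by blast+
      show ?case
        unfolding sum.insert[OF insert.hyps] add'[OF sk IH(2) combV] scale'[OF k(2) combV] IH(1) coef[OF k(1)]
        using cfun.subspace_add[OF V sk IH(2)] by (simp only: mult.commute)
    qed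
    thus ?thesis unfolding comb_def by blast
  qed
  have nrm: "ip (comb \<alpha>) (comb \<alpha>) = of_real (\<Sum>i\<in>J. (cmod (\<alpha> i))\<^sup>2)" for \<alpha>
    unfolding ip of_real_sum by (intro sum.cong refl complex_norm_square[symmetric])
  have diff: "comb \<alpha> - comb \<beta> = comb (\<lambda>i. \<alpha> i - \<beta> i)" for \<alpha> \<beta>
    unfolding comb_def sum_subtractf[symmetric] cfun.scale_left_diff_distrib ..
  have inner: "inner_product_on V ip"
    unfolding inner_product_on_def
  proof (intro conjI ballI allI impI add scale)
    fix f g assume "f \<in> V" "g \<in> V"
    then obtain \<alpha> \<beta> where "f = comb \<alpha>" "g = comb \<beta>" using ex by meson
    thus "ip g f = cnj (ip f g)" by (simp add: ip mult.commute)
  next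
    fix f assume "f \<in> V" and nz: "f \<noteq> 0"
    then obtain \<alpha> where f: "f = comb \<alpha>" using ex by meson
    show "ip f f \<in> \<real>" unfolding f nrm by simp
    obtain i where i: "i \<in> J" "\<alpha> i \<noteq> 0"
    proof -
      have "\<exists>i\<in>J. \<alpha> i \<noteq> 0"
      proof (rule ccontr)
        assume "\<not> (\<exists>i\<in>J. \<alpha> i \<noteq> 0)"
        hence "comb \<alpha> = 0" by (simp add: comb_def fun_scale_def fun_eq_iff)
        thus False using nz f by simp
      qed
      thus ?thesis using that by blast
    qed
    have "0 < (\<Sum>i\<in>J. (cmod (\<alpha> i))\<^sup>2)"
      by (rule sum_pos2[OF J i(1)]) (use i(2) in auto)
    thus "Re (ip f f) > 0" unfolding f nrm by simp
  qed
  have complete: "\<exists>f\<in>V. (\<lambda>k. sqrt (Re (ip (s k - f) (s k - f)))) \<longlonglongrightarrow> 0"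
    if sV: "\<And>k. s k \<in> V" and cau: "\<And>\<epsilon>. \<epsilon> > 0 \<Longrightarrow> \<exists>N. \<forall>k\<ge>N. \<forall>l\<ge>N. sqrt (Re (ip (s k - s l) (s k - s l))) < \<epsilon>"
    for s :: "nat \<Rightarrow> 'a \<Rightarrow> complex"
  proof -
    obtain \<alpha> where \<alpha>: "s k = comb (\<alpha> k)" for k using ex[OF sV] by metis
    have n: "sqrt (Re (ip (s k - comb \<beta>) (s k - comb \<beta>))) = sqrt (\<Sum>i\<in>J. (cmod (\<alpha> k i - \<beta> i))\<^sup>2)" for k \<beta>
      unfolding \<alpha> diff nrm by simp
    have "Cauchy (\<lambda>k. \<alpha> k i)" if i: "i \<in> J" for i
    proof (rule CauchyI)
      fix e :: real assume "e > 0"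
      then obtain N where N: "\<forall>k\<ge>N. \<forall>l\<ge>N. sqrt (Re (ip (s k - s l) (s k - s l))) < e" using cau by blast
      have "cmod (\<alpha> k i - \<alpha> l i) < e" if "k \<ge> N" "l \<ge> N" for k l
      proof -
        have "(cmod (\<alpha> k i - \<alpha> l i))\<^sup>2 \<le> (\<Sum>i\<in>J. (cmod (\<alpha> k i - \<alpha> l i))\<^sup>2)"
          by (rule member_le_sum[OF i]) (use J in auto)
        hence "cmod (\<alpha> k i - \<alpha> l i) \<le> sqrt (\<Sum>i\<in>J. (cmod (\<alpha> k i - \<alpha> l i))\<^sup>2)" by (rule real_le_rsqrt)
        also have "\<dots> < e"
        proof -
          have "sqrt (Re (ip (s k - s l) (s k - s l))) < e" using N that by blast
          thus ?thesis unfolding \<alpha>[of l] n .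
        qed
        finally show ?thesis .
      qed
      thus "\<exists>N. \<forall>k\<ge>N. \<forall>l\<ge>N. norm (\<alpha> k i - \<alpha> l i) < e" by blast
    qed
    hence "\<forall>i\<in>J. \<exists>L. (\<lambda>k. \<alpha> k i) \<longlonglongrightarrow> L" using Cauchy_convergent convergent_def by blast
    then obtain \<beta> where \<beta>: "\<And>i. i \<in> J \<Longrightarrow> (\<lambda>k. \<alpha> k i) \<longlonglongrightarrow> \<beta> i" by metis
    have "(\<lambda>k. sqrt (\<Sum>i\<in>J. (cmod (\<alpha> k i - \<beta> i))\<^sup>2)) \<longlonglongrightarrow> sqrt (\<Sum>i\<in>J. (cmod (\<beta> i - \<beta> i))\<^sup>2)"
      by (intro tendsto_intros \<beta>)
    hence "(\<lambda>k. sqrt (Re (ip (s k - comb \<beta>) (s k - comb \<beta>)))) \<longlonglongrightarrow> 0" unfolding n by simp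
    thus ?thesis using combV by blast
  qed
  show ?thesis
    unfolding hilbert_space_on_def orthonormal_basis_on_def Let_def
    using V inner complete inj ind span on by blast
qed

section \<open>Orthonormality of the Foulkes characters\<close>

context complex_reflection
begin

lemma CF_ellI:
  assumes "\<And>x. x \<notin> G \<Longrightarrow> f x = 0"
    and "\<And>x y. x \<in> G \<Longrightarrow> y \<in> G \<Longrightarrow> ell r \<zeta> n x = ell r \<zeta> n y \<Longrightarrow> f x = f y"
  shows "f \<in> CF_ell r \<zeta> n"
  unfolding CF_ell_def mem_Collect_eq using assms by (intro conjI allI impI ballI)

lemma CF_ellD:
  assumes "f \<in> CF_ell r \<zeta> n"
  shows "x \<notin> G \<Longrightarrow> f x = 0"
    and "x \<in> G \<Longrightarrow> y \<in> G \<Longrightarrow> ell r \<zeta> n x = ell r \<zeta> n y \<Longrightarrow> f x = f y"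
  using assms unfolding CF_ell_def mem_Collect_eq by blast+

lemma subspace_CF_ell: "cfun.subspace (CF_ell r \<zeta> n)"
proof (rule cfun.subspaceI)
  show "0 \<in> CF_ell r \<zeta> n" by (rule CF_ellI) simp_all
  show "f + g \<in> CF_ell r \<zeta> n" if f: "f \<in> CF_ell r \<zeta> n" and g: "g \<in> CF_ell r \<zeta> n" for f g
  proof (rule CF_ellI)
    show "(f + g) x = 0" if "x \<notin> G" for x using CF_ellD(1)[OF f that] CF_ellD(1)[OF g that] by simp
    show "(f + g) x = (f + g) y" if "x \<in> G" "y \<in> G" "ell r \<zeta> n x = ell r \<zeta> n y" for x y
      using CF_ellD(2)[OF f that] CF_ellD(2)[OF g that] by simp
  qed
  show "fun_scale c f \<in> CF_ell r \<zeta> n" if f: "f \<in> CF_ell r \<zeta> n" for c f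
  proof (rule CF_ellI)
    show "fun_scale c f x = 0" if "x \<notin> G" for x using CF_ellD(1)[OF f that] by (simp add: fun_scale_def)
    show "fun_scale c f x = fun_scale c f y" if "x \<in> G" "y \<in> G" "ell r \<zeta> n x = ell r \<zeta> n y" for x y
      using CF_ellD(2)[OF f that] by (simp add: fun_scale_def)
  qed
qed

lemma class_value_eq:
  assumes "f \<in> CF_ell r \<zeta> n" "x \<in> ell_class r \<zeta> n i"
  shows "class_value r \<zeta> n f i = f x"
  unfolding class_value_def
proof (rule the_equality)
  show "\<forall>y\<in>ell_class r \<zeta> n i. f y = f x"
    using assms by (auto simp: CF_ell_def ell_class_def)
qed (use assms(2) in auto)

lemma class_value_add:
  assumes "f \<in> CF_ell r \<zeta> n" "g \<in> CF_ell r \<zeta> n" "i \<le> n"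
  shows "class_value r \<zeta> n (f + g) i = class_value r \<zeta> n f i + class_value r \<zeta> n g i"
proof -
  obtain x where x: "x \<in> ell_class r \<zeta> n i" using ell_class_nonempty[OF assms(3)] by blast
  have fg: "f + g \<in> CF_ell r \<zeta> n" by (rule cfun.subspace_add[OF subspace_CF_ell assms(1,2)])
  show ?thesis
    unfolding class_value_eq[OF fg x] class_value_eq[OF assms(1) x] class_value_eq[OF assms(2) x]
    by (rule plus_fun_apply)
qed

lemma class_value_scale:
  assumes "f \<in> CF_ell r \<zeta> n" "i \<le> n"
  shows "class_value r \<zeta> n (fun_scale c f) i = c * class_value r \<zeta> n f i"
proof -
  obtain x where x: "x \<in> ell_class r \<zeta> n i" using ell_class_nonempty[OF assms(2)] by blast
  have cf: "fun_scale c f \<in> CF_ell r \<zeta> n" by (rule cfun.subspace_scale[OF subspace_CF_ell assms(1)])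
  show ?thesis
    unfolding class_value_eq[OF cf x] class_value_eq[OF assms(1) x] by (simp add: fun_scale_def)
qed

lemma foulkes_inner_add:
  assumes f: "f \<in> CF_ell r \<zeta> n" and g: "g \<in> CF_ell r \<zeta> n"
  shows "foulkes_inner r \<zeta> n (f + g) h = foulkes_inner r \<zeta> n f h + foulkes_inner r \<zeta> n g h"
    "foulkes_inner r \<zeta> n h (f + g) = foulkes_inner r \<zeta> n h f + foulkes_inner r \<zeta> n h g"
  unfolding foulkes_inner_def distrib_left[symmetric] sum.distrib[symmetric]
  by (rule arg_cong[where f = "(*) _"], rule sum.cong[OF refl], rule sum.cong[OF refl],
      simp add: class_value_add[OF f g] algebra_simps)+

lemma foulkes_inner_scale:
  assumes f: "f \<in> CF_ell r \<zeta> n"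
  shows "foulkes_inner r \<zeta> n (fun_scale c f) h = c * foulkes_inner r \<zeta> n f h"
    "foulkes_inner r \<zeta> n h (fun_scale c f) = cnj c * foulkes_inner r \<zeta> n h f"
  unfolding foulkes_inner_def mult.left_commute[of _ "1 / _"] sum_distrib_left
  by (rule sum.cong[OF refl], rule sum.cong[OF refl],
      simp add: class_value_scale[OF f] mult_ac)+

lemma foulkes_char_eq:
  assumes "x \<in> G"
  shows "foulkes_char r \<zeta> n i x = of_real (\<Sum>j=0..n. foulkes_coeff n i j * (1 + real r * real j) ^ ell r \<zeta> n x)"
  using assms unfolding foulkes_char_def foulkes_coeff_def
  by (simp, intro sum.cong refl) (simp add: add.commute)

lemma foulkes_char_mem: "foulkes_char r \<zeta> n i \<in> CF_ell r \<zeta> n"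
proof (rule CF_ellI)
  show "foulkes_char r \<zeta> n i x = 0" if "x \<notin> G" for x using that by (simp add: foulkes_char_def)
  show "foulkes_char r \<zeta> n i x = foulkes_char r \<zeta> n i y"
    if "x \<in> G" "y \<in> G" "ell r \<zeta> n x = ell r \<zeta> n y" for x y
    unfolding foulkes_char_eq[OF that(1)] foulkes_char_eq[OF that(2)] that(3) ..
qed

lemma class_value_foulkes_char:
  assumes "m \<le> n"
  shows "class_value r \<zeta> n (foulkes_char r \<zeta> n i) m =
    of_real (\<Sum>j=0..n. foulkes_coeff n i j * (1 + real r * real j) ^ m)"
proof -
  obtain x where x: "x \<in> ell_class r \<zeta> n m" using ell_class_nonempty[OF assms] by blast
  hence "x \<in> G" "ell r \<zeta> n x = m" by (auto simp: ell_class_def)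
  thus ?thesis using class_value_eq[OF foulkes_char_mem x] foulkes_char_eq by simp
qed

text \<open>By \<open>bilinear_mu\<close>, the functions (1 + rj)^ell have Gram matrix H^T H, where
  H has the entries \<open>hook_mult n h (Suc j)\<close> with row index h. By
  \<open>foulkes_coeff_hook_mult\<close>, passing to the Foulkes characters multiplies by the
  inverse of H on both sides. All class values are real, so the conjugation in the form has no
  effect on them.\<close>

lemma foulkes_inner_foulkes_char:
  assumes "i \<le> n" "k \<le> n"
  shows "foulkes_inner r \<zeta> n (foulkes_char r \<zeta> n i) (foulkes_char r \<zeta> n k) = (if i = k then 1 else 0)"
proof -
  let ?w = "foulkes_coeff n"
  define N where "N = real r ^ n * fact n"
  have N0: "N \<noteq> 0" using r2 by (simp add: N_def)
  have "(\<Sum>m=0..n. \<Sum>m'=0..n. (\<Sum>j=0..n. ?w i j * (1 + real r * real j) ^ m) *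
      (\<Sum>l=0..n. ?w k l * (1 + real r * real l) ^ m') * mu r \<zeta> n m m') =
    (\<Sum>m=0..n. \<Sum>m'=0..n. \<Sum>j=0..n. \<Sum>l=0..n. ?w i j * ?w k l *
      ((1 + real r * real j) ^ m * (1 + real r * real l) ^ m' * mu r \<zeta> n m m'))"
    unfolding sum_product unfolding sum_distrib_right by (intro sum.cong refl) (simp only: ac_simps)
  also have "\<dots> = (\<Sum>m=0..n. \<Sum>j=0..n. \<Sum>l=0..n. \<Sum>m'=0..n. ?w i j * ?w k l *
      ((1 + real r * real j) ^ m * (1 + real r * real l) ^ m' * mu r \<zeta> n m m'))"
    by (rule sum.cong[OF refl], rule trans[OF sum.swap sum.cong[OF refl sum.swap]])
  also have "\<dots> = (\<Sum>j=0..n. \<Sum>l=0..n. \<Sum>m=0..n. \<Sum>m'=0..n. ?w i j * ?w k l *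
      ((1 + real r * real j) ^ m * (1 + real r * real l) ^ m' * mu r \<zeta> n m m'))"
    by (rule trans[OF sum.swap sum.cong[OF refl sum.swap]])
  also have "\<dots> = (\<Sum>j=0..n. \<Sum>l=0..n. ?w i j * ?w k l * bilinear j l (mu r \<zeta> n))"
    unfolding bilinear_def sum_distrib_left ..
  also have "\<dots> = N * (\<Sum>j=0..n. \<Sum>l=0..n. \<Sum>h=0..n. (?w i j * hook_mult n h (Suc j)) * (?w k l * hook_mult n h (Suc l)))"
    unfolding bilinear_mu target_term_def N_def sum_distrib_left by (intro sum.cong refl) (simp only: ac_simps)
  also have "(\<Sum>j=0..n. \<Sum>l=0..n. \<Sum>h=0..n. (?w i j * hook_mult n h (Suc j)) * (?w k l * hook_mult n h (Suc l))) =
      (\<Sum>h=0..n. (\<Sum>j=0..n. ?w i j * hook_mult n h (Suc j)) * (\<Sum>l=0..n. ?w k l * hook_mult n h (Suc l)))"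
    unfolding sum_product by (rule trans[OF sum.cong[OF refl sum.swap] sum.swap])
  also have "\<dots> = (\<Sum>h=0..n. (if i = h then 1 else 0) * (if k = h then 1 else 0))"
    by (intro sum.cong refl arg_cong2[of _ _ _ _ "(*)"] foulkes_coeff_hook_mult) (use assms in auto)
  also have "\<dots> = (\<Sum>h=0..n. if i = h then (if i = k then 1 else 0) else 0)"
    by (intro sum.cong refl) auto
  also have "\<dots> = (if i = k then 1 else 0)" using assms by simp
  finally have S: "(\<Sum>m=0..n. \<Sum>m'=0..n. (\<Sum>j=0..n. ?w i j * (1 + real r * real j) ^ m) *
      (\<Sum>l=0..n. ?w k l * (1 + real r * real l) ^ m') * mu r \<zeta> n m m') = N * (if i = k then 1 else 0)" .
  have "foulkes_inner r \<zeta> n (foulkes_char r \<zeta> n i) (foulkes_char r \<zeta> n k) =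
    1 / of_nat (card G) * of_real (\<Sum>m=0..n. \<Sum>m'=0..n. (\<Sum>j=0..n. ?w i j * (1 + real r * real j) ^ m) *
      (\<Sum>l=0..n. ?w k l * (1 + real r * real l) ^ m') * mu r \<zeta> n m m')"
    unfolding foulkes_inner_def of_real_sum
    by (intro arg_cong[where f = "(*) _"] sum.cong refl)
       (simp only: class_value_foulkes_char atLeastAtMost_iff complex_cnj_complex_of_real of_real_mult)
  also have "of_nat (card G) = complex_of_real N"
    unfolding card_refl_group N_def by (simp add: mult.commute)
  finally show ?thesis unfolding S using N0 by simp
qed

definition ell_indicator :: "nat \<Rightarrow> complex mat \<Rightarrow> complex" where
  "ell_indicator i x = (if x \<in> ell_class r \<zeta> n i then 1 else 0)"

text \<open>Provides the dimension bound n + 1 by which n + 1 orthonormal characters must span the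
  space.\<close>

lemma CF_ell_subset_span: "CF_ell r \<zeta> n \<subseteq> cfun.span (ell_indicator ` {0..n})"
proof
  fix f assume f: "f \<in> CF_ell r \<zeta> n"
  have "f = (\<Sum>i\<in>{0..n}. fun_scale (class_value r \<zeta> n f i) (ell_indicator i))"
  proof
    fix x
    have "(\<Sum>i\<in>{0..n}. fun_scale (class_value r \<zeta> n f i) (ell_indicator i)) x =
        (\<Sum>i\<in>{0..n}. fun_scale (class_value r \<zeta> n f i) (ell_indicator i) x)"
    proof -
      have "(\<Sum>i\<in>K. F i) x = (\<Sum>i\<in>K. F i x)" if "finite K" for K and F :: "nat \<Rightarrow> complex mat \<Rightarrow> complex"
        using that by (induction K rule: finite_induct) simp_all
      thus ?thesis by (simp only: finite_atLeastAtMost)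
    qed
    also have "\<dots> = f x"
    proof (cases "x \<in> G")
      case True
      have "(\<Sum>i\<in>{0..n}. fun_scale (class_value r \<zeta> n f i) (ell_indicator i) x) =
          (\<Sum>i\<in>{0..n}. if i = ell r \<zeta> n x then f x else 0)"
      proof (rule sum.cong[OF refl])
        fix i
        show "fun_scale (class_value r \<zeta> n f i) (ell_indicator i) x = (if i = ell r \<zeta> n x then f x else 0)"
        proof (cases "i = ell r \<zeta> n x")
          case i: True
          hence "x \<in> ell_class r \<zeta> n i" using True by (simp add: ell_class_def)
          thus ?thesis using class_value_eq[OF f] i by (simp add: fun_scale_def ell_indicator_def)
        qed (simp add: fun_scale_def ell_indicator_def ell_class_def)
      qed
      also have "\<dots> = f x" using ell_le[OF True] by simp
      finally show ?thesis .
    next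
      case False
      thus ?thesis using CF_ellD(1)[OF f False] by (simp add: fun_scale_def ell_indicator_def ell_class_def)
    qed
    finally show "f x = (\<Sum>i\<in>{0..n}. fun_scale (class_value r \<zeta> n f i) (ell_indicator i)) x" ..
  qed
  also have "\<dots> \<in> cfun.span (ell_indicator ` {0..n})"
    by (intro cfun.span_sum cfun.span_scale cfun.span_base) auto
  finally show "f \<in> cfun.span (ell_indicator ` {0..n})" .
qed

end

theorem theorem3p11:
  fixes r n :: nat and \<zeta> :: complex
  assumes "r \<ge> 2" and "n \<ge> 1" and "primitive_root_of_unity r \<zeta>"
  shows "hilbert_space_on (CF_ell r \<zeta> n) (foulkes_inner r \<zeta> n) \<and>
    orthonormal_basis_on (CF_ell r \<zeta> n) (foulkes_inner r \<zeta> n) {0..n} (foulkes_char r \<zeta> n)"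
proof -
  interpret complex_reflection r n \<zeta> by unfold_locales (fact assms)+
  show ?thesis
  proof (rule hilbert_space_orthonormal_basis[OF subspace_CF_ell])
    show "finite (ell_indicator ` {0..n})" by simp
    show "card (ell_indicator ` {0..n}) \<le> card {0..n}" by (rule card_image_le) simp
    show "CF_ell r \<zeta> n \<subseteq> cfun.span (ell_indicator ` {0..n})" by (rule CF_ell_subset_span)
    show "foulkes_inner r \<zeta> n (foulkes_char r \<zeta> n i) (foulkes_char r \<zeta> n k) = (if i = k then 1 else 0)"
      if "i \<in> {0..n}" "k \<in> {0..n}" for i k
      using that by (intro foulkes_inner_foulkes_char) simp_all
  qed (simp_all only: foulkes_char_mem foulkes_inner_add foulkes_inner_scale finite_atLeastAtMost)
qed

end
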